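(* Let $(\mu_n)$ be either $\mu_n^{\mathrm{ball}(\alpha,d)}$ or $\mu_n^{\mathrm{perc}(\alpha,d)}$. Let $\Gamma$ be any compact subset of $(\mathrm{Sim}^c_d)^m$ such that for all $F\in\Gamma$ the self-similar set $E_F$ is not contained in a hyperplane, hits the interior of $\operatorname{supp}\mu_0$, and has Hausdorff dimension $>\alpha$. Then there is a positive probability that $\operatorname{supp}\mu_\infty\cap E_F\neq\varnothing$ for all $F\in\Gamma$.
   Context: $\mathrm{Sim}^c_d$ is the set of contracting similarities of $\mathbb{R}^d$; for $F=(F_1,\dots,F_m)$, $\Pi_F:\{1,\dots,m\}^{\mathbb{N}}\to\mathbb{R}^d$, $\Pi_F(i_1i_2\dots)=\lim_N F_{i_1}\circ\cdots\circ F_{i_N}(0)$, $E_F=\Pi_F(\{1,\dots,m\}^{\mathbb{N}})$; $(\mathrm{Sim}^c_d)^m$ carries the metric $\sup|\Pi_F-\Pi_G|$. Ball cutout $\mu_n^{\mathrm{ball}(\alpha,d)}$ ($0<\alpha$): let $r>0$ and let $\mathcal{Y}$ be a Poisson point process of balls whose intensity is the push-forward of $r\,\mathcal{L}^d\times\frac{ds}{s}$ on $\mathbb{R}^d\times(0,\infty)$ under $(t,s)\mapsto B(st,s/2)$. Set $A_n=B(0,1)\setminus\bigcup\{B\in\mathcal{Y}:2^{-n}\le\operatorname{diam}B<1\}$, $\alpha=r\,\mathcal{L}^d(B(0,1/2))$, $\mu_n=2^{\alpha n}\mathbf{1}_{A_n}$; thus $\mu_0=\mathbf{1}_{B(0,1)}$.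 Fractal percolation $\mu_n^{\mathrm{perc}(\alpha,d)}$: with $p=2^{-\alpha}$, start from $A_0=[0,1]^d$; given $A_n$ (a union of dyadic cubes of side $2^{-n}$), each dyadic subcube of side $2^{-(n+1)}$ of a retained cube is retained independently with probability $p$, and $A_{n+1}$ is the union of the retained cubes; $\mu_n=p^{-n}\mathbf{1}_{A_n}$. In both cases $\mu_\infty$ is the a.s. weak limit of the measures $\mu_n(x)dx$. *)

theory Defs
  imports "HOL-Analysis.Analysis" "HOL-Probability.Probability"
begin

definition contracting_similarity :: "('a::euclidean_space \<Rightarrow> 'a) \<Rightarrow> bool" where
  "contracting_similarity f \<longleftrightarrow>
     (\<exists>c. 0 < c \<and> c < 1 \<and> (\<forall>x y. dist (f x) (f y) = c * dist x y))"

definition sim_tuples :: "nat \<Rightarrow> ('a::euclidean_space \<Rightarrow> 'a) list set" where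
  "sim_tuples m = {F. length F = m \<and> (\<forall>f\<in>set F. contracting_similarity f)}"

definition codes :: "nat \<Rightarrow> (nat \<Rightarrow> nat) set" where
  "codes m = {w. \<forall>i. w i < m}"

fun comp_prefix :: "('a \<Rightarrow> 'a) list \<Rightarrow> (nat \<Rightarrow> nat) \<Rightarrow> nat \<Rightarrow> 'a \<Rightarrow> 'a" where
  "comp_prefix F w 0 = id"
| "comp_prefix F w (Suc N) = comp_prefix F w N \<circ> (F ! w N)"

definition ifs_proj :: "('a::euclidean_space \<Rightarrow> 'a) list \<Rightarrow> (nat \<Rightarrow> nat) \<Rightarrow> 'a" where
  "ifs_proj F w = lim (\<lambda>N. comp_prefix F w N 0)"

definition attractor :: "('a::euclidean_space \<Rightarrow> 'a) list \<Rightarrow> 'a set" where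
  "attractor F = ifs_proj F ` codes (length F)"

definition ifs_dist :: "('a::euclidean_space \<Rightarrow> 'a) list \<Rightarrow> ('a \<Rightarrow> 'a) list \<Rightarrow> real" where
  "ifs_dist F G = (SUP w\<in>codes (length F). norm (ifs_proj F w - ifs_proj G w))"

definition ifs_compact :: "('a::euclidean_space \<Rightarrow> 'a) list set \<Rightarrow> bool" where
  "ifs_compact G \<longleftrightarrow>
     (\<forall>s. (\<forall>n. s n \<in> G) \<longrightarrow>
        (\<exists>(r::nat \<Rightarrow> nat) l. strict_mono r \<and> l \<in> G \<and> (\<lambda>n. ifs_dist (s (r n)) l) \<longlonglongrightarrow> 0))"

definition in_hyperplane :: "'a::euclidean_space set \<Rightarrow> bool" where
  "in_hyperplane E \<longleftrightarrow> (\<exists>a b. a \<noteq> 0 \<and> E \<subseteq> {x. inner a x = b})"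

definition hausdorff_content :: "real \<Rightarrow> real \<Rightarrow> 'a::euclidean_space set \<Rightarrow> ennreal" where
  "hausdorff_content s \<delta> E =
     (INF C\<in>{C :: nat \<Rightarrow> 'a set. E \<subseteq> (\<Union>i. C i) \<and> (\<forall>i. bounded (C i) \<and> diameter (C i) \<le> \<delta>)}.
        (\<Sum>i. ennreal (diameter (C i) powr s)))"

definition hausdorff_measure :: "real \<Rightarrow> 'a::euclidean_space set \<Rightarrow> ennreal" where
  "hausdorff_measure s E = (SUP \<delta>\<in>{0<..}. hausdorff_content s \<delta> E)"

definition hausdorff_dim :: "'a::euclidean_space set \<Rightarrow> real" where
  "hausdorff_dim E = Inf {s. 0 < s \<and> hausdorff_measure s E = 0}"

definition msupp :: "'a::metric_space measure \<Rightarrow> 'a set" where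
  "msupp \<mu> = {x. \<forall>e>0. emeasure \<mu> (ball x e) > 0}"

definition weak_conv_measures :: "(nat \<Rightarrow> 'a::euclidean_space measure) \<Rightarrow> 'a measure \<Rightarrow> bool" where
  "weak_conv_measures \<mu>s \<mu> \<longleftrightarrow>
     (\<forall>f::'a \<Rightarrow> real. continuous_on UNIV f \<and> bounded (range f) \<longrightarrow>
        (\<lambda>n. integral\<^sup>L (\<mu>s n) f) \<longlonglongrightarrow> integral\<^sup>L \<mu> f)"

definition ppp_intensity :: "real \<Rightarrow> ('a::euclidean_space \<times> real) measure" where
  "ppp_intensity r = density (lborel \<Otimes>\<^sub>M lborel)
      (\<lambda>(t, s). if 0 < s then ennreal (r / s) else 0)"

definition pcount :: "('w \<Rightarrow> 'b set) \<Rightarrow> 'b set \<Rightarrow> 'w \<Rightarrow> ennreal" where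
  "pcount Y B \<omega> = emeasure (count_space UNIV) (Y \<omega> \<inter> B)"

definition poisson_point_process :: "'w measure \<Rightarrow> 'b measure \<Rightarrow> ('w \<Rightarrow> 'b set) \<Rightarrow> bool" where
  "poisson_point_process M \<nu> Y \<longleftrightarrow>
     (\<forall>B\<in>sets \<nu>. pcount Y B \<in> borel_measurable M) \<and>
     (\<forall>B\<in>sets \<nu>. emeasure \<nu> B < \<infinity> \<longrightarrow>
        (\<forall>k::nat. measure M {\<omega>\<in>space M. pcount Y B \<omega> = of_nat k} =
            exp (- enn2real (emeasure \<nu> B)) * enn2real (emeasure \<nu> B) ^ k / fact k)) \<and>
     (\<forall>(B :: nat \<Rightarrow> 'b set) k. (\<forall>i<k. B i \<in> sets \<nu>) \<and> disjoint_family_on B {..<k} \<longrightarrow>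
        prob_space.indep_vars M (\<lambda>_. borel) (\<lambda>i. pcount Y (B i)) {..<k})"

definition cutout_set :: "('w \<Rightarrow> ('a::euclidean_space \<times> real) set) \<Rightarrow> 'w \<Rightarrow> nat \<Rightarrow> 'a set" where
  "cutout_set Y \<omega> n = ball 0 1 -
     \<Union>{ball (s *\<^sub>R t) (s / 2) | t s. (t, s) \<in> Y \<omega> \<and> 2 powr (- real n) \<le> s \<and> s < 1}"

definition ball_cutout_model ::
    "'w measure \<Rightarrow> real \<Rightarrow> (nat \<Rightarrow> 'w \<Rightarrow> 'a::euclidean_space \<Rightarrow> real) \<Rightarrow> bool" where
  "ball_cutout_model M \<alpha> \<mu> \<longleftrightarrow>
     (\<exists>r Y. 0 < r \<and> \<alpha> = r * measure lborel (ball (0::'a) (1/2)) \<and>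
        poisson_point_process M (ppp_intensity r) Y \<and>
        (\<forall>n \<omega> x. \<mu> n \<omega> x = 2 powr (\<alpha> * real n) * indicator (cutout_set Y \<omega> n) x))"

definition dyadic_cube :: "nat \<Rightarrow> ('a::euclidean_space \<Rightarrow> nat) \<Rightarrow> 'a set" where
  "dyadic_cube n k = {x. \<forall>i\<in>Basis. real (k i) / 2 ^ n \<le> x \<bullet> i \<and> x \<bullet> i \<le> (real (k i) + 1) / 2 ^ n}"

definition dyadic_index :: "nat \<Rightarrow> ('a::euclidean_space \<Rightarrow> nat) set" where
  "dyadic_index n = {k. (\<forall>i\<in>Basis. k i < 2 ^ n) \<and> (\<forall>i. i \<notin> Basis \<longrightarrow> k i = 0)}"

definition perc_index :: "(nat \<times> ('a::euclidean_space \<Rightarrow> nat)) set" where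
  "perc_index = {(n, k). 1 \<le> n \<and> k \<in> dyadic_index n}"

text \<open>A_n: union of level-n cubes all of whose ancestors (and itself) are retained.\<close>
definition perc_set :: "(nat \<times> ('a::euclidean_space \<Rightarrow> nat) \<Rightarrow> 'w \<Rightarrow> bool) \<Rightarrow> 'w \<Rightarrow> nat \<Rightarrow> 'a set" where
  "perc_set X \<omega> n = \<Union>{dyadic_cube n k | k. k \<in> dyadic_index n \<and>
       (\<forall>j\<in>{1..n}. X (j, \<lambda>i. k i div 2 ^ (n - j)) \<omega>)}"

definition fractal_percolation_model ::
    "'w measure \<Rightarrow> real \<Rightarrow> (nat \<Rightarrow> 'w \<Rightarrow> 'a::euclidean_space \<Rightarrow> real) \<Rightarrow> bool" where
  "fractal_percolation_model M \<alpha> \<mu> \<longleftrightarrow>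
     (\<exists>X. prob_space.indep_vars M (\<lambda>_. count_space UNIV) X perc_index \<and>
        (\<forall>c\<in>perc_index. measure M {\<omega>\<in>space M. X c \<omega>} = 2 powr (- \<alpha>)) \<and>
        (\<forall>n \<omega> x. \<mu> n \<omega> x = (2 powr (- \<alpha>)) powr (- real n) * indicator (perc_set X \<omega> n) x))"

end

theory Submission
  imports Defs "HOL-Library.Omega_Words_Fun" "HOL-Real_Asymp.Real_Asymp"
begin

text \<open>
  The mass that a measure carried by a self-similar set retains after \<open>n\<close> levels of the random
  construction is followed for a whole family of tuples \<open>F\<close>, and of their small translates, at once.
  A self-similar set of dimension above \<open>\<alpha>\<close> contains separated pieces, coded by finitely many words,
  whose uniform weights satisfy a Frostman condition with an exponent \<open>s > \<alpha>\<close> and charge no thin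
  neighbourhood of a hyperplane; both properties persist, with the same words and constants, for all
  nearby tuples. Given the first \<open>n\<close> levels, the mass that survives level \<open>n + 1\<close> is a sum of small,
  almost independent terms, so Hoeffding's inequality bounds the probability of losing more than the
  expected factor \<open>2 powr - \<alpha> * (1 - o(1))\<close> by \<open>exp (- 2 powr (c * n))\<close>, while at the scale
  \<open>2 powr - n\<^sup>2\<close> the family is represented by \<open>exp (O(n\<^sup>2))\<close> of its members. Continuity of the mass in
  the parameter is replaced by monotonicity: the surviving set of level \<open>n\<close> is eroded by \<open>2 powr - n\<^sup>2\<close>,
  and a change of the parameter only uses up a part of this erosion.

  The chain starts from the event that nothing is removed up to a late level \<open>n0\<close>. It has positive
  probability, and conditionally on it all later losses together are unlikely. Averaging the mass over
  the translates bounds the limit measure of every neighbourhood of the set from below, so the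
  support of the limit meets the set by compactness. Percolation and ball cutouts are both given by
  independent removals; for the balls, the Poisson points are grouped into small cells, so that every
  level consists of finitely many removals.
\<close>

section \<open>Self-similar sets and their codings\<close>

text \<open>A point of the set that survives all levels need not lie in the support of the limit,
  which only sees Lebesgue mass. This is why whole measures and all their small translates are
  followed: by Fubini, a bound \<open>1/2 * 2 powr (- \<alpha> * (n - n0))\<close> for the surviving
  mass of every small translate bounds the Lebesgue measure of the surviving set near the attractor,
  and the density factor \<open>2 powr (\<alpha> * n)\<close> makes the result independent of
  \<open>n\<close>. The exponents fit as follows. Write \<open>s = \<alpha> + 4 * \<beta>\<close>.
  Balls of radius about \<open>2 powr (- n)\<close> have mass at most of order
  \<open>2 powr (- s * n)\<close>, the surviving mass is at least of order
  \<open>2 powr (- \<alpha> * n)\<close>, and a relative deviation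
  \<open>2 powr (- \<beta> * n)\<close>, summable in \<open>n\<close>, is tolerated. Hoeffding's
  exponent is then of order \<open>2 powr (2 * \<beta> * n)\<close>. All estimates go from below, so
  removing more than the model removes is harmless. This permits closed cubes, erosion, and the
  replacement of a Poisson point by its whole cell.\<close>

definition similarity :: "real \<Rightarrow> ('a::euclidean_space \<Rightarrow> 'a) \<Rightarrow> bool" where
  "similarity c f \<longleftrightarrow> (\<forall>x y. dist (f x) (f y) = c * dist x y)"

text \<open>Basis vectors have norm 1, so for a similarity the two images are exactly one ratio
  apart.\<close>

definition sim_ratio :: "('a::euclidean_space \<Rightarrow> 'a) \<Rightarrow> real" where
  "sim_ratio f = dist (f 0) (f (SOME b. b \<in> Basis))"

lemma some_Basis: "(SOME b. b \<in> Basis) \<in> (Basis :: 'a::euclidean_space set)"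
  using nonempty_Basis by (metis ex_in_conv someI_ex)

lemma similarity_ratio: "similarity c f \<Longrightarrow> sim_ratio f = c"
  using some_Basis by (simp add: similarity_def sim_ratio_def dist_norm)

lemma contracting_similarityD:
  assumes "contracting_similarity f"
  shows "0 < sim_ratio f" "sim_ratio f < 1" "similarity (sim_ratio f) f"
proof -
  obtain c where c: "0 < c" "c < 1" "similarity c f"
    using assms unfolding contracting_similarity_def similarity_def by blast
  then show "0 < sim_ratio f" "sim_ratio f < 1" "similarity (sim_ratio f) f"
    unfolding similarity_ratio[OF c(3)] by simp_all
qed

lemma similarity_orthogonal:
  assumes "similarity c f" "0 < c"
  obtains g where "orthogonal_transformation g" "\<And>x. f x = f 0 + c *\<^sub>R g x"
proof -
  define g where "g x = (1 / c) *\<^sub>R (f x - f 0)" for x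
  have d: "dist (g x) (g y) = dist x y" for x y
  proof -
    have "g x - g y = (1 / c) *\<^sub>R (f x - f y)" by (simp add: g_def algebra_simps)
    then have "dist (g x) (g y) = (1 / c) * dist (f x) (f y)" using assms by (simp add: dist_norm)
    then show ?thesis using assms by (simp add: similarity_def)
  qed
  have g0: "g 0 = 0" by (simp add: g_def)
  have "orthogonal_transformation g"
    unfolding orthogonal_transformation_isometry using d g0 by auto
  moreover have "f x = f 0 + c *\<^sub>R g x" for x using assms by (simp add: g_def)
  ultimately show ?thesis using that by blast
qed

text \<open>\<open>a'\<close> is the adjoint of the orthogonal part of \<open>f\<close> applied to
  \<open>a\<close>, hence of the same norm. A strip of width \<eta> around a hyperplane thus pulls
  back under \<open>f\<close> to a strip of width \<open>\<eta> / c\<close>, the step on which the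
  counts near hyperplanes rest.\<close>

lemma similarity_inner:
  assumes "similarity c f" "0 < c"
  obtains a' where "norm a' = norm a" "\<And>x. inner a (f x) = inner a (f 0) + c * inner a' x"
proof -
  obtain g where g: "orthogonal_transformation g" "\<And>x. f x = f 0 + c *\<^sub>R g x"
    using similarity_orthogonal[OF assms] by blast
  have lin: "linear g" using g(1) by (simp add: orthogonal_transformation_linear)
  define a' where "a' = adjoint g a"
  have ad: "inner a' x = inner a (g x)" for x
    unfolding a'_def using adjoint_works[OF lin, of x a] by (simp add: inner_commute)
  obtain z where z: "g z = a"
    using surjD[OF orthogonal_transformation_surj[OF g(1)], of a] by auto
  have "a' = z"
  proof -
    have "inner (a' - z) x = 0" for x
      using ad[of x] g(1) z by (auto simp: orthogonal_transformation_def inner_diff_left)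
    from this[of "a' - z"] show ?thesis by simp
  qed
  then have "norm a' = norm a" using orthogonal_transformation_norm[OF g(1), of z] z by simp
  moreover have "inner a (f x) = inner a (f 0) + c * inner a' x" for x
    by (subst g(2)) (simp add: inner_add_right ad)
  ultimately show ?thesis using that by blast
qed

text \<open>A similarity is affine, so finitely many numbers, the coordinates of its values at 0 and
  at the basis vectors, determine it. The nets of parameters are built from these numbers.\<close>

lemma similarity_coordinates:
  assumes "similarity c f" "0 < c"
  shows "f x = f 0 + (\<Sum>b\<in>Basis. (x \<bullet> b) *\<^sub>R (f b - f 0))"
proof -
  obtain g where g: "orthogonal_transformation g" "\<And>x. f x = f 0 + c *\<^sub>R g x"
    using similarity_orthogonal[OF assms] by blast
  have lin: "linear g" using g(1) by (simp add: orthogonal_transformation_linear)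
  have "g x = g (\<Sum>b\<in>Basis. (x \<bullet> b) *\<^sub>R b)" by (simp add: euclidean_representation)
  also have "\<dots> = (\<Sum>b\<in>Basis. (x \<bullet> b) *\<^sub>R g b)"
    by (simp add: linear_sum[OF lin] linear_scale[OF lin])
  finally have gx: "c *\<^sub>R g x = (\<Sum>b\<in>Basis. (x \<bullet> b) *\<^sub>R (c *\<^sub>R g b))"
    by (simp add: scaleR_sum_right mult.commute)
  have gb: "c *\<^sub>R g b = f b - f 0" for b using g(2)[of b] by (metis add_diff_cancel_left')
  show ?thesis unfolding gb[symmetric] gx[symmetric] by (rule g(2))
qed

section \<open>Words, codes and the coding map\<close>

definition wmap :: "('a \<Rightarrow> 'a) list \<Rightarrow> nat list \<Rightarrow> 'a \<Rightarrow> 'a" where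
  "wmap F u = foldr (\<lambda>i f. (F ! i) \<circ> f) u id"

definition wratio :: "('a::euclidean_space \<Rightarrow> 'a) list \<Rightarrow> nat list \<Rightarrow> real" where
  "wratio F u = (\<Prod>i\<leftarrow>u. sim_ratio (F ! i))"

lemma wmap_simps [simp]: "wmap F [] = id" "wmap F (i # u) = (F ! i) \<circ> wmap F u"
  by (simp_all add: wmap_def)

lemma wratio_simps [simp]: "wratio F [] = 1" "wratio F (i # u) = sim_ratio (F ! i) * wratio F u"
  "wratio F (u @ v) = wratio F u * wratio F v"
  by (simp_all add: wratio_def)

lemma wmap_append: "wmap F (u @ v) = wmap F u \<circ> wmap F v"
  by (induction u) (auto simp: o_assoc)

lemma comp_prefix_eq_wmap: "comp_prefix F w N = wmap F (map w [0..<N])"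
  by (induction N) (auto simp: wmap_append)

abbreviation words :: "nat \<Rightarrow> nat list set" where "words m \<equiv> lists {..<m}"

lemma conc_codes: "u \<in> words m \<Longrightarrow> w \<in> codes m \<Longrightarrow> u \<frown> w \<in> codes m"
  by (auto simp: codes_def conc_def in_lists_conv_set)

lemma codes_suffix: "w \<in> codes m \<Longrightarrow> (\<lambda>i. w (i + N)) \<in> codes m"
  by (auto simp: codes_def)

lemma codes_prefix: "w \<in> codes m \<Longrightarrow> map w [0..<N] \<in> words m"
  by (auto simp: codes_def)

lemma codes_split: "w = map w [0..<N] \<frown> (\<lambda>i. w (i + N))"
  by (auto simp: conc_def)

text \<open>\<open>base_le\<close> makes the ball of radius \<open>R\<close> about 0 invariant,
  since \<open>(1 - c) * R + c * R = R\<close>. The constants \<open>c\<close> and \<open>R\<close>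
  are parameters so that one pair can serve a whole family of tuples.\<close>

locale ifs =
  fixes F :: "('a::euclidean_space \<Rightarrow> 'a) list" and m :: nat and c R :: real
  assumes F: "F \<in> sim_tuples m" and c: "0 < c" "c < 1" and R: "0 \<le> R"
    and ratio_le: "\<And>i. i < m \<Longrightarrow> sim_ratio (F ! i) \<le> c"
    and base_le: "\<And>i. i < m \<Longrightarrow> norm ((F ! i) 0) \<le> (1 - c) * R"
begin

lemma len: "length F = m"
  using F by (simp add: sim_tuples_def)

lemma letter:
  assumes "i < m"
  shows "0 < sim_ratio (F ! i)" "sim_ratio (F ! i) < 1" "similarity (sim_ratio (F ! i)) (F ! i)"
  using assms F contracting_similarityD[of "F ! i"] by (auto simp: sim_tuples_def)

lemma word_similarity: "u \<in> words m \<Longrightarrow> similarity (wratio F u) (wmap F u)"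
  using letter by (induction u) (auto simp: similarity_def)

lemma wratio_pos: "u \<in> words m \<Longrightarrow> 0 < wratio F u"
  using letter by (induction u) auto

lemma wratio_le: "u \<in> words m \<Longrightarrow> wratio F u \<le> c ^ length u"
proof (induction u)
  case (Cons i u)
  then show ?case using ratio_le[of i] letter[of i] wratio_pos[of u] c by (auto intro!: mult_mono)
qed simp

lemma dist_wmap: "u \<in> words m \<Longrightarrow> dist (wmap F u x) (wmap F u y) = wratio F u * dist x y"
  using word_similarity by (simp add: similarity_def)

lemma letter_cball:
  assumes "i < m" "norm x \<le> R" shows "norm ((F ! i) x) \<le> R"
proof -
  have "norm ((F ! i) x) \<le> norm ((F ! i) 0) + dist ((F ! i) x) ((F ! i) 0)"
    by (metis dist_norm norm_triangle_sub)
  also have "dist ((F ! i) x) ((F ! i) 0) = sim_ratio (F ! i) * norm x"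
    using letter(3)[OF assms(1)] by (simp add: similarity_def)
  also have "\<dots> \<le> c * R"
    using assms ratio_le letter[OF assms(1)] c by (intro mult_mono) auto
  finally show ?thesis using base_le[OF assms(1)] by (simp add: algebra_simps)
qed

lemma word_cball: "u \<in> words m \<Longrightarrow> norm x \<le> R \<Longrightarrow> norm (wmap F u x) \<le> R"
  using letter_cball by (induction u) auto

lemma word_dist_le:
  assumes "u \<in> words m" "norm x \<le> R" "norm y \<le> R"
  shows "dist (wmap F u x) (wmap F u y) \<le> c ^ length u * (2 * R)"
proof -
  have "dist x y \<le> 2 * R" using assms norm_triangle_ineq4[of x y] by (simp add: dist_norm)
  then show ?thesis
    using wratio_le[OF assms(1)] wratio_pos[OF assms(1)] R c by (simp add: dist_wmap assms mult_mono)
qed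

text \<open>All later prefixes map 0 into the image of the invariant ball under the first
  \<open>N\<close> letters, of diameter at most \<open>c ^ N * (2 * R)\<close>. Hence the
  \<open>lim\<close> in \<open>ifs_proj\<close> is a genuine limit.\<close>

lemma comp_prefix_tendsto:
  assumes w: "w \<in> codes m"
  shows "(\<lambda>N. comp_prefix F w N 0) \<longlonglongrightarrow> ifs_proj F w"
proof -
  have near: "dist (comp_prefix F w n 0) (comp_prefix F w N 0) \<le> c ^ N * (2 * R)" if "N \<le> n" for n N
  proof -
    have "map w [0..<n] = map w [0..<N] @ map w [N..<n]"
      using that by (metis le_add_diff_inverse map_append upt_add_eq_append zero_le)
    then have "comp_prefix F w n 0 = wmap F (map w [0..<N]) (wmap F (map w [N..<n]) 0)"
      by (simp add: comp_prefix_eq_wmap wmap_append)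
    moreover have "map w [N..<n] \<in> words m" using w by (auto simp: codes_def)
    ultimately show ?thesis
      using word_dist_le[OF codes_prefix[OF w, of N], of "wmap F (map w [N..<n]) 0" 0] word_cball[of "map w [N..<n]" 0] R
      by (simp add: comp_prefix_eq_wmap)
  qed
  have "Cauchy (\<lambda>N. comp_prefix F w N 0)"
  proof (rule metric_CauchyI)
    fix e :: real assume e: "0 < e"
    have "(\<lambda>N. c ^ N * (2 * R)) \<longlonglongrightarrow> 0 * (2 * R)" using c by (intro tendsto_mult_right LIMSEQ_realpow_zero) auto
    then have "eventually (\<lambda>N. c ^ N * (2 * R) < e / 2) sequentially"
      using e by (intro order_tendstoD(2)) auto
    then obtain N where N: "c ^ N * (2 * R) < e / 2" by (auto simp: eventually_sequentially)
    have "dist (comp_prefix F w n 0) (comp_prefix F w k 0) < e" if "N \<le> n" "N \<le> k" for n k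
      using near[OF that(1)] near[OF that(2)] N
        dist_triangle[of "comp_prefix F w n 0" "comp_prefix F w k 0" "comp_prefix F w N 0"]
      by (simp add: dist_commute)
    then show "\<exists>N. \<forall>n\<ge>N. \<forall>k\<ge>N. dist (comp_prefix F w n 0) (comp_prefix F w k 0) < e" by blast
  qed
  then show ?thesis
    unfolding ifs_proj_def using Cauchy_convergent convergent_LIMSEQ_iff by blast
qed

lemma proj_norm:
  assumes "w \<in> codes m" shows "norm (ifs_proj F w) \<le> R"
proof (rule tendsto_upperbound[OF tendsto_norm[OF comp_prefix_tendsto[OF assms]]])
  show "\<forall>\<^sub>F N in sequentially. norm (comp_prefix F w N 0) \<le> R"
    using word_cball[OF codes_prefix[OF assms], of 0] R by (simp add: comp_prefix_eq_wmap)
qed simp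

lemma proj_conc:
  assumes u: "u \<in> words m" and w: "w \<in> codes m"
  shows "ifs_proj F (u \<frown> w) = wmap F u (ifs_proj F w)"
proof -
  have "map (u \<frown> w) [0..<N + length u] = u @ map w [0..<N]" for N
    by (rule nth_equalityI) (auto simp: conc_def nth_append)
  then have e: "comp_prefix F (u \<frown> w) (N + length u) 0 = wmap F u (comp_prefix F w N 0)" for N
    by (simp add: comp_prefix_eq_wmap wmap_append)
  have cont: "isCont (wmap F u) x" for x
  proof -
    have "(wratio F u)-lipschitz_on UNIV (wmap F u)"
      using dist_wmap[OF u] wratio_pos[OF u] by (intro lipschitz_onI) auto
    then have "continuous_on UNIV (wmap F u)" by (rule lipschitz_on_continuous_on)
    then show ?thesis by (simp add: continuous_on_eq_continuous_at)
  qed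
  have "(\<lambda>N. wmap F u (comp_prefix F w N 0)) \<longlonglongrightarrow> wmap F u (ifs_proj F w)"
    by (rule isCont_tendsto_compose[OF cont comp_prefix_tendsto[OF w]])
  moreover have "(\<lambda>N. comp_prefix F (u \<frown> w) (N + length u) 0) \<longlonglongrightarrow> ifs_proj F (u \<frown> w)"
    by (rule LIMSEQ_ignore_initial_segment[OF comp_prefix_tendsto[OF conc_codes[OF u w]]])
  ultimately show ?thesis using LIMSEQ_unique by (simp add: e)
qed

lemma dist_proj_conc:
  assumes "u \<in> words m" "w \<in> codes m" "w' \<in> codes m"
  shows "dist (ifs_proj F (u \<frown> w)) (ifs_proj F (u \<frown> w')) = wratio F u * dist (ifs_proj F w) (ifs_proj F w')"
  using assms by (simp add: proj_conc dist_wmap)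

lemma dist_proj_le: "w \<in> codes m \<Longrightarrow> w' \<in> codes m \<Longrightarrow> dist (ifs_proj F w) (ifs_proj F w') \<le> 2 * R"
  using proj_norm[of w] proj_norm[of w'] norm_triangle_ineq4[of "ifs_proj F w" "ifs_proj F w'"]
  by (simp add: dist_norm)

lemma dist_proj_conc_le:
  assumes "u \<in> words m" "w \<in> codes m" "w' \<in> codes m"
  shows "dist (ifs_proj F (u \<frown> w)) (ifs_proj F (u \<frown> w')) \<le> c ^ length u * (2 * R)"
  using assms word_dist_le[OF assms(1)] proj_norm by (simp add: proj_conc)

text \<open>Codes that agree in their first \<open>N\<close> letters have images at most
  \<open>c ^ N * (2 * R)\<close> apart, and fixing finitely many coordinates is an open condition in
  the product topology.\<close>

lemma proj_continuous: "continuous_on (codes m) (ifs_proj F)"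
  unfolding continuous_on_topological
proof (intro ballI allI impI)
  fix w B assume w: "w \<in> codes m" and B: "open B" "ifs_proj F w \<in> B"
  obtain e where e: "0 < e" "ball (ifs_proj F w) e \<subseteq> B" using B openE by blast
  have "(\<lambda>N. c ^ N * (2 * R)) \<longlonglongrightarrow> 0 * (2 * R)" using c by (intro tendsto_mult_right LIMSEQ_realpow_zero) auto
  then have "eventually (\<lambda>N. c ^ N * (2 * R) < e) sequentially" using e by (intro order_tendstoD(2)) auto
  then obtain N where N: "c ^ N * (2 * R) < e" by (auto simp: eventually_sequentially)
  define A where "A = {w'. \<forall>i<N. w' i = w i}"
  have "open A"
  proof -
    have "A = (\<Inter>i<N. (\<lambda>w'. w' i) -` {w i})" by (auto simp: A_def)
    moreover have "open ((\<lambda>w'::nat \<Rightarrow> nat. w' i) -` {w i})" for i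
      by (intro open_vimage continuous_on_product_coordinates) (rule Topological_Spaces.open_discrete)
    ultimately show ?thesis by auto
  qed
  moreover have "ifs_proj F w' \<in> B" if w': "w' \<in> codes m" "w' \<in> A" for w'
  proof -
    define p s s' where "p = map w [0..<N]" and "s = (\<lambda>i. w (i + N))" and "s' = (\<lambda>i. w' (i + N))"
    have p: "p \<in> words m" "length p = N" using codes_prefix[OF w] by (simp_all add: p_def)
    have s: "s \<in> codes m" "s' \<in> codes m" using codes_suffix w w' by (auto simp: s_def s'_def)
    have "map w' [0..<N] = p" using w' by (auto simp: A_def p_def)
    then have "p \<frown> s' = w'" unfolding s'_def by (metis codes_split)
    moreover have "p \<frown> s = w" unfolding p_def s_def by (rule codes_split[symmetric])
    ultimately have "dist (ifs_proj F w) (ifs_proj F w') \<le> c ^ N * (2 * R)"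
      using dist_proj_conc_le[OF p(1) s] p(2) by simp
    then show ?thesis using N e by (auto simp: subset_eq)
  qed
  ultimately show "\<exists>A. open A \<and> w \<in> A \<and> (\<forall>y\<in>codes m. y \<in> A \<longrightarrow> ifs_proj F y \<in> B)"
    by (intro exI[of _ A]) (auto simp: A_def)
qed

lemma attractor_eq: "attractor F = ifs_proj F ` codes m"
  by (simp add: attractor_def len)

text \<open>By Tychonoff, since the codes form a product of finite sets and the coding map is
  continuous.\<close>

lemma attractor_compact: "compact (attractor F)"
proof -
  have "codes m = Pi\<^sub>E UNIV (\<lambda>_. {..<m})" by (auto simp: codes_def)
  then have "compactin (product_topology (\<lambda>_::nat. euclidean) UNIV) (codes m)"
    by (simp add: compactin_PiE finite_imp_compact)
  then have "compact (codes m)" by (simp add: euclidean_product_topology)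
  then show ?thesis
    unfolding attractor_eq by (rule compact_continuous_image[OF proj_continuous])
qed

end

lemma sim_tuple_ifs:
  assumes "F \<in> sim_tuples m"
  obtains c R where "ifs F m c R"
proof -
  \<comment> \<open>The extra element 1/2 keeps the maximum defined for the empty tuple and makes
    \<open>c\<close> positive.\<close>
  define c where "c = Max (insert (1/2) ((\<lambda>i. sim_ratio (F ! i)) ` {..<m}))"
  have sr: "sim_ratio (F ! i) < 1" if "i < m" for i
    using assms that contracting_similarityD[of "F ! i"] by (auto simp: sim_tuples_def)
  have c: "1/2 \<le> c" "\<And>i. i < m \<Longrightarrow> sim_ratio (F ! i) \<le> c" "c < 1"
    unfolding c_def by (rule Max_ge, simp, simp, rule Max_ge, simp, simp, subst Max_less_iff) (use sr in auto)
  define R where "R = Max (insert 0 ((\<lambda>i. norm ((F ! i) 0)) ` {..<m})) / (1 - c)"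
  have R: "0 \<le> R" "\<And>i. i < m \<Longrightarrow> norm ((F ! i) 0) \<le> (1 - c) * R"
    using c by (simp_all add: R_def pos_le_divide_eq del: Max_insert)
  have "ifs F m c R" by unfold_locales (use assms c R in auto)
  then show ?thesis using that by blast
qed

section \<open>The distance of tuples\<close>

lemma ifs_dist_bdd:
  assumes "F \<in> sim_tuples m" "G \<in> sim_tuples m"
  shows "bdd_above ((\<lambda>w. norm (ifs_proj F w - ifs_proj G w)) ` codes m)"
proof -
  obtain c R c' R' where "ifs F m c R" "ifs G m c' R'" using sim_tuple_ifs assms by metis
  then have "norm (ifs_proj F w - ifs_proj G w) \<le> R + R'" if "w \<in> codes m" for w
    using ifs.proj_norm[of F m c R w] ifs.proj_norm[of G m c' R' w] that norm_triangle_ineq4[of "ifs_proj F w" "ifs_proj G w"]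
    by linarith
  then show ?thesis by (auto intro!: bdd_aboveI)
qed

lemma dist_proj_le_ifs_dist:
  assumes "F \<in> sim_tuples m" "G \<in> sim_tuples m" "w \<in> codes m"
  shows "dist (ifs_proj F w) (ifs_proj G w) \<le> ifs_dist F G"
  using cSUP_upper[OF assms(3) ifs_dist_bdd[OF assms(1,2)]] assms
  by (simp add: ifs_dist_def sim_tuples_def dist_norm)

text \<open>For \<open>m = 0\<close> the supremum would run over the empty set, where its real value
  carries no information.\<close>

lemma ifs_dist_le:
  assumes "F \<in> sim_tuples m" "\<And>w. w \<in> codes m \<Longrightarrow> dist (ifs_proj F w) (ifs_proj G w) \<le> e" "0 < m"
  shows "ifs_dist F G \<le> e"
proof -
  have "(\<lambda>_. 0) \<in> codes m" using assms by (auto simp: codes_def)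
  then show ?thesis
    unfolding ifs_dist_def using assms by (intro cSUP_least) (auto simp: sim_tuples_def dist_norm)
qed

lemma ifs_dist_triangle:
  assumes "F \<in> sim_tuples m" "G \<in> sim_tuples m" "H \<in> sim_tuples m" "0 < m"
  shows "ifs_dist F H \<le> ifs_dist F G + ifs_dist H G"
proof (rule ifs_dist_le[OF assms(1) _ assms(4)])
  fix w assume w: "w \<in> codes m"
  show "dist (ifs_proj F w) (ifs_proj H w) \<le> ifs_dist F G + ifs_dist H G"
    using dist_proj_le_ifs_dist[OF assms(1,2) w] dist_proj_le_ifs_dist[OF assms(3,2) w]
      dist_triangle2[of "ifs_proj F w" "ifs_proj H w" "ifs_proj G w"] by linarith
qed

text \<open>\<open>separated\<close> and \<open>escape\<close> speak of whole cylinders, with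
  arbitrary continuations, so that they can be applied again inside every cylinder.
  \<open>escape\<close> also forces \<open>W\<close> to be non-empty and \<open>m\<close> to be
  positive.\<close>

locale subsystem = ifs F m c R
  for F :: "('a::euclidean_space \<Rightarrow> 'a) list" and m c R +
  fixes W :: "nat list set" and b g \<delta> :: real
  assumes finW: "finite W" and W: "W \<subseteq> words m" and Nil_W: "[] \<notin> W"
    and b: "0 < b" "b < 1" and g: "0 < g" and \<delta>: "0 < \<delta>"
    and ratio_ge: "\<And>u. u \<in> W \<Longrightarrow> b \<le> wratio F u"
    and separated: "\<And>u u' w w'. u \<in> W \<Longrightarrow> u' \<in> W \<Longrightarrow> u \<noteq> u' \<Longrightarrow> w \<in> codes m \<Longrightarrow> w' \<in> codes m \<Longrightarrow>
      g \<le> dist (ifs_proj F (u \<frown> w)) (ifs_proj F (u' \<frown> w'))"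
    and escape: "\<And>a t. norm a = 1 \<Longrightarrow> \<exists>u\<in>W. \<forall>w\<in>codes m. \<delta> < \<bar>a \<bullet> ifs_proj F (u \<frown> w) - t\<bar>"
begin

section \<open>Counting blocks near points and near hyperplanes\<close>

definition blocks :: "nat \<Rightarrow> nat list list set" where "blocks L = {us. set us \<subseteq> W \<and> length us = L}"

definition point :: "nat list list \<Rightarrow> 'a" where "point us = ifs_proj F (concat us \<frown> (\<lambda>_. 0))"

lemma finite_blocks: "finite (blocks L)"
  unfolding blocks_def by (rule finite_lists_length_eq[OF finW])

lemma card_blocks: "card (blocks L) = card W ^ L"
  unfolding blocks_def by (rule card_lists_length_eq[OF finW])

lemma m_pos: "0 < m"
proof -
  obtain a :: 'a where "norm a = 1" using vector_choose_size[of 1] by auto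
  then obtain u where "u \<in> W" using escape by blast
  then show ?thesis using W Nil_W by (cases u) auto
qed

lemma zero_code: "(\<lambda>_. 0) \<in> codes m"
  using m_pos by (simp add: codes_def)

text \<open>A word that escapes from a hyperplane through a point of the cylinder of
  \<open>u\<close> differs from \<open>u\<close>.\<close>

lemma card_W: "2 \<le> card W"
proof -
  obtain a :: 'a where a: "norm a = 1" using vector_choose_size[of 1] by auto
  then obtain u where u: "u \<in> W" using escape by blast
  obtain v where v: "v \<in> W" "\<forall>w\<in>codes m. \<delta> < \<bar>a \<bullet> ifs_proj F (v \<frown> w) - a \<bullet> ifs_proj F (u \<frown> (\<lambda>_. 0))\<bar>"
    using escape[OF a] by blast
  then have "u \<noteq> v" using zero_code \<delta> by fastforce
  then have "card {u, v} = 2" by simp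
  then show ?thesis using card_mono[OF finW, of "{u, v}"] u v by simp
qed

lemma concat_words: "set us \<subseteq> W \<Longrightarrow> concat us \<in> words m"
  using W by (induction us) auto

text \<open>The sequences first differ at one of the first \<open>k\<close> blocks. What follows
  there is \<open>g\<close> apart, and each of the at most \<open>k - 1\<close> common blocks before
  it multiplies distances by at least \<open>b\<close>.\<close>

lemma separated_blocks:
  assumes "set us \<subseteq> W" "set vs \<subseteq> W" "length us = length vs" "take k us \<noteq> take k vs"
    "w \<in> codes m" "w' \<in> codes m"
  shows "g * b ^ (k - 1) \<le> dist (ifs_proj F (concat us \<frown> w)) (ifs_proj F (concat vs \<frown> w'))"
  using assms
proof (induction us arbitrary: vs k)
  case (Cons u us)
  obtain v vs' where vs: "vs = v # vs'" using Cons.prems(3) by (cases vs) auto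
  obtain k' where k: "k = Suc k'" using Cons.prems(4) by (cases k) auto
  have c1: "concat us \<frown> w \<in> codes m" "concat vs' \<frown> w' \<in> codes m"
    using Cons.prems vs concat_words by (auto intro!: conc_codes)
  show ?case
  proof (cases "u = v")
    case True
    have neq: "take k' us \<noteq> take k' vs'" using Cons.prems(4) True vs k by simp
    then have k': "k' \<noteq> 0" by (auto intro: ccontr)
    have ih: "g * b ^ (k' - 1) \<le> dist (ifs_proj F (concat us \<frown> w)) (ifs_proj F (concat vs' \<frown> w'))"
      by (rule Cons.IH) (use Cons.prems vs neq in auto)
    have uW: "u \<in> W" "u \<in> words m" using Cons.prems W by auto
    have "g * b ^ (k - 1) = b * (g * b ^ (k' - 1))" using k k' by (simp add: power_eq_if)
    also have "\<dots> \<le> wratio F u * dist (ifs_proj F (concat us \<frown> w)) (ifs_proj F (concat vs' \<frown> w'))"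
      using ih ratio_ge[OF uW(1)] b g by (intro mult_mono) auto
    also have "\<dots> = dist (ifs_proj F (u \<frown> (concat us \<frown> w))) (ifs_proj F (u \<frown> (concat vs' \<frown> w')))"
      by (rule dist_proj_conc[OF uW(2) c1, symmetric])
    finally show ?thesis using True vs by simp
  next
    case False
    have "g * b ^ (k - 1) \<le> g * 1" using g b by (intro mult_left_mono power_le_one) auto
    also have "\<dots> \<le> dist (ifs_proj F (u \<frown> (concat us \<frown> w))) (ifs_proj F (v \<frown> (concat vs' \<frown> w')))"
      using separated[OF _ _ False c1] Cons.prems vs by auto
    finally show ?thesis using vs by simp
  qed
qed simp

lemma ex_scale:
  assumes "0 < h" "h * b ^ L \<le> \<eta>"
  obtains k where "k \<le> L" "h * b ^ k \<le> \<eta>" "k = 0 \<or> \<eta> < h * b ^ (k - 1)"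
proof -
  define k where "k = (LEAST k. h * b ^ k \<le> \<eta>)"
  have "h * b ^ k \<le> \<eta>" unfolding k_def by (rule LeastI[of _ L]) (rule assms)
  moreover have "k \<le> L" unfolding k_def by (rule Least_le) (rule assms)
  moreover have "k = 0 \<or> \<eta> < h * b ^ (k - 1)"
    using not_less_Least[of "k - 1" "\<lambda>k. h * b ^ k \<le> \<eta>"] unfolding k_def[symmetric] by (cases k) auto
  ultimately show ?thesis using that by blast
qed

text \<open>At the scale \<open>k\<close> of \<rho> all members of \<open>A\<close> share their
  first \<open>k\<close> blocks, which leaves \<open>card W ^ (L - k)\<close> of them. By
  \<open>1 \<le> card W * b powr s\<close> this is at most \<open>(b ^ k) powr s\<close> times the
  number of all blocks, and \<open>g * b ^ k \<le> \<rho>\<close>.\<close>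

lemma frostman_count:
  assumes A: "A \<subseteq> blocks L" and small: "\<And>us vs. us \<in> A \<Longrightarrow> vs \<in> A \<Longrightarrow> dist (point us) (point vs) \<le> \<rho>"
    and L: "g * b ^ L \<le> \<rho>" and s: "0 \<le> s" "1 \<le> card W * b powr s"
  shows "card A \<le> real (card W) ^ L * (\<rho> / g) powr s"
proof -
  obtain k where k: "k \<le> L" "g * b ^ k \<le> \<rho>" "k = 0 \<or> \<rho> < g * b ^ (k - 1)"
    using ex_scale[OF g L] by blast
  have same: "take k us = take k vs" if "us \<in> A" "vs \<in> A" for us vs
  proof (rule ccontr)
    assume ne: "take k us \<noteq> take k vs"
    have "g * b ^ (k - 1) \<le> dist (point us) (point vs)"
      unfolding point_def by (rule separated_blocks[OF _ _ _ ne zero_code zero_code])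
        (use that A in \<open>auto simp: blocks_def\<close>)
    then show False using small[OF that] k(3) ne by auto
  qed
  have "card A \<le> card W ^ (L - k)"
  proof -
    have inj: "inj_on (drop k) A"
    proof (rule inj_onI)
      fix us vs assume A: "us \<in> A" "vs \<in> A" and d: "drop k us = drop k vs"
      have "us = take k us @ drop k us" by simp
      also have "\<dots> = take k vs @ drop k vs" using same[OF A] d by simp
      finally show "us = vs" by simp
    qed
    have "drop k ` A \<subseteq> blocks (L - k)"
      using A by (auto simp: blocks_def dest: in_set_dropD)
    then have "card (drop k ` A) \<le> card (blocks (L - k))" by (rule card_mono[OF finite_blocks])
    then show ?thesis by (simp add: card_image[OF inj] card_blocks)
  qed
  then have "real (card A) \<le> real (card W ^ (L - k))" by (simp only: of_nat_le_iff)
  then have "real (card A) \<le> real (card W) ^ (L - k)" by (simp only: of_nat_power)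
  also have "\<dots> \<le> real (card W) ^ (L - k) * (real (card W) * b powr s) ^ k"
    using mult_left_mono[OF one_le_power[OF s(2), of k], of "real (card W) ^ (L - k)"] by simp
  also have "\<dots> = real (card W) ^ L * (b ^ k) powr s"
  proof -
    have "(b powr s) ^ k = (b ^ k) powr s"
      using b by (simp add: powr_realpow[symmetric] powr_powr mult.commute)
    moreover have "real (card W) ^ L = real (card W) ^ (L - k) * real (card W) ^ k"
      using k(1) by (simp add: power_add[symmetric])
    ultimately show ?thesis by (simp add: power_mult_distrib)
  qed
  also have "\<dots> \<le> real (card W) ^ L * (\<rho> / g) powr s"
    using k(2) g b s by (intro mult_left_mono powr_mono2) (auto simp: field_simps)
  finally show ?thesis .
qed

text \<open>The first block cannot be the word that escapes from the hyperplane. Pulled back under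
  any other first word, the strip widens by a factor of at most \<open>1 / b\<close>, and the
  argument applies to the next block, for as many levels as the width stays below \<delta>.\<close>

lemma hyperplane_count_aux:
  assumes "norm a = 1" "k \<le> L" "k = 0 \<or> \<eta> \<le> \<delta> * b ^ (k - 1)"
  shows "card {us\<in>blocks L. \<bar>a \<bullet> point us - t\<bar> \<le> \<eta>} \<le> (card W - 1) ^ k * card W ^ (L - k)"
  using assms
proof (induction k arbitrary: L a t \<eta>)
  case 0
  have "card {us\<in>blocks L. \<bar>a \<bullet> point us - t\<bar> \<le> \<eta>} \<le> card (blocks L)"
    by (intro card_mono finite_blocks) auto
  then show ?case by (simp add: card_blocks)
next
  case (Suc k)
  obtain L' where L: "L = Suc L'" using Suc.prems(2) by (cases L) auto
  have \<eta>: "\<eta> \<le> \<delta> * b ^ k" using Suc.prems(3) by simp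
  also have "\<dots> \<le> \<delta> * 1" using \<delta> b by (intro mult_left_mono power_le_one) auto
  finally have \<eta>': "\<eta> \<le> \<delta>" by simp
  obtain u0 where u0: "u0 \<in> W" "\<forall>w\<in>codes m. \<delta> < \<bar>a \<bullet> ifs_proj F (u0 \<frown> w) - t\<bar>"
    using escape[OF Suc.prems(1), of t] by blast
  have point_Cons: "point (u # us) = wmap F u (point us)" if "u \<in> W" "set us \<subseteq> W" for u us
  proof -
    have "point (u # us) = ifs_proj F (u \<frown> (concat us \<frown> (\<lambda>_. 0)))" by (simp add: point_def)
    also have "\<dots> = wmap F u (point us)" unfolding point_def
      using that W concat_words zero_code by (intro proj_conc conc_codes) auto
    finally show ?thesis .
  qed
  let ?A = "{us\<in>blocks L. \<bar>a \<bullet> point us - t\<bar> \<le> \<eta>}"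
  let ?B = "\<lambda>u. {us\<in>blocks L'. \<bar>a \<bullet> point (u # us) - t\<bar> \<le> \<eta>}"
  have sub: "?A \<subseteq> (\<Union>u\<in>W - {u0}. Cons u ` ?B u)"
  proof
    fix us assume us: "us \<in> ?A"
    obtain u us' where u: "us = u # us'" using us L by (cases us) (auto simp: blocks_def)
    have uW: "u \<in> W" "set us' \<subseteq> W" "length us' = L'" using us u L by (auto simp: blocks_def)
    have "u \<noteq> u0"
    proof
      assume "u = u0"
      have "concat us' \<frown> (\<lambda>_. 0) \<in> codes m" by (intro conc_codes concat_words uW zero_code)
      then have "\<delta> < \<bar>a \<bullet> point us - t\<bar>"
        using u0(2) by (force simp: point_def u \<open>u = u0\<close> simp flip: conc_conc simp del: conc_conc)
      then show False using us \<eta>' by simp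
    qed
    then show "us \<in> (\<Union>u\<in>W - {u0}. Cons u ` ?B u)" using us u uW by (auto simp: blocks_def)
  qed
  have Bcard: "card (?B u) \<le> (card W - 1) ^ k * card W ^ (L' - k)" if u: "u \<in> W" for u
  proof -
    have r: "0 < wratio F u" "b \<le> wratio F u" using u W wratio_pos ratio_ge by blast+
    have "similarity (wratio F u) (wmap F u)" using word_similarity u W by blast
    then obtain a' where a': "norm a' = norm a" "\<And>x. a \<bullet> wmap F u x = a \<bullet> wmap F u 0 + wratio F u * (a' \<bullet> x)"
      using similarity_inner[OF _ r(1), of "wmap F u" a] by blast
    define t' where "t' = (t - a \<bullet> wmap F u 0) / wratio F u"
    have "?B u \<subseteq> {us\<in>blocks L'. \<bar>a' \<bullet> point us - t'\<bar> \<le> \<eta> / wratio F u}"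
    proof safe
      fix us assume us: "us \<in> blocks L'" and le: "\<bar>a \<bullet> point (u # us) - t\<bar> \<le> \<eta>"
      have "point (u # us) = wmap F u (point us)" using u us by (intro point_Cons) (auto simp: blocks_def)
      then have e: "a \<bullet> point (u # us) - t = wratio F u * (a' \<bullet> point us - t')"
        using a'(2)[of "point us"] r by (simp add: t'_def field_simps)
      show "\<bar>a' \<bullet> point us - t'\<bar> \<le> \<eta> / wratio F u"
        using le r(1) unfolding e by (simp add: abs_mult pos_le_divide_eq mult.commute)
    qed
    then have "card (?B u) \<le> card {us\<in>blocks L'. \<bar>a' \<bullet> point us - t'\<bar> \<le> \<eta> / wratio F u}"
      by (intro card_mono) (auto simp: finite_blocks)
    also have "\<dots> \<le> (card W - 1) ^ k * card W ^ (L' - k)"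
    proof (rule Suc.IH)
      show "norm a' = 1" using a' Suc.prems by simp
      show "k \<le> L'" using Suc.prems L by simp
      show "k = 0 \<or> \<eta> / wratio F u \<le> \<delta> * b ^ (k - 1)"
      proof (cases k)
        case (Suc j)
        have "\<eta> \<le> (\<delta> * b ^ j) * b" using \<eta> Suc by (simp add: mult_ac)
        also have "\<dots> \<le> (\<delta> * b ^ j) * wratio F u" using r \<delta> b by (intro mult_left_mono) auto
        finally show ?thesis using r Suc by (simp add: field_simps)
      qed simp
    qed
    finally show ?thesis .
  qed
  have "card ?A \<le> card (\<Union>u\<in>W - {u0}. Cons u ` ?B u)"
    by (intro card_mono sub) (auto simp: finW finite_blocks)
  also have "\<dots> \<le> (\<Sum>u\<in>W - {u0}. card (Cons u ` ?B u))"
    by (intro card_UN_le) (simp add: finW)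
  also have "\<dots> \<le> (\<Sum>u\<in>W - {u0}. (card W - 1) ^ k * card W ^ (L' - k))"
  proof (rule sum_mono)
    fix u assume "u \<in> W - {u0}"
    have "card (Cons u ` ?B u) = card (?B u)" by (intro card_image) auto
    then show "card (Cons u ` ?B u) \<le> (card W - 1) ^ k * card W ^ (L' - k)"
      using Bcard[of u] \<open>u \<in> W - {u0}\<close> by simp
  qed
  also have "\<dots> = (card W - 1) ^ Suc k * card W ^ (L - Suc k)"
    using u0 finW L by simp
  finally show ?case .
qed

text \<open>The exponent solves \<open>b powr x = 1 - 1 / card W\<close>: each level multiplies the
  proportion of blocks in the strip by at most \<open>1 - 1 / card W\<close> while the scale shrinks
  by \<open>b\<close>.\<close>

lemma hyperplane_count:
  assumes a: "norm a = 1" and L: "\<delta> * b ^ L \<le> \<eta>"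
  shows "card {us\<in>blocks L. \<bar>a \<bullet> point us - t\<bar> \<le> \<eta>}
    \<le> real (card W) ^ L * (\<eta> / \<delta>) powr (log b (1 - 1 / card W))"
proof -
  obtain k where k: "k \<le> L" "\<delta> * b ^ k \<le> \<eta>" "k = 0 \<or> \<eta> < \<delta> * b ^ (k - 1)"
    using ex_scale[OF \<delta> L] by blast
  define N where "N = real (card W)"
  define \<gamma> where "\<gamma> = log b (1 - 1 / N)"
  have N: "2 \<le> N" using card_W by (simp add: N_def)
  have \<gamma>: "0 \<le> \<gamma>" "b powr \<gamma> = 1 - 1 / N"
  proof -
    show "b powr \<gamma> = 1 - 1 / N" unfolding \<gamma>_def using b N by (intro powr_log_cancel) auto
    have "log b (1 - 1 / N) = ln (1 - 1 / N) / ln b" by (simp add: log_def)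
    moreover have "ln (1 - 1 / N) \<le> 0" "ln b < 0" using N b by auto
    ultimately show "0 \<le> \<gamma>" unfolding \<gamma>_def by (simp add: divide_nonpos_neg)
  qed
  have "card {us\<in>blocks L. \<bar>a \<bullet> point us - t\<bar> \<le> \<eta>} \<le> (card W - 1) ^ k * card W ^ (L - k)"
    by (rule hyperplane_count_aux[OF a k(1)]) (use k(3) in auto)
  then have "real (card {us\<in>blocks L. \<bar>a \<bullet> point us - t\<bar> \<le> \<eta>}) \<le> real ((card W - 1) ^ k * card W ^ (L - k))"
    by (simp only: of_nat_le_iff)
  also have "\<dots> = (N - 1) ^ k * N ^ (L - k)"
    using card_W by (simp add: N_def of_nat_diff)
  also have "\<dots> = N ^ L * (1 - 1 / N) ^ k"
  proof -
    have "N - 1 = N * (1 - 1 / N)" using N by (simp add: field_simps)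
    then have "(N - 1) ^ k * N ^ (L - k) = (N ^ k * N ^ (L - k)) * (1 - 1 / N) ^ k"
      by (simp only: power_mult_distrib mult_ac)
    then show ?thesis using k(1) by (simp add: power_add[symmetric])
  qed
  also have "(1 - 1 / N) ^ k = (b ^ k) powr \<gamma>"
    using b unfolding \<gamma>(2)[symmetric] by (simp add: powr_realpow[symmetric] powr_powr mult.commute)
  also have "N ^ L * (b ^ k) powr \<gamma> \<le> N ^ L * (\<eta> / \<delta>) powr \<gamma>"
    using k(2) \<delta> b \<gamma> N by (intro mult_left_mono powr_mono2) (auto simp: field_simps)
  finally show ?thesis by (simp add: N_def \<gamma>_def)
qed

end

section \<open>From Hausdorff dimension to a subsystem\<close>

lemma hausdorff_content_pos:
  assumes "0 < s" "s < hausdorff_dim E"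
  obtains \<delta> \<eta> where "0 < \<delta>" "0 < \<eta>" "ennreal \<eta> \<le> hausdorff_content s \<delta> E"
proof -
  have "hausdorff_measure s E \<noteq> 0"
  proof
    assume "hausdorff_measure s E = 0"
    then have "hausdorff_dim E \<le> s"
      unfolding hausdorff_dim_def using assms by (intro cInf_lower bdd_belowI[of _ 0]) auto
    then show False using assms by simp
  qed
  then obtain \<delta> where \<delta>: "\<delta> \<in> {0<..}" "hausdorff_content s \<delta> E \<noteq> 0"
    unfolding hausdorff_measure_def by (metis SUP_bot_conv(2) bot_ennreal)
  then have "0 < hausdorff_content s \<delta> E" by (simp add: zero_less_iff_neq_zero)
  \<comment> \<open>The content may be infinite, so a finite positive number below it is
    selected.\<close>
  then obtain e where e: "0 < e" "e < hausdorff_content s \<delta> E" using dense by blast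
  then have "e < top" using top.not_eq_extremum by fastforce
  then obtain \<eta> where "e = ennreal \<eta>" "0 \<le> \<eta>" by (cases e) auto
  then have "0 < \<eta>" "ennreal \<eta> \<le> hausdorff_content s \<delta> E" using e by auto
  then show ?thesis using that[of \<delta> \<eta>] \<delta> by simp
qed

lemma hausdorff_content_le_card:
  fixes E :: "'a::euclidean_space set"
  assumes "finite S" "E \<subseteq> (\<Union>x\<in>S. cball x r)" "0 \<le> r" "2 * r \<le> \<delta>"
  shows "hausdorff_content s \<delta> E \<le> ennreal (card S * (2 * r) powr s)"
proof -
  obtain f where f: "bij_betw f {..<card S} S"
    using ex_bij_betw_nat_finite[OF assms(1)] by (auto simp: atLeast0LessThan)
  \<comment> \<open>Covers are sequences; beyond \<open>card S\<close> the balls are followed by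
    empty sets, whose terms vanish because \<open>0 powr s = 0\<close>.\<close>
  define C where "C i = (if i < card S then cball (f i) r else {})" for i
  have img: "f ` {..<card S} = S" using f by (simp add: bij_betw_def)
  have "E \<subseteq> (\<Union>i. C i)"
  proof
    fix y assume "y \<in> E"
    then obtain x where x: "x \<in> S" "y \<in> cball x r" using assms by auto
    then obtain i where "i < card S" "x = f i" using img by blast
    then show "y \<in> (\<Union>i. C i)" using x by (auto simp: C_def intro!: exI[of _ i])
  qed
  moreover have "bounded (C i)" "diameter (C i) \<le> \<delta>" for i
    using assms by (auto simp: C_def diameter_cball)
  ultimately have "hausdorff_content s \<delta> E \<le> (\<Sum>i. ennreal (diameter (C i) powr s))"
    unfolding hausdorff_content_def by (intro INF_lower) auto
  also have "\<dots> = (\<Sum>i<card S. ennreal (diameter (C i) powr s))"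
    by (intro suminf_finite) (auto simp: C_def)
  also have "\<dots> = (\<Sum>i<card S. ennreal ((2 * r) powr s))"
    using assms by (intro sum.cong) (auto simp: C_def diameter_cball)
  also have "\<dots> = ennreal (card S * (2 * r) powr s)"
    by (simp add: ennreal_of_nat_eq_real_of_nat ennreal_mult)
  finally show ?thesis .
qed

text \<open>A maximal separated set is chosen inside a finite \<open>r\<close>-net of
  \<open>E\<close>, where it exists by finiteness; the radius of the net and the separation add up
  to \<open>2 * r\<close>.\<close>

lemma separated_net:
  fixes E :: "'a::metric_space set"
  assumes "compact E" "0 < r"
  obtains S where "finite S" "S \<subseteq> E" "\<And>x y. x \<in> S \<Longrightarrow> y \<in> S \<Longrightarrow> x \<noteq> y \<Longrightarrow> r \<le> dist x y"
    "E \<subseteq> (\<Union>x\<in>S. cball x (2 * r))"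
proof -
  obtain K where K: "finite K" "K \<subseteq> E" "E \<subseteq> (\<Union>x\<in>K. ball x r)"
    using seq_compact_imp_totally_bounded[of E] assms compact_eq_seq_compact_metric by blast
  define Q where "Q = {S\<in>Pow K. \<forall>x\<in>S. \<forall>y\<in>S. x \<noteq> y \<longrightarrow> r \<le> dist x y}"
  have "finite Q" "{} \<in> Q" using K by (auto simp: Q_def)
  then obtain S where S: "S \<in> Q" "\<And>T. T \<in> Q \<Longrightarrow> S \<subseteq> T \<Longrightarrow> T = S"
    using finite_has_maximal[of Q] by auto
  have cov: "\<exists>y\<in>S. dist x y \<le> r" if x: "x \<in> K" for x
  proof (rule ccontr)
    assume "\<not> ?thesis"
    then have far: "\<forall>y\<in>S. r < dist x y" by auto
    then have "insert x S \<in> Q" using S(1) x by (force simp: Q_def dist_commute)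
    then have "x \<in> S" using S(2)[of "insert x S"] by auto
    then show False using far assms by force
  qed
  have "E \<subseteq> (\<Union>x\<in>S. cball x (2 * r))"
  proof
    fix z assume "z \<in> E"
    then obtain x where x: "x \<in> K" "dist x z < r" using K by auto
    then obtain y where "y \<in> S" "dist x y \<le> r" using cov by blast
    then show "z \<in> (\<Union>x\<in>S. cball x (2 * r))"
      using x dist_triangle[of y z x] by (intro UN_I[of y]) (auto simp: dist_commute)
  qed
  then show ?thesis using that[of S] S(1) K by (auto simp: Q_def intro: finite_subset)
qed

text \<open>If the widths of \<open>E\<close> in some directions tended to 0, a limit direction in
  the compact unit sphere would have width 0 and put \<open>E\<close> into a hyperplane.\<close>

lemma width_pos:
  fixes E :: "'a::euclidean_space set"
  assumes "\<not> in_hyperplane E"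
  obtains \<omega> where "0 < \<omega>" "\<And>a. norm a = 1 \<Longrightarrow> \<exists>p\<in>E. \<exists>q\<in>E. \<omega> \<le> a \<bullet> (p - q)"
proof -
  have "\<exists>n::nat. \<forall>a. norm a = 1 \<longrightarrow> (\<exists>p\<in>E. \<exists>q\<in>E. 1 / Suc n \<le> a \<bullet> (p - q))"
  proof (rule ccontr)
    assume "\<not> ?thesis"
    then have "\<forall>n. \<exists>a. norm a = 1 \<and> (\<forall>p\<in>E. \<forall>q\<in>E. a \<bullet> (p - q) < 1 / Suc n)" by (force simp: not_le)
    then obtain a where a: "\<And>n. norm (a n) = 1" "\<And>n p q. p \<in> E \<Longrightarrow> q \<in> E \<Longrightarrow> a n \<bullet> (p - q) < 1 / Suc n" by metis
    have "\<forall>n. a n \<in> sphere 0 1" using a by simp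
    then obtain l r where l: "l \<in> sphere 0 1" "strict_mono (r::nat \<Rightarrow> nat)" "(a \<circ> r) \<longlonglongrightarrow> l"
      using compact_sphere[of "0::'a" 1] unfolding compact_def by blast
    have le0: "l \<bullet> (p - q) \<le> 0" if pq: "p \<in> E" "q \<in> E" for p q
    proof (rule LIMSEQ_le)
      show "(\<lambda>n. (a \<circ> r) n \<bullet> (p - q)) \<longlonglongrightarrow> l \<bullet> (p - q)" by (intro tendsto_intros l)
      show "(\<lambda>n. 1 / real (Suc n)) \<longlonglongrightarrow> 0" using LIMSEQ_inverse_real_of_nat by (simp add: inverse_eq_divide)
      have "(a \<circ> r) n \<bullet> (p - q) \<le> 1 / Suc n" for n
      proof -
        have "(a \<circ> r) n \<bullet> (p - q) < 1 / Suc (r n)" using a(2)[OF pq] by simp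
        also have "\<dots> \<le> 1 / Suc n" using seq_suble[OF l(2), of n] by (simp add: frac_le)
        finally show ?thesis by simp
      qed
      then show "\<exists>N. \<forall>n\<ge>N. (a \<circ> r) n \<bullet> (p - q) \<le> 1 / real (Suc n)" by blast
    qed
    have "in_hyperplane E"
    proof (cases "E = {}")
      case True
      then show ?thesis using l by (auto simp: in_hyperplane_def intro!: exI[of _ l])
    next
      case False
      then obtain q where q: "q \<in> E" by blast
      have "l \<bullet> p = l \<bullet> q" if "p \<in> E" for p
        using le0[OF that q] le0[OF q that] by (simp add: inner_diff_right)
      then show ?thesis unfolding in_hyperplane_def using l by (intro exI[of _ l] exI[of _ "l \<bullet> q"]) auto
    qed
    then show False using assms by simp
  qed
  then obtain n :: nat where "\<And>a. norm a = 1 \<Longrightarrow> \<exists>p\<in>E. \<exists>q\<in>E. 1 / Suc n \<le> a \<bullet> (p - q)" by blast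
  then show ?thesis using that[of "1 / Suc n"] by simp
qed

context ifs
begin

text \<open>The shortest prefix whose ratio has dropped to \<rho>: one letter earlier the ratio
  still exceeds \<rho>, and the last letter contributes a factor of at least \<open>a\<close>. It is
  not empty because \<open>\<rho> < 1\<close>.\<close>

lemma stopping_prefix:
  assumes w: "w \<in> codes m" and \<rho>: "0 < \<rho>" "\<rho> < 1" and a: "\<And>i. i < m \<Longrightarrow> a \<le> sim_ratio (F ! i)"
  obtains u w' where "u \<in> words m" "u \<noteq> []" "w' \<in> codes m" "w = u \<frown> w'" "wratio F u \<le> \<rho>" "a * \<rho> < wratio F u"
proof -
  define P where "P k \<longleftrightarrow> wratio F (map w [0..<k]) \<le> \<rho>" for k
  have "(\<lambda>N. c ^ N) \<longlonglongrightarrow> 0" using c by (intro LIMSEQ_realpow_zero) auto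
  then have "eventually (\<lambda>N. c ^ N < \<rho>) sequentially" using \<rho> by (intro order_tendstoD(2)) auto
  then obtain N where "c ^ N < \<rho>" by (auto simp: eventually_sequentially)
  then have PN: "P N" unfolding P_def using wratio_le[OF codes_prefix[OF w, of N]] by simp
  define k where "k = (LEAST k. P k)"
  have Pk: "P k" unfolding k_def by (rule LeastI[of P N, OF PN])
  have "k \<noteq> 0"
  proof
    assume "k = 0"
    then show False using Pk \<rho> by (simp add: P_def)
  qed
  then obtain j where j: "k = Suc j" by (cases k) auto
  have "\<not> P j" using not_less_Least[of j P] j by (simp add: k_def[symmetric])
  then have gt: "\<rho> < wratio F (map w [0..<j])" by (simp add: P_def)
  have wj: "w j < m" using w by (simp add: codes_def)
  have "a * \<rho> \<le> sim_ratio (F ! w j) * \<rho>" using a[OF wj] \<rho> by (intro mult_right_mono) auto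
  also have "\<dots> < sim_ratio (F ! w j) * wratio F (map w [0..<j])"
    using gt letter(1)[OF wj] by (rule mult_strict_left_mono)
  also have "\<dots> = wratio F (map w [0..<k])" using j by simp
  finally have "a * \<rho> < wratio F (map w [0..<k])" .
  then show ?thesis
    using that[OF codes_prefix[OF w, of k] _ codes_suffix[OF w, of k] codes_split[of w k]] Pk j by (simp add: P_def)
qed

text \<open>A maximal separated set of points of the attractor has at least \<open>\<rho> powr - s\<close> elements for some
  small \<open>\<rho>\<close>, since the Hausdorff content would vanish otherwise. Being dense at scale \<open>\<rho>\<close> it is
  contained in no hyperplane neighbourhood either. Its points are replaced by cylinders of size \<open>\<rho>\<close>.\<close>

theorem subsystem_exists:
  assumes nh: "\<not> in_hyperplane (attractor F)" and \<alpha>: "0 < \<alpha>" "\<alpha> < hausdorff_dim (attractor F)"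
  obtains W b g \<delta> s where "subsystem F m c R W b g \<delta>" "\<alpha> < s" "1 \<le> card W * b powr s"
    "\<And>u. u \<in> W \<Longrightarrow> b < wratio F u"
proof -
  let ?E = "attractor F"
  \<comment> \<open>Two exponents between \<alpha> and the dimension: the content is bounded below
    for \<open>s'\<close>, and the gap \<open>s' - s\<close> absorbs all constants once the scale
    \<rho> is small.\<close>
  define s' where "s' = (\<alpha> + hausdorff_dim ?E) / 2"
  have s': "\<alpha> < s'" "s' < hausdorff_dim ?E" using \<alpha> by (auto simp: s'_def)
  define s where "s = (\<alpha> + s') / 2"
  have s: "\<alpha> < s" "s < s'" using s' by (auto simp: s_def)
  obtain \<delta>0 \<eta> where \<delta>0: "0 < \<delta>0" and \<eta>: "0 < \<eta>" "ennreal \<eta> \<le> hausdorff_content s' \<delta>0 ?E"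
    by (rule hausdorff_content_pos[OF less_trans[OF \<alpha>(1) s'(1)] s'(2)]) (rule that)
  obtain \<omega> where \<omega>: "0 < \<omega>" "\<And>a. norm a = 1 \<Longrightarrow> \<exists>p\<in>?E. \<exists>q\<in>?E. \<omega> \<le> a \<bullet> (p - q)"
    using width_pos[OF nh] by blast
  have mpos: "0 < m"
  proof (rule ccontr)
    assume "\<not> 0 < m"
    then have "?E = {}" by (auto simp: attractor_eq codes_def)
    moreover obtain a :: 'a where "norm a = 1" using vector_choose_size[of 1] by auto
    ultimately show False using \<omega>(2)[of a] by auto
  qed
  define a0 where "a0 = Min ((\<lambda>i. sim_ratio (F ! i)) ` {..<m})"
  have a0: "0 < a0" "\<And>i. i < m \<Longrightarrow> a0 \<le> sim_ratio (F ! i)" "a0 < 1"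
  proof -
    show "0 < a0" unfolding a0_def using mpos letter by (subst Min_gr_iff) auto
    show le: "\<And>i. i < m \<Longrightarrow> a0 \<le> sim_ratio (F ! i)" unfolding a0_def by (rule Min_le; simp)
    show "a0 < 1" using le[OF mpos] letter(2)[OF mpos] by linarith
  qed
  define B where "B = 2 * R"
  have B: "0 \<le> B" using R by (simp add: B_def)
  \<comment> \<open>A cylinder of ratio at most \<rho> has diameter at most
    \<open>\<rho> * B\<close>. Points this far apart keep their cylinders at distance at least
    \<rho>.\<close>
  define sep where "sep \<rho> = (2 * B + 1) * \<rho>" for \<rho>
  \<comment> \<open>With this constant the lower bound on the content yields at least
    \<open>\<eta>' * \<rho> powr (- s')\<close> separated points.\<close>
  define \<eta>' where "\<eta>' = \<eta> * (4 * (2 * B + 1)) powr (- s')"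
  have \<eta>': "0 < \<eta>'" using \<eta> B by (simp add: \<eta>'_def)
  \<comment> \<open>The last three conditions: the balls are admissible for the content, the
    cylinders are dense compared with the width \<omega>, and their number is at least
    \<open>b powr (- s)\<close>.\<close>
  have "\<exists>\<rho>. 0 < \<rho> \<and> \<rho> < 1 \<and> 4 * sep \<rho> \<le> \<delta>0 \<and> \<rho> * (B + 2 * (2 * B + 1)) < \<omega> / 8 \<and> 1 \<le> \<eta>' * a0 powr s * \<rho> powr (s - s')"
  proof -
    define q where "q = 1 / (\<eta>' * a0 powr s)"
    have q: "0 < q" using \<eta>' a0 by (simp add: q_def)
    define \<rho>1 where "\<rho>1 = q powr (1 / (s - s'))"
    have \<rho>1: "0 < \<rho>1" "\<rho>1 powr (s - s') = q" using q s by (auto simp: \<rho>1_def powr_powr)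
    define \<rho> where "\<rho> = Min {1/2, \<delta>0 / (4 * (2 * B + 1)), \<omega> / (16 * (B + 2 * (2 * B + 1))), \<rho>1}"
    have p0: "0 < \<rho>" using \<delta>0 B \<omega>(1) \<rho>1 by (simp add: \<rho>_def)
    have le: "\<rho> \<le> 1/2" "\<rho> \<le> \<delta>0 / (4 * (2 * B + 1))" "\<rho> \<le> \<omega> / (16 * (B + 2 * (2 * B + 1)))" "\<rho> \<le> \<rho>1"
      unfolding \<rho>_def by (rule Min_le; simp)+
    have "4 * sep \<rho> \<le> \<delta>0" using le(2) B by (simp add: sep_def field_simps)
    moreover have "\<rho> * (B + 2 * (2 * B + 1)) \<le> \<omega> / 16" using le(3) B by (simp add: field_simps)
    moreover have "1 \<le> \<eta>' * a0 powr s * \<rho> powr (s - s')"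
    proof -
      have "q \<le> \<rho> powr (s - s')" using powr_mono2'[of "s - s'" \<rho> \<rho>1] s(2) p0 le(4) unfolding \<rho>1(2) by simp
      then show ?thesis using \<eta>' a0 by (simp add: q_def field_simps)
    qed
    ultimately show ?thesis using p0 le(1) \<omega>(1) by (intro exI[of _ \<rho>]) auto
  qed
  then obtain \<rho> where \<rho>: "0 < \<rho>" "\<rho> < 1" "4 * sep \<rho> \<le> \<delta>0" "\<rho> * (B + 2 * (2 * B + 1)) < \<omega> / 8"
    "1 \<le> \<eta>' * a0 powr s * \<rho> powr (s - s')" by blast
  have seppos: "0 < sep \<rho>" using \<rho>(1) B by (simp add: sep_def)
  obtain S where S: "finite S" "S \<subseteq> ?E" "\<And>x y. x \<in> S \<Longrightarrow> y \<in> S \<Longrightarrow> x \<noteq> y \<Longrightarrow> sep \<rho> \<le> dist x y"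
    "?E \<subseteq> (\<Union>x\<in>S. cball x (2 * sep \<rho>))"
    by (rule separated_net[OF attractor_compact seppos]) (rule that)
  define b where "b = a0 * \<rho>"
  have b: "0 < b" "b < 1" using a0 \<rho> mult_strict_mono[of a0 1 \<rho> 1] by (auto simp: b_def)
  have cardS: "1 \<le> card S * b powr s"
  proof -
    have "ennreal \<eta> \<le> ennreal (card S * (2 * (2 * sep \<rho>)) powr s')"
      using order_trans[OF \<eta>(2) hausdorff_content_le_card[OF S(1,4)]] \<rho> seppos by simp
    then have "\<eta> \<le> card S * (4 * sep \<rho>) powr s'"
      by (subst (asm) ennreal_le_iff) auto
    also have "4 * sep \<rho> = 4 * (2 * B + 1) * \<rho>" by (simp add: sep_def)
    also have "(4 * (2 * B + 1) * \<rho>) powr s' = (4 * (2 * B + 1)) powr s' * \<rho> powr s'"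
      by (rule powr_mult)
    finally have "\<eta>' \<le> card S * \<rho> powr s'"
      using B by (simp add: \<eta>'_def powr_minus field_simps)
    then have "\<eta>' * a0 powr s * \<rho> powr (s - s') \<le> card S * \<rho> powr s' * a0 powr s * \<rho> powr (s - s')"
      by (intro mult_right_mono) auto
    also have "\<dots> = card S * a0 powr s * (\<rho> powr s' * \<rho> powr (s - s'))" by (simp add: mult_ac)
    also have "\<rho> powr s' * \<rho> powr (s - s') = \<rho> powr s" by (simp add: powr_add[symmetric])
    also have "card S * a0 powr s * \<rho> powr s = card S * b powr s"
      using a0 \<rho> by (simp add: b_def powr_mult)
    finally show ?thesis using \<rho>(5) by linarith
  qed
  have "\<forall>x\<in>S. \<exists>u. u \<in> words m \<and> u \<noteq> [] \<and> b < wratio F u \<and> (\<forall>w\<in>codes m. dist x (ifs_proj F (u \<frown> w)) \<le> \<rho> * B)"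
  proof
    fix x assume "x \<in> S"
    then obtain w where w: "w \<in> codes m" "x = ifs_proj F w" using S(2) by (auto simp: attractor_eq)
    obtain u w' where u: "u \<in> words m" "u \<noteq> []" "w' \<in> codes m" "w = u \<frown> w'" "wratio F u \<le> \<rho>" "b < wratio F u"
      by (rule stopping_prefix[OF w(1) \<rho>(1,2) a0(2), folded b_def])
    have "dist x (ifs_proj F (u \<frown> v)) \<le> \<rho> * B" if v: "v \<in> codes m" for v
    proof -
      have "dist x (ifs_proj F (u \<frown> v)) = wratio F u * dist (ifs_proj F w') (ifs_proj F v)"
        unfolding w(2) u(4) by (rule dist_proj_conc[OF u(1,3) v])
      also have "\<dots> \<le> \<rho> * B"
        using dist_proj_le[OF u(3) v] u(5) \<rho> by (intro mult_mono) (auto simp: B_def)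
      finally show ?thesis .
    qed
    then show "\<exists>u. u \<in> words m \<and> u \<noteq> [] \<and> b < wratio F u \<and> (\<forall>w\<in>codes m. dist x (ifs_proj F (u \<frown> w)) \<le> \<rho> * B)"
      using u by blast
  qed
  from bchoice[OF this] obtain U where U0: "\<forall>x\<in>S. U x \<in> words m \<and> U x \<noteq> [] \<and> b < wratio F (U x) \<and>
    (\<forall>w\<in>codes m. dist x (ifs_proj F (U x \<frown> w)) \<le> \<rho> * B)" by blast
  then have U: "\<And>x. x \<in> S \<Longrightarrow> U x \<in> words m \<and> U x \<noteq> [] \<and> b < wratio F (U x)"
    "\<And>x w. x \<in> S \<Longrightarrow> w \<in> codes m \<Longrightarrow> dist x (ifs_proj F (U x \<frown> w)) \<le> \<rho> * B" by auto
  have Usep: "\<rho> \<le> dist (ifs_proj F (U x \<frown> w)) (ifs_proj F (U y \<frown> w'))"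
    if xy: "x \<in> S" "y \<in> S" "x \<noteq> y" and w: "w \<in> codes m" "w' \<in> codes m" for x y w w'
  proof -
    have "sep \<rho> \<le> dist x (ifs_proj F (U x \<frown> w)) + dist (ifs_proj F (U x \<frown> w)) (ifs_proj F (U y \<frown> w')) + dist y (ifs_proj F (U y \<frown> w'))"
      using S(3)[OF xy] dist_triangle[of x y "ifs_proj F (U x \<frown> w)"] dist_triangle[of "ifs_proj F (U x \<frown> w)" y "ifs_proj F (U y \<frown> w')"]
      by (simp add: dist_commute)
    then show ?thesis using U(2)[OF xy(1) w(1)] U(2)[OF xy(2) w(2)] by (simp add: sep_def algebra_simps)
  qed
  have zero: "(\<lambda>_. 0) \<in> codes m" using mpos by (simp add: codes_def)
  have inj: "inj_on U S"
  proof (rule inj_onI, rule ccontr)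
    fix x y assume xy: "x \<in> S" "y \<in> S" "U x = U y" "x \<noteq> y"
    show False using Usep[OF xy(1,2,4) zero zero] xy(3) \<rho> by simp
  qed
  have sub: "subsystem F m c R (U ` S) b \<rho> (\<omega> / 8)"
  proof unfold_locales
    show "finite (U ` S)" "0 < b" "b < 1" "0 < \<rho>" "0 < \<omega> / 8"
      using S(1) b \<rho>(1) \<omega>(1) by simp_all
    show "U ` S \<subseteq> words m" by (rule image_subsetI) (use U(1) in blast)
    show "[] \<notin> U ` S" by (rule notI, erule imageE) (use U(1) in metis)
    show "b \<le> wratio F u" if u: "u \<in> U ` S" for u
    proof -
      obtain x where x: "x \<in> S" "u = U x" using u by (rule imageE)
      then show ?thesis using U(1)[OF x(1)] by simp
    qed
    show "\<rho> \<le> dist (ifs_proj F (u \<frown> w)) (ifs_proj F (u' \<frown> w'))"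
      if u: "u \<in> U ` S" "u' \<in> U ` S" "u \<noteq> u'" and w: "w \<in> codes m" "w' \<in> codes m" for u u' w w'
    proof -
      obtain x where x: "x \<in> S" "u = U x" using u(1) by (rule imageE)
      obtain y where y: "y \<in> S" "u' = U y" using u(2) by (rule imageE)
      have "x \<noteq> y" using u(3) x(2) y(2) by blast
      then show ?thesis unfolding x(2) y(2) using Usep[OF x(1) y(1) _ w] by simp
    qed
    show "\<exists>u\<in>U ` S. \<forall>w\<in>codes m. \<omega> / 8 < \<bar>a \<bullet> ifs_proj F (u \<frown> w) - t\<bar>" if a: "norm a = 1" for a t
    \<comment> \<open>If every cylinder came within \<open>\<omega> / 8\<close> of the hyperplane,
      the whole attractor would lie within \<open>\<omega> / 4\<close> of it, which contradicts its
      width \<omega>.\<close>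
    proof (rule ccontr)
      assume "\<not> ?thesis"
      then have no: "\<And>x. x \<in> S \<Longrightarrow> \<exists>w\<in>codes m. \<bar>a \<bullet> ifs_proj F (U x \<frown> w) - t\<bar> \<le> \<omega> / 8"
        unfolding not_less[symmetric] by blast
      have ip: "\<bar>a \<bullet> x - a \<bullet> y\<bar> \<le> dist x y" for x y
        using Cauchy_Schwarz_ineq2[of a "x - y"] a by (simp add: inner_diff_right dist_norm)
      have near: "\<bar>a \<bullet> p - t\<bar> < \<omega> / 4" if p: "p \<in> ?E" for p
      proof -
        obtain x where x: "x \<in> S" "dist x p \<le> 2 * sep \<rho>" using S(4) p by auto
        obtain w where w: "w \<in> codes m" "\<bar>a \<bullet> ifs_proj F (U x \<frown> w) - t\<bar> \<le> \<omega> / 8" using no[OF x(1)] by blast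
        have "\<bar>a \<bullet> p - t\<bar> \<le> 2 * sep \<rho> + \<rho> * B + \<omega> / 8"
          using ip[of x p] ip[of x "ifs_proj F (U x \<frown> w)"] U(2)[OF x(1) w(1)] x(2) w(2) by linarith
        also have "2 * sep \<rho> + \<rho> * B < \<omega> / 8" using \<rho>(4) by (simp add: sep_def algebra_simps)
        finally show ?thesis by simp
      qed
      obtain p q where pq: "p \<in> ?E" "q \<in> ?E" "\<omega> \<le> a \<bullet> (p - q)" using \<omega>(2)[OF a] by blast
      then have "\<omega> \<le> a \<bullet> p - a \<bullet> q" by (simp only: inner_diff_right)
      then show False using near[OF pq(1)] near[OF pq(2)] \<omega>(1) by linarith
    qed
  qed
  have "1 \<le> card (U ` S) * b powr s" using cardS by (simp add: card_image[OF inj])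
  moreover have "\<And>u. u \<in> U ` S \<Longrightarrow> b < wratio F u" using U(1) by blast
  ultimately show ?thesis using that[OF sub s(1)] by blast
qed

end


section \<open>Concentration for independent thinnings\<close>

text \<open>The sum of the squared ranges in Hoeffding's inequality is at most the largest weight
  times the total weight. For a measure whose small balls have little mass this product is
  small.\<close>

lemma (in prob_space) hoeffding_lower_tail_weighted:
  fixes Z :: "'i \<Rightarrow> 'a \<Rightarrow> real"
  assumes fin: "finite I" and ind: "indep_vars (\<lambda>_. borel) Z I"
    and bd: "\<And>i \<omega>. i \<in> I \<Longrightarrow> \<omega> \<in> space M \<Longrightarrow> 0 \<le> Z i \<omega> \<and> Z i \<omega> \<le> w i"
    and w: "\<And>i. i \<in> I \<Longrightarrow> w i \<le> q" and V: "(\<Sum>i\<in>I. w i) \<le> V"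
    and pos: "0 < q" "0 < V" "0 < \<tau>"
  shows "prob {\<omega>\<in>space M. (\<Sum>i\<in>I. Z i \<omega>) \<le> (\<Sum>i\<in>I. expectation (Z i)) - \<tau>} \<le> exp (- 2 * \<tau>\<^sup>2 / (q * V))"
proof -
  interpret H: Hoeffding_ineq M I Z "\<lambda>_. 0" w "\<Sum>i\<in>I. expectation (Z i)"
    by unfold_locales (use fin ind bd in auto)
  obtain \<omega>0 where \<omega>0: "\<omega>0 \<in> space M" using not_empty by blast
  have w0: "0 \<le> w i" if "i \<in> I" for i using bd[OF that \<omega>0] by linarith
  let ?d = "\<Sum>i\<in>I. (w i - 0)\<^sup>2"
  have d: "?d \<le> q * V"
  proof -
    have "?d \<le> (\<Sum>i\<in>I. q * w i)"
      by (intro sum_mono) (use w w0 in \<open>auto simp: power2_eq_square intro!: mult_right_mono\<close>)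
    also have "\<dots> \<le> q * V" using V pos by (simp add: sum_distrib_left[symmetric])
    finally show ?thesis .
  qed
  show ?thesis
  proof (cases "?d > 0")
    case True
    have "prob {\<omega>\<in>space M. (\<Sum>i\<in>I. Z i \<omega>) \<le> (\<Sum>i\<in>I. expectation (Z i)) - \<tau>} \<le> exp (- 2 * \<tau>\<^sup>2 / ?d)"
      by (rule H.Hoeffding_ineq_le) (use pos True in auto)
    also have "\<dots> \<le> exp (- 2 * \<tau>\<^sup>2 / (q * V))"
      using d True pos by (auto intro!: divide_left_mono)
    finally show ?thesis .
  next
    \<comment> \<open>All weights are 0, so the sum and its expectation vanish and the event is
      empty.\<close>
    case False
    then have "?d = 0" by (meson not_less order_antisym sum_nonneg zero_le_power2)
    then have "\<forall>i\<in>I. (w i - 0)\<^sup>2 = 0" using fin by (subst (asm) sum_nonneg_eq_0_iff) auto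
    then have Z0: "Z i \<omega> = 0" if "i \<in> I" "\<omega> \<in> space M" for i \<omega>
      using bd[OF that] that by auto
    have "expectation (Z i) = 0" if "i \<in> I" for i
      using that Z0 by (subst Bochner_Integration.integral_cong[where g="\<lambda>_. 0"]) auto
    then have "{\<omega>\<in>space M. (\<Sum>i\<in>I. Z i \<omega>) \<le> (\<Sum>i\<in>I. expectation (Z i)) - \<tau>} = {}"
      using Z0 pos by auto
    then show ?thesis by (metis exp_ge_zero measure_empty)
  qed
qed

lemma measurable_fun_of_bools:
  assumes "finite J"
  shows "f \<in> borel_measurable (PiM J (\<lambda>_. count_space (UNIV::bool set)))"
  by (subst count_space_PiM_finite) (use assms in auto)

lemma measure_pmf_finite_support:
  assumes "finite (set_pmf p)"
  shows "measure_pmf.prob p T = (\<Sum>x\<in>set_pmf p. pmf p x * indicator T x)"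
proof -
  have "measure_pmf.prob p T = measure_pmf.prob p (T \<inter> set_pmf p)"
    by (simp add: measure_Int_set_pmf)
  also have "\<dots> = (\<Sum>x\<in>T \<inter> set_pmf p. pmf p x)"
    using assms by (intro measure_measure_pmf_finite) auto
  also have "\<dots> = (\<Sum>x\<in>set_pmf p. pmf p x * indicator T x)"
    using assms by (intro sum.mono_neutral_cong_left) (auto simp: indicator_def)
  finally show ?thesis .
qed

text \<open>Grid cubes of equal parity are more than \<open>r\<close> apart, so no set \<open>N i\<close> meets two of them
  and the masses surviving in these cubes are independent. Hoeffding's inequality is applied to each
  of the \<open>2 ^ DIM('b)\<close> parity classes.\<close>

lemma (in prob_space) thinned_mass_lower_tail:
  fixes X :: "'i \<Rightarrow> 'a \<Rightarrow> bool" and p :: "'b::euclidean_space pmf" and r :: real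
  assumes ind: "indep_vars (\<lambda>_. count_space UNIV) X I" and fin: "finite I"
    and finp: "finite (set_pmf p)" and l: "0 < r"
    and diam: "\<And>i x y. i \<in> I \<Longrightarrow> x \<in> N i \<Longrightarrow> y \<in> N i \<Longrightarrow> dist x y \<le> r"
    and fro: "\<And>x. measure_pmf.prob p (cball x (DIM('b) * r)) \<le> q"
    and a: "0 \<le> a" "\<And>x. x \<in> G \<Longrightarrow> a \<le> prob {\<omega>\<in>space M. \<forall>i\<in>I. X i \<omega> \<longrightarrow> x \<notin> N i}"
    and pos: "0 < q" "0 < \<tau>" "0 < measure_pmf.prob p S"
  defines "ok \<equiv> (\<lambda>\<omega>. {x. \<forall>i\<in>I. X i \<omega> \<longrightarrow> x \<notin> N i})"
  shows "prob {\<omega>\<in>space M. measure_pmf.prob p (S \<inter> ok \<omega>) \<le> a * measure_pmf.prob p (S \<inter> G) - \<tau>}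
    \<le> 2 ^ DIM('b) * exp (- 2 * (\<tau> / 2 ^ DIM('b))\<^sup>2 / (q * measure_pmf.prob p S))"
proof -
  have rv[measurable]: "X i \<in> measurable M (count_space UNIV)" if "i \<in> I" for i
    using ind that by (auto simp: indep_vars_def)
  have okm: "{\<omega>\<in>space M. x \<in> ok \<omega>} \<in> sets M" for x
    unfolding ok_def mem_Collect_eq by (intro sets.sets_Collect_finite_All fin) auto
  define z :: "'b \<Rightarrow> 'b \<Rightarrow> int" where "z x = (\<lambda>b\<in>Basis. \<lfloor>x \<bullet> b / r\<rfloor>)" for x
  define col :: "('b \<Rightarrow> int) \<Rightarrow> 'b \<Rightarrow> int" where "col k = (\<lambda>b\<in>Basis. k b mod 2)" for k
  define K where "K = z ` set_pmf p"
  define C :: "('b \<Rightarrow> int) set" where "C = (\<Pi>\<^sub>E b\<in>Basis. {0,1})"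
  define Kc where "Kc c = {k\<in>K. col k = c}" for c
  \<comment> \<open>The indices whose sets meet the cube \<open>k\<close>; only these decide how
    much mass survives in it.\<close>
  define J where "J k = {i\<in>I. \<exists>x. z x = k \<and> x \<in> N i}" for k
  define Z where "Z k \<omega> = measure_pmf.prob p (S \<inter> ok \<omega> \<inter> {x. z x = k})" for k \<omega>
  define w where "w k = measure_pmf.prob p (S \<inter> {x. z x = k})" for k
  have finK: "finite K" using finp by (simp add: K_def)
  have finC: "finite C" and cardC: "card C = 2 ^ DIM('b)"
    by (auto simp: C_def card_PiE numeral_2_eq_2 intro!: finite_PiE)
  have colC: "col k \<in> C" for k by (auto simp: col_def C_def)
  have far: "r < dist x y" if ceq: "col (z x) = col (z y)" and neq: "z x \<noteq> z y" for x y
  proof -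
    obtain b where b: "b \<in> Basis" "z x b \<noteq> z y b"
      using neq by (auto simp: z_def fun_eq_iff restrict_def split: if_splits)
    have m: "z x b mod 2 = z y b mod 2"
      using fun_cong[OF ceq, of b] b by (simp add: col_def)
    have "\<bar>z x b - z y b\<bar> \<ge> 2" using m b(2) by presburger
    then have "\<bar>\<lfloor>x \<bullet> b / r\<rfloor> - \<lfloor>y \<bullet> b / r\<rfloor>\<bar> \<ge> 2" using b by (simp add: z_def)
    then have "\<bar>x \<bullet> b / r - y \<bullet> b / r\<bar> > 1" by linarith
    moreover have "\<bar>x \<bullet> b / r - y \<bullet> b / r\<bar> = \<bar>(x - y) \<bullet> b\<bar> / r"
      using l by (simp add: inner_diff_left abs_div diff_divide_distrib[symmetric])
    ultimately have "r < \<bar>(x - y) \<bullet> b\<bar>" using l by simp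
    also have "\<dots> \<le> norm (x - y)" using b by (simp add: Basis_le_norm)
    finally show ?thesis by (simp add: dist_norm)
  qed
  have disj: "disjoint_family_on J (Kc c)" for c
  unfolding disjoint_family_on_def
  proof (intro ballI impI)
    fix k k' assume k: "k \<in> Kc c" "k' \<in> Kc c" "k \<noteq> k'"
    show "J k \<inter> J k' = {}"
    proof (rule ccontr)
      assume "J k \<inter> J k' \<noteq> {}"
      then obtain i x y where "i \<in> I" "z x = k" "x \<in> N i" "z y = k'" "y \<in> N i"
        by (auto simp: J_def)
      then show False using far[of x y] diam[of i x y] k by (auto simp: Kc_def)
    qed
  qed
  have Zind: "indep_vars (\<lambda>_. borel) Z (Kc c)" for c
  proof -
    define f where "f k g = measure_pmf.prob p (S \<inter> {x. z x = k \<and> (\<forall>i\<in>J k. g i \<longrightarrow> x \<notin> N i)})" for k g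
    have "indep_vars (\<lambda>k. PiM (J k) (\<lambda>_. count_space UNIV)) (\<lambda>k \<omega>. restrict (\<lambda>i. X i \<omega>) (J k)) (Kc c)"
      by (rule indep_vars_restrict[OF ind _ disj]) (auto simp: J_def)
    then have "indep_vars (\<lambda>_. borel) (\<lambda>k \<omega>. f k (restrict (\<lambda>i. X i \<omega>) (J k))) (Kc c)"
      by (rule indep_vars_compose2) (intro measurable_fun_of_bools, use fin in \<open>auto simp: J_def\<close>)
    moreover have "f k (restrict (\<lambda>i. X i \<omega>) (J k)) = Z k \<omega>" for k \<omega>
      unfolding f_def Z_def by (rule arg_cong[where f="measure_pmf.prob p"]) (auto simp: ok_def J_def)
    ultimately show ?thesis by simp
  qed
  \<comment> \<open>This puts the mass of a single cube, the weight in Hoeffding's inequality, under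
    the control of \<open>fro\<close>.\<close>
  have zball: "{x. z x = z y} \<subseteq> cball y (DIM('b) * r)" for y
  proof safe
    fix x assume "z x = z y"
    have "\<bar>(y - x) \<bullet> b\<bar> \<le> r" if b: "b \<in> Basis" for b
    proof -
      have "\<lfloor>x \<bullet> b / r\<rfloor> = \<lfloor>y \<bullet> b / r\<rfloor>" using fun_cong[OF \<open>z x = z y\<close>, of b] b by (simp add: z_def)
      then have "\<bar>y \<bullet> b / r - x \<bullet> b / r\<bar> \<le> 1" by linarith
      moreover have "\<bar>y \<bullet> b / r - x \<bullet> b / r\<bar> = \<bar>(y - x) \<bullet> b\<bar> / r"
        using l by (simp add: inner_diff_left abs_div diff_divide_distrib[symmetric])
      ultimately show ?thesis using l by (simp add: field_simps)
    qed
    then have "(\<Sum>b\<in>Basis. \<bar>(y - x) \<bullet> b\<bar>) \<le> (\<Sum>b\<in>(Basis::'b set). r)"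
      by (intro sum_mono) blast
    then have "norm (y - x) \<le> (\<Sum>b\<in>(Basis::'b set). r)"
      using norm_le_l1[of "y - x"] by linarith
    then show "x \<in> cball y (DIM('b) * r)" by (simp add: dist_norm)
  qed
  have wq: "w k \<le> q" if kK: "k \<in> K" for k
  proof -
    obtain y where y: "k = z y" using kK by (auto simp: K_def)
    have "w k \<le> measure_pmf.prob p (cball y (DIM('b) * r))"
      unfolding w_def y using zball[of y] by (intro measure_pmf.finite_measure_mono) auto
    then show ?thesis using fro[of y] by linarith
  qed
  have split: "measure_pmf.prob p T = (\<Sum>k\<in>K. measure_pmf.prob p (T \<inter> {x. z x = k}))" for T
  proof -
    have "measure_pmf.prob p T = measure_pmf.prob p (T \<inter> set_pmf p)"
      by (simp add: measure_Int_set_pmf)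
    also have "T \<inter> set_pmf p = (\<Union>k\<in>K. T \<inter> {x. z x = k} \<inter> set_pmf p)" by (auto simp: K_def)
    also have "measure_pmf.prob p \<dots> = (\<Sum>k\<in>K. measure_pmf.prob p (T \<inter> {x. z x = k} \<inter> set_pmf p))"
      by (rule measure_pmf.finite_measure_finite_Union[OF finK]) (auto simp: disjoint_family_on_def)
    finally show ?thesis by (simp add: measure_Int_set_pmf)
  qed
  have colsum: "(\<Sum>c\<in>C. \<Sum>k\<in>Kc c. h k) = (\<Sum>k\<in>K. h k)" for h :: "_ \<Rightarrow> real"
    unfolding Kc_def using finK finC colC by (intro sum.group) auto
  have Vsum: "(\<Sum>k\<in>Kc c. w k) \<le> measure_pmf.prob p S" for c
  proof -
    have "(\<Sum>k\<in>Kc c. w k) \<le> (\<Sum>k\<in>K. w k)"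
      by (intro sum_mono2 finK) (auto simp: Kc_def w_def)
    then show ?thesis using split[of S] by (simp add: w_def)
  qed
  have Zexp: "Z k \<omega> = (\<Sum>x\<in>set_pmf p. pmf p x * indicator (S \<inter> {x. z x = k}) x * indicator {\<omega>. x \<in> ok \<omega>} \<omega>)" for k \<omega>
    unfolding Z_def by (subst measure_pmf_finite_support[OF finp]) (auto intro!: sum.cong simp: indicator_def)
  have indm: "expectation (indicator {\<omega>. x \<in> ok \<omega>}) = prob {\<omega>\<in>space M. x \<in> ok \<omega>}"
     "integrable M (indicator {\<omega>. x \<in> ok \<omega>} :: _ \<Rightarrow> real)" for x
  proof -
    have e: "{\<omega>. x \<in> ok \<omega>} \<inter> space M = {\<omega>\<in>space M. x \<in> ok \<omega>}" by auto
    show "expectation (indicator {\<omega>. x \<in> ok \<omega>}) = prob {\<omega>\<in>space M. x \<in> ok \<omega>}"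
      by (simp add: e)
    show "integrable M (indicator {\<omega>. x \<in> ok \<omega>} :: _ \<Rightarrow> real)"
      by (subst integrable_indicator_iff) (simp add: e okm less_top[symmetric])
  qed
  have EZ: "expectation (Z k) = (\<Sum>x\<in>set_pmf p. pmf p x * indicator (S \<inter> {x. z x = k}) x * prob {\<omega>\<in>space M. x \<in> ok \<omega>})" for k
    unfolding Zexp
    by (subst Bochner_Integration.integral_sum) (use indm in \<open>auto intro!: integrable_mult_right\<close>)
  \<comment> \<open>Outside \<open>G\<close> nothing is known about the survival probability, so
    only the mass of \<open>S \<inter> G\<close> enters.\<close>
  have Esum: "a * measure_pmf.prob p (S \<inter> G) \<le> (\<Sum>k\<in>K. expectation (Z k))"
  proof -
    have "(\<Sum>k\<in>K. expectation (Z k)) = (\<Sum>x\<in>set_pmf p. \<Sum>k\<in>K. pmf p x * indicator (S \<inter> {x. z x = k}) x * prob {\<omega>\<in>space M. x \<in> ok \<omega>})"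
      unfolding EZ by (rule sum.swap)
    also have "\<dots> = (\<Sum>x\<in>set_pmf p. pmf p x * indicator S x * prob {\<omega>\<in>space M. x \<in> ok \<omega>})"
    proof (rule sum.cong[OF refl])
      fix x assume x: "x \<in> set_pmf p"
      have "(\<Sum>k\<in>K. pmf p x * indicator (S \<inter> {x. z x = k}) x * prob {\<omega>\<in>space M. x \<in> ok \<omega>})
         = (\<Sum>k\<in>K. if k = z x then pmf p x * indicator S x * prob {\<omega>\<in>space M. x \<in> ok \<omega>} else 0)"
        by (intro sum.cong) (auto simp: indicator_def)
      also have "\<dots> = pmf p x * indicator S x * prob {\<omega>\<in>space M. x \<in> ok \<omega>}"
        using x finK by (simp add: K_def)
      finally show "(\<Sum>k\<in>K. pmf p x * indicator (S \<inter> {x. z x = k}) x * prob {\<omega>\<in>space M. x \<in> ok \<omega>}) = \<dots>" .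
    qed
    also have "\<dots> \<ge> (\<Sum>x\<in>set_pmf p. a * (pmf p x * indicator (S \<inter> G) x))"
      using a by (intro sum_mono) (auto simp: indicator_def ok_def mult.commute[of a] intro!: mult_left_mono)
    finally show ?thesis
      by (simp add: measure_pmf_finite_support[OF finp] sum_distrib_left)
  qed
  let ?n = "2 ^ DIM('b) :: real"
  let ?bad = "\<lambda>c. {\<omega>\<in>space M. (\<Sum>k\<in>Kc c. Z k \<omega>) \<le> (\<Sum>k\<in>Kc c. expectation (Z k)) - \<tau> / ?n}"
  have Zm: "Z k \<in> borel_measurable M" if "k \<in> K" for k
    using Zind[of "col k"] that by (auto simp: indep_vars_def Kc_def)
  have badm: "?bad c \<in> events" for c
  proof -
    have [measurable]: "Z k \<in> borel_measurable M" if "k \<in> Kc c" for k using Zm that by (auto simp: Kc_def)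
    show ?thesis by measurable
  qed
  have "prob {\<omega>\<in>space M. measure_pmf.prob p (S \<inter> ok \<omega>) \<le> a * measure_pmf.prob p (S \<inter> G) - \<tau>}
      \<le> prob (\<Union>c\<in>C. ?bad c)"
  proof (intro finite_measure_mono subsetI)
    fix \<omega> assume w: "\<omega> \<in> {\<omega>\<in>space M. measure_pmf.prob p (S \<inter> ok \<omega>) \<le> a * measure_pmf.prob p (S \<inter> G) - \<tau>}"
    show "\<omega> \<in> (\<Union>c\<in>C. ?bad c)"
    proof (rule ccontr)
      assume "\<omega> \<notin> (\<Union>c\<in>C. ?bad c)"
      then have *: "(\<Sum>k\<in>Kc c. Z k \<omega>) > (\<Sum>k\<in>Kc c. expectation (Z k)) - \<tau> / ?n" if "c \<in> C" for c
        using w that by force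
      \<comment> \<open>Losses below \<open>\<tau> / ?n\<close> in each of the \<open>?n\<close>
        parity classes add up to less than \<tau>.\<close>
      have "(\<Sum>c\<in>C. ((\<Sum>k\<in>Kc c. expectation (Z k)) - \<tau> / ?n)) < (\<Sum>c\<in>C. \<Sum>k\<in>Kc c. Z k \<omega>)"
        using finC cardC * by (intro sum_strict_mono) force+
      also have "\<dots> = measure_pmf.prob p (S \<inter> ok \<omega>)"
        unfolding colsum using split[of "S \<inter> ok \<omega>"] by (simp add: Z_def)
      also have "(\<Sum>c\<in>C. ((\<Sum>k\<in>Kc c. expectation (Z k)) - \<tau> / ?n)) = (\<Sum>k\<in>K. expectation (Z k)) - \<tau>"
        by (simp add: sum_subtractf colsum cardC)
      finally show False using Esum w by auto
    qed
  qed (use badm finC in auto)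
  also have "\<dots> \<le> (\<Sum>c\<in>C. prob (?bad c))"
    by (rule finite_measure_subadditive_finite) (use badm finC in auto)
  also have "\<dots> \<le> (\<Sum>c\<in>C. exp (- 2 * (\<tau> / ?n)\<^sup>2 / (q * measure_pmf.prob p S)))"
  proof (rule sum_mono)
    fix c assume "c \<in> C"
    show "prob (?bad c) \<le> exp (- 2 * (\<tau> / ?n)\<^sup>2 / (q * measure_pmf.prob p S))"
    proof (rule hoeffding_lower_tail_weighted[OF _ Zind, where w = w])
      show "finite (Kc c)" using finK by (simp add: Kc_def)
      show "0 \<le> Z k \<omega> \<and> Z k \<omega> \<le> w k" for k \<omega>
        unfolding Z_def w_def by (auto intro!: measure_pmf.finite_measure_mono)
      show "w k \<le> q" if "k \<in> Kc c" for k using wq that by (auto simp: Kc_def)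
    qed (use Vsum pos in auto)
  qed
  also have "\<dots> = ?n * exp (- 2 * (\<tau> / ?n)\<^sup>2 / (q * measure_pmf.prob p S))"
    by (simp add: cardC)
  finally show ?thesis .
qed


section \<open>Removal models\<close>

text \<open>The scale \<open>2 powr - n\<^sup>2\<close> is smaller than \<open>2 powr - (K * n)\<close> for every \<open>K\<close>, so the same erosion
  serves for all families, whatever their exponent of non-concentration near hyperplanes.\<close>

definition erosion :: "nat \<Rightarrow> real" where "erosion n = (1/2) ^ (n\<^sup>2)"

text \<open>A quantifier is used because \<open>infdist\<close> is 0 for the empty set, whereas
  every point has to be far from an empty removed set.\<close>

definition far :: "real \<Rightarrow> 'a::metric_space set \<Rightarrow> 'a set" where
  "far e S = {x. \<forall>y\<in>S. e < dist x y}"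

definition near_grid :: "nat \<Rightarrow> 'a::euclidean_space set" where
  "near_grid n = {x. \<exists>b\<in>Basis. \<exists>j::int. \<bar>x \<bullet> b - real_of_int j / 2 ^ n\<bar> \<le> erosion n}"

lemma erosion_pos: "0 < erosion n"
  by (simp add: erosion_def)

text \<open>Half of the erosion pays for the passage to a nearby parameter; the other half still
  covers the erosion of the next level.\<close>

lemma erosion_Suc_le: "erosion (Suc n) \<le> erosion n / 2"
proof -
  have "(Suc n)\<^sup>2 = n\<^sup>2 + (2 * n + 1)"
    by (simp add: power2_eq_square)
  then have "erosion (Suc n) = erosion n * (1/2) ^ (2 * n + 1)"
    unfolding erosion_def by (simp only: power_add)
  also have "\<dots> \<le> erosion n * (1/2) ^ 1"
    using erosion_pos[of n] by (intro mult_left_mono power_decreasing) auto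
  finally show ?thesis by simp
qed

lemma erosion_le: "erosion n \<le> (1/2) ^ n"
  unfolding erosion_def by (rule power_decreasing) (auto simp: power2_eq_square)

lemma far_Un: "far e (A \<union> B) = far e A \<inter> far e B"
  by (auto simp: far_def)

lemma far_empty [simp]: "far e {} = UNIV"
  by (simp add: far_def)

lemma summable_tail_le:
  fixes g :: "nat \<Rightarrow> real"
  assumes "summable g" "0 < \<epsilon>"
  obtains N where "\<And>n0 n. N \<le> n0 \<Longrightarrow> (\<Sum>k\<in>{n0<..n}. g k) \<le> \<epsilon>"
proof -
  obtain N where N: "\<And>m n. m \<ge> N \<Longrightarrow> norm (sum g {m..<n}) < \<epsilon>"
    using assms summable_Cauchy[of g] by blast
  have "(\<Sum>k\<in>{n0<..n}. g k) \<le> \<epsilon>" if "N \<le> n0" for n0 n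
  proof -
    have "{n0<..n} = {Suc n0..<Suc n}" by auto
    then show ?thesis using N[of "Suc n0" "Suc n"] that by (auto simp: real_norm_def)
  qed
  then show ?thesis using that by blast
qed

text \<open>The size of the net at level \<open>k\<close> times the failure probability for one
  parameter: doubly exponential decay beats \<open>exp (C * k\<^sup>2)\<close>.\<close>

lemma summable_doubly_exponential:
  fixes C c \<beta> K :: real
  assumes "0 < c" "0 < \<beta>"
  shows "summable (\<lambda>k::nat. exp (C * (real k ^ 2 + 1)) * (K * exp (- c * 2 powr (\<beta> * real k))))"
proof -
  have "filterlim (\<lambda>k::nat. C * (real k ^ 2 + 1) - c * 2 powr (\<beta> * real k) + real k) at_bot at_top"
    using assms by real_asymp
  then have "eventually (\<lambda>k::nat. C * (real k ^ 2 + 1) - c * 2 powr (\<beta> * real k) + real k \<le> 0) at_top"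
    by (simp add: filterlim_at_bot)
  then have ev: "eventually (\<lambda>k::nat. norm (exp (C * (real k ^ 2 + 1)) * (K * exp (- c * 2 powr (\<beta> * real k)))) \<le> \<bar>K\<bar> * exp (-1) ^ k) at_top"
  proof eventually_elim
    case (elim k)
    have "exp (C * (real k ^ 2 + 1)) * exp (- c * 2 powr (\<beta> * real k)) \<le> exp (- real k)"
      using elim by (simp add: exp_add[symmetric])
    also have "\<dots> = exp (-1) ^ k" by (simp add: exp_of_nat_mult[symmetric])
    finally have "\<bar>K\<bar> * (exp (C * (real k ^ 2 + 1)) * exp (- c * 2 powr (\<beta> * real k))) \<le> \<bar>K\<bar> * exp (-1) ^ k"
      by (intro mult_left_mono) auto
    then show ?case by (simp add: abs_mult mult.left_commute)
  qed
  show ?thesis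
    by (rule summable_comparison_test_ev[OF ev]) (intro summable_mult summable_geometric, simp)
qed

lemma summable_powr_neg:
  fixes \<beta> :: real
  assumes "0 < \<beta>" shows "summable (\<lambda>k::nat. 2 powr (- \<beta> * real k))"
proof -
  have "2 powr (- \<beta> * real k) = (2 powr (- \<beta>)) ^ k" for k
    using powr_powr[of 2 "- \<beta>" "real k"] powr_realpow[of "2 powr (- \<beta>)" k] by simp
  moreover have "2 powr (- \<beta>) < 1" using assms by (simp add: powr_less_one)
  ultimately show ?thesis by (simp add: summable_geometric)
qed

text \<open>The set \<open>R (n, i)\<close> is removed at level \<open>n\<close> if \<open>X (n, i)\<close> holds. The exception \<open>near_grid\<close> in
  \<open>survive\<close> is needed for percolation, where a point close to the boundary of a dyadic cube is
  threatened by several cubes.\<close>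

locale removal_model = prob_space M
  for M :: "'w measure" +
  fixes I :: "nat \<Rightarrow> 'i set" and X :: "nat \<times> 'i \<Rightarrow> 'w \<Rightarrow> bool"
    and R :: "nat \<times> 'i \<Rightarrow> 'a::euclidean_space set" and \<alpha> D \<kappa> :: real
  assumes alpha: "0 < \<alpha>" and D: "0 \<le> D" and \<kappa>: "0 \<le> \<kappa>"
    and fin: "finite (I n)"
    and indep: "indep_vars (\<lambda>_. count_space UNIV) X (SIGMA n:{1..}. I n)"
    and diam: "1 \<le> n \<Longrightarrow> i \<in> I n \<Longrightarrow> x \<in> R (n, i) \<Longrightarrow> y \<in> R (n, i) \<Longrightarrow> dist x y \<le> D / 2 ^ n"
    and keep_pos: "1 \<le> n \<Longrightarrow> i \<in> I n \<Longrightarrow> 0 < prob {\<omega>\<in>space M. \<not> X (n, i) \<omega>}"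
    and survive: "1 \<le> n \<Longrightarrow> x \<notin> near_grid n \<Longrightarrow>
      2 powr (- \<alpha>) * (1 - \<kappa> / 2 ^ n) \<le>
        prob {\<omega>\<in>space M. \<forall>i\<in>I n. X (n, i) \<omega> \<longrightarrow> x \<in> far (erosion n) (R (n, i))}"
begin

section \<open>Configurations of removed indices\<close>

definition J :: "nat \<Rightarrow> (nat \<times> 'i) set" where "J n = (SIGMA j:{1..n}. I j)"

definition config :: "(nat \<times> 'i) set \<Rightarrow> 'w \<Rightarrow> (nat \<times> 'i) set" where "config A \<omega> = {p\<in>A. X p \<omega>}"

definition removed :: "'w \<Rightarrow> nat \<Rightarrow> 'a set" where "removed \<omega> n = \<Union> (R ` config (J n) \<omega>)"

definition intact :: "nat \<Rightarrow> 'w set" where "intact n = {\<omega>\<in>space M. config (J n) \<omega> = {}}"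

lemma finJ: "finite (J n)"
  by (auto simp: J_def fin)

lemma J_sub: "J n \<subseteq> (SIGMA n:{1..}. I n)"
  by (auto simp: J_def)

lemma J_mono: "k \<le> n \<Longrightarrow> J k \<subseteq> J n"
  by (auto simp: J_def)

lemma J_Suc: "J (Suc n) = J n \<union> {Suc n} \<times> I (Suc n)"
  by (auto simp: J_def le_Suc_eq)

text \<open>\<open>config A\<close> takes finitely many values, so every predicate of it defines an
  event.\<close>

lemma config_event:
  assumes "finite A" "A \<subseteq> (SIGMA n:{1..}. I n)"
  shows "{\<omega>\<in>space M. Q (config A \<omega>)} \<in> events"
proof -
  have X: "X p \<in> measurable M (count_space UNIV)" if "p \<in> A" for p
    using that indep assms by (auto simp: indep_vars_def)
  have "{\<omega>\<in>space M. config A \<omega> = a} \<in> events" if "a \<subseteq> A" for a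
  proof -
    have "{\<omega>\<in>space M. config A \<omega> = a} = {\<omega>\<in>space M. \<forall>p\<in>A. X p \<omega> \<longleftrightarrow> p \<in> a}"
      using that by (auto simp: config_def)
    also have "\<dots> \<in> events"
      by (intro sets.sets_Collect_finite_All assms) (use X in measurable)
    finally show ?thesis .
  qed
  then have "(\<Union>a\<in>{a\<in>Pow A. Q a}. {\<omega>\<in>space M. config A \<omega> = a}) \<in> events"
    using assms by (intro sets.finite_UN) auto
  moreover have "(\<Union>a\<in>{a\<in>Pow A. Q a}. {\<omega>\<in>space M. config A \<omega> = a}) = {\<omega>\<in>space M. Q (config A \<omega>)}"
    by (auto simp: config_def)
  ultimately show ?thesis by simp
qed

lemma config_indep:
  assumes A: "finite A" "A \<subseteq> (SIGMA n:{1..}. I n)" and B: "finite B" "B \<subseteq> (SIGMA n:{1..}. I n)"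
    and AB: "A \<inter> B = {}"
  shows "prob {\<omega>\<in>space M. P (config A \<omega>) \<and> Q (config B \<omega>)} =
    prob {\<omega>\<in>space M. P (config A \<omega>)} * prob {\<omega>\<in>space M. Q (config B \<omega>)}"
proof -
  let ?M = "\<lambda>_. count_space (UNIV :: bool set)"
  let ?S = "\<lambda>C P. {g \<in> C \<rightarrow>\<^sub>E UNIV. P {p\<in>C. g p}}"
  have S: "?S C P \<in> sets (PiM C ?M)" if "finite C" for C :: "(nat \<times> 'i) set" and P
    by (subst count_space_PiM_finite) (use that in auto)
  have "prob ((\<lambda>\<omega>. (restrict (\<lambda>i. X i \<omega>) A, restrict (\<lambda>i. X i \<omega>) B)) -` (?S A P \<times> ?S B Q) \<inter> space M)
    = prob ((\<lambda>\<omega>. restrict (\<lambda>i. X i \<omega>) A) -` ?S A P \<inter> space M) * prob ((\<lambda>\<omega>. restrict (\<lambda>i. X i \<omega>) B) -` ?S B Q \<inter> space M)"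
    by (rule indep_varD[OF indep_var_restrict[OF indep AB A(2) B(2)] S[OF A(1)] S[OF B(1)]])
  moreover have e: "{p\<in>C. restrict (\<lambda>i. X i \<omega>) C p} = config C \<omega>" for C \<omega>
    by (auto simp: config_def)
  have "(\<lambda>\<omega>. restrict (\<lambda>i. X i \<omega>) C) -` ?S C P \<inter> space M = {\<omega>\<in>space M. P (config C \<omega>)}" for C P
    using e[of C] by auto
  moreover have "(\<lambda>\<omega>. (restrict (\<lambda>i. X i \<omega>) A, restrict (\<lambda>i. X i \<omega>) B)) -` (?S A P \<times> ?S B Q) \<inter> space M
     = {\<omega>\<in>space M. P (config A \<omega>) \<and> Q (config B \<omega>)}"
    using e[of A] e[of B] by auto
  ultimately show ?thesis by simp
qed

text \<open>This stands for conditioning on the past: split by the value \<open>a\<close> of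
  \<open>config A\<close>, use the independence of \<open>config B\<close> for each
  \<open>a\<close>, and sum. The bad event may depend on \<open>a\<close>, its bound \<beta> may
  not.\<close>

lemma config_conditional_bound:
  assumes A: "finite A" "A \<subseteq> (SIGMA n:{1..}. I n)" and B: "finite B" "B \<subseteq> (SIGMA n:{1..}. I n)"
    and AB: "A \<inter> B = {}"
    and bd: "\<And>a. a \<subseteq> A \<Longrightarrow> H a \<Longrightarrow> prob {\<omega>\<in>space M. Bad a (config B \<omega>)} \<le> \<beta>"
  shows "prob {\<omega>\<in>space M. H (config A \<omega>) \<and> Bad (config A \<omega>) (config B \<omega>)}
    \<le> \<beta> * prob {\<omega>\<in>space M. H (config A \<omega>)}"
proof -
  let ?F = "{a\<in>Pow A. H a}"
  have finF: "finite ?F" using A by auto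
  have ev: "{\<omega>\<in>space M. config A \<omega> = a \<and> Bad a (config B \<omega>)} \<in> events" for a
    using sets.Int[OF config_event[OF A, of "\<lambda>x. x = a"] config_event[OF B, of "Bad a"]]
    by (rule back_subst[of "\<lambda>S. S \<in> events"]) auto
  have "{\<omega>\<in>space M. H (config A \<omega>) \<and> Bad (config A \<omega>) (config B \<omega>)}
     = (\<Union>a\<in>?F. {\<omega>\<in>space M. config A \<omega> = a \<and> Bad a (config B \<omega>)})"
    by (auto simp: config_def)
  also have "prob \<dots> = (\<Sum>a\<in>?F. prob {\<omega>\<in>space M. config A \<omega> = a \<and> Bad a (config B \<omega>)})"
    by (rule finite_measure_finite_Union[OF finF]) (use ev in \<open>auto simp: disjoint_family_on_def\<close>)
  also have "\<dots> = (\<Sum>a\<in>?F. prob {\<omega>\<in>space M. config A \<omega> = a} * prob {\<omega>\<in>space M. Bad a (config B \<omega>)})"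
    by (intro sum.cong refl config_indep[OF A B AB, where P="\<lambda>x. x = _"])
  also have "\<dots> \<le> (\<Sum>a\<in>?F. prob {\<omega>\<in>space M. config A \<omega> = a} * \<beta>)"
    using bd by (intro sum_mono mult_left_mono) auto
  also have "\<dots> = \<beta> * (\<Sum>a\<in>?F. prob {\<omega>\<in>space M. config A \<omega> = a})"
    by (simp add: sum_distrib_left mult.commute)
  also have "(\<Sum>a\<in>?F. prob {\<omega>\<in>space M. config A \<omega> = a}) = prob (\<Union>a\<in>?F. {\<omega>\<in>space M. config A \<omega> = a})"
    by (rule finite_measure_finite_Union[OF finF, symmetric])
      (use config_event[OF A] in \<open>auto simp: disjoint_family_on_def\<close>)
  also have "(\<Union>a\<in>?F. {\<omega>\<in>space M. config A \<omega> = a}) = {\<omega>\<in>space M. H (config A \<omega>)}"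
    by (auto simp: config_def)
  finally show ?thesis .
qed

lemma intact_event: "intact n \<in> events"
  unfolding intact_def by (rule config_event[OF finJ J_sub])

lemma intact_pos: "0 < prob (intact n)"
proof (cases "J n = {}")
  case True
  then have "intact n = space M" by (auto simp: intact_def config_def)
  then show ?thesis by (simp add: prob_space)
next
  case False
  have e: "(\<Inter>i\<in>J n. X i -` {False} \<inter> space M) = intact n"
    using False by (auto simp: intact_def config_def)
  have "prob (\<Inter>i\<in>J n. X i -` {False} \<inter> space M) = (\<Prod>i\<in>J n. prob (X i -` {False} \<inter> space M))"
    by (rule indep_varsD[OF indep False finJ J_sub]) auto
  also have "\<dots> > 0"
  proof (rule prod_pos, safe)
    fix j i assume "(j, i) \<in> J n"
    moreover have "X (j, i) -` {False} \<inter> space M = {\<omega>\<in>space M. \<not> X (j, i) \<omega>}" by auto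
    ultimately show "0 < prob (X (j, i) -` {False} \<inter> space M)"
      using keep_pos[of j i] by (auto simp: J_def)
  qed
  finally show ?thesis using e by simp
qed

end

section \<open>Mass that survives the levels\<close>

context removal_model
begin

lemma far_config:
  "far e (\<Union> (R ` config A \<omega>)) = {x. \<forall>p\<in>A. X p \<omega> \<longrightarrow> x \<in> far e (R p)}"
  by (auto simp: far_def config_def)

text \<open>The general tail bound is applied to the removed sets enlarged by the erosion. The loss
  \<open>t\<close> has three sources: the factor \<open>1 - \<kappa> / 2 ^ k\<close> in the survival
  probability, the mass near the grid, which is given up, and an allowed fluctuation
  \<open>2 powr (- \<beta> * k)\<close>.\<close>

lemma one_level_tail:
  fixes p :: "'a pmf" and k :: nat and \<beta> s C2 C3 :: real
  assumes k: "1 \<le> k" "\<kappa> \<le> 2 ^ k" and \<beta>: "0 < \<beta>" "s = \<alpha> + 4 * \<beta>" and C: "0 < C2" "0 \<le> C3"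
    and finp: "finite (set_pmf p)"
    and fro: "\<And>x r. (1/2) ^ k \<le> r \<Longrightarrow> measure_pmf.prob p (cball x r) \<le> C2 * r powr s"
    and grid: "measure_pmf.prob p (near_grid k) \<le> C3 * 2 powr (- (\<alpha> + 1) * real k)"
    and m: "1/2 * 2 powr (- \<alpha> * real k) \<le> measure_pmf.prob p S"
  defines "t \<equiv> (\<kappa> + 2 * C3) / 2 ^ k + 2 powr (- \<beta> * real k)"
  defines "c0 \<equiv> 2 powr (- 2 * \<alpha>) / (4 ^ DIM('a) * (C2 * (DIM('a) * (D + 2)) powr s))"
  shows "prob {\<omega>\<in>space M. measure_pmf.prob p (S \<inter> far (erosion k) (\<Union> (R ` config ({k} \<times> I k) \<omega>)))
      \<le> 2 powr (- \<alpha>) * (1 - t) * measure_pmf.prob p S}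
    \<le> 2 ^ DIM('a) * exp (- c0 * 2 powr (2 * \<beta> * real k))"
proof -
  define mS where "mS = measure_pmf.prob p S"
  define N where "N q = - far (erosion k) (R q)" for q
  \<comment> \<open>A set of diameter \<open>D / 2 ^ k\<close> grows by the erosion on both sides,
    and \<open>erosion k \<le> 1 / 2 ^ k\<close>.\<close>
  define r where "r = (D + 2) / 2 ^ k"
  define G where "G = - (near_grid k :: 'a set)"
  define a where "a = 2 powr (- \<alpha>) * (1 - \<kappa> / 2 ^ k)"
  define \<tau> where "\<tau> = 2 powr (- \<alpha>) * 2 powr (- \<beta> * real k) * mS"
  \<comment> \<open>The Frostman bound for a ball of radius \<open>DIM('a) * r\<close>, which
    contains a grid cube of side \<open>r\<close>.\<close>
  define q where "q = C2 * (DIM('a) * (D + 2)) powr s * 2 powr (- s * real k)"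
  have mpos: "0 < mS" using m unfolding mS_def by (smt (verit) powr_gt_zero zero_less_divide_1_iff mult_pos_pos)
  have sub: "{k} \<times> I k \<subseteq> (SIGMA n:{1..}. I n)" using k by auto
  have rpos: "0 < r" using D by (simp add: r_def)
  have p2: "2 powr (- real k) = (1/2) ^ k" "2 powr (- s * real k) = ((1/2)^k) powr s"
    by (simp_all add: powr_minus powr_realpow power_one_over inverse_eq_divide powr_powr[symmetric] powr_divide
        mult.commute[of s])
  have qeq: "C2 * (DIM('a) * r) powr s = q"
  proof -
    have "real DIM('a) * r = DIM('a) * (D + 2) * (1/2) ^ k"
      by (simp add: r_def power_one_over)
    then show ?thesis using D unfolding q_def p2 by (simp add: powr_mult)
  qed
  have fro': "measure_pmf.prob p (cball x (DIM('a) * r)) \<le> q" for x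
  proof -
    have "(1/2) ^ k \<le> 1 * r" using D by (simp add: r_def power_one_over field_simps)
    also have "\<dots> \<le> DIM('a) * r" using rpos by (intro mult_right_mono) (auto simp: Suc_leI)
    finally show ?thesis using fro[of "DIM('a) * r" x] qeq by simp
  qed
  have Ndiam: "dist x y \<le> r" if ik: "i \<in> {k} \<times> I k" and xN: "x \<in> N i" and yN: "y \<in> N i" for i x y
  proof -
    obtain j where j: "i = (k, j)" "j \<in> I k" using ik by auto
    obtain x' y' where xy: "x' \<in> R i" "dist x x' \<le> erosion k" "y' \<in> R i" "dist y y' \<le> erosion k"
      using xN yN by (auto simp: N_def far_def not_less)
    have "dist x' y' \<le> D / 2 ^ k" using diam[of k j x' y'] k j xy by simp
    then have "dist x y \<le> D / 2 ^ k + 2 * erosion k"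
      using xy dist_triangle[of x y x'] dist_triangle[of x' y y'] by (simp add: dist_commute)
    also have "\<dots> \<le> r" using erosion_le[of k] by (simp add: r_def power_one_over field_simps)
    finally show ?thesis .
  qed
  have a0: "0 \<le> a" using k by (simp add: a_def)
  have aG: "a \<le> prob {\<omega>\<in>space M. \<forall>i\<in>{k} \<times> I k. X i \<omega> \<longrightarrow> x \<notin> N i}" if "x \<in> G" for x
    using survive[of k x] k that by (simp add: a_def N_def G_def)
  have qpos: "0 < q" using C D by (simp add: q_def)
  have \<tau>pos: "0 < \<tau>" using mpos by (simp add: \<tau>_def)
  have okeq: "{x. \<forall>i\<in>{k} \<times> I k. X i \<omega> \<longrightarrow> x \<notin> N i} = far (erosion k) (\<Union> (R ` config ({k} \<times> I k) \<omega>))" for \<omega>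
    unfolding far_config N_def by auto
  have main: "prob {\<omega>\<in>space M. measure_pmf.prob p (S \<inter> far (erosion k) (\<Union> (R ` config ({k} \<times> I k) \<omega>)))
        \<le> a * measure_pmf.prob p (S \<inter> G) - \<tau>}
      \<le> 2 ^ DIM('a) * exp (- 2 * (\<tau> / 2 ^ DIM('a))\<^sup>2 / (q * mS))"
    using thinned_mass_lower_tail[OF indep_vars_subset[OF indep sub] _ finp rpos Ndiam fro' a0 aG qpos \<tau>pos, where S = S]
      mpos fin unfolding okeq mS_def by auto
  have SG: "mS * (1 - 2 * C3 / 2 ^ k) \<le> measure_pmf.prob p (S \<inter> G)"
  proof -
    have "mS \<le> measure_pmf.prob p (S \<inter> G \<union> near_grid k)"
      unfolding mS_def by (intro measure_pmf.finite_measure_mono) (auto simp: G_def)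
    also have "\<dots> \<le> measure_pmf.prob p (S \<inter> G) + measure_pmf.prob p (near_grid k)"
      by (intro measure_Un_le) auto
    finally have "mS \<le> measure_pmf.prob p (S \<inter> G) + C3 * 2 powr (- (\<alpha> + 1) * real k)" using grid by linarith
    also have "2 powr (- (\<alpha> + 1) * real k) = 2 powr (- \<alpha> * real k) * (1/2) ^ k"
      unfolding p2[symmetric] by (simp add: powr_add[symmetric] algebra_simps)
    \<comment> \<open>The lower bound on the mass of \<open>S\<close> turns the absolute bound near
      the grid into a relative one.\<close>
    also have "C3 * (2 powr (- \<alpha> * real k) * (1/2) ^ k) \<le> C3 * (2 * mS * (1/2)^k)"
      using m C unfolding mS_def by (intro mult_left_mono mult_right_mono) auto
    finally show ?thesis by (simp add: algebra_simps power_one_over)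
  qed
  have ineq: "2 powr (- \<alpha>) * (1 - t) * mS \<le> a * measure_pmf.prob p (S \<inter> G) - \<tau>"
  proof -
    define u where "u = \<kappa> / 2 ^ k"
    define v where "v = 2 * C3 / 2 ^ k"
    define w where "w = 2 powr (- \<beta> * real k)"
    have nn: "0 \<le> u * v" using \<kappa> C by (simp add: u_def v_def)
    have "t = u + v + w" by (simp add: t_def u_def v_def w_def add_divide_distrib)
    then have "1 - t \<le> (1 - u) * (1 - v) - w"
      using nn by (simp add: algebra_simps)
    then have "2 powr (- \<alpha>) * (1 - t) * mS \<le> 2 powr (- \<alpha>) * ((1 - u) * (1 - v) - w) * mS"
      using mpos by (intro mult_right_mono mult_left_mono) auto
    also have "\<dots> = a * (mS * (1 - v)) - \<tau>"
      unfolding a_def \<tau>_def u_def[symmetric] w_def[symmetric] by (simp add: algebra_simps)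
    also have "\<dots> = a * (mS * (1 - 2 * C3 / 2 ^ k)) - \<tau>" by (simp add: v_def)
    also have "\<dots> \<le> a * measure_pmf.prob p (S \<inter> G) - \<tau>"
      using SG a0 by (intro diff_right_mono mult_left_mono)
    finally show ?thesis .
  qed
  \<comment> \<open>Up to constants \<open>\<tau>\<^sup>2 / (q * mS)\<close> is
    \<open>2 powr ((s - 2 * \<beta>) * k) * mS\<close>, where \<open>mS\<close> is at least of order
    \<open>2 powr (- \<alpha> * k)\<close>. The resulting exponent
    \<open>s - 2 * \<beta> - \<alpha>\<close> equals \<open>2 * \<beta>\<close>.\<close>
  have expo: "c0 * 2 powr (2 * \<beta> * real k) \<le> 2 * (\<tau> / 2 ^ DIM('a))\<^sup>2 / (q * mS)"
  proof -
    let ?B = "C2 * (DIM('a) * (D + 2)) powr s"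
    have B: "?B > 0" using C D by simp
    have four: "(4::real) ^ DIM('a) = 2 ^ DIM('a) * 2 ^ DIM('a)"
      by (simp add: power_mult_distrib[symmetric])
    define f where "f = (4::real) ^ DIM('a)"
    have f: "0 < f" "c0 = 2 powr (- 2 * \<alpha>) / (f * ?B)" by (simp_all add: f_def c0_def)
    have sq: "(\<tau> / 2 ^ DIM('a))\<^sup>2 = \<tau>\<^sup>2 / f"
      by (simp add: f_def power_divide four power2_eq_square)
    have \<tau>sq: "\<tau>\<^sup>2 = 2 powr (- 2 * \<alpha>) * 2 powr (- 2 * \<beta> * real k) * mS\<^sup>2"
      by (simp add: \<tau>_def power_mult_distrib power2_eq_square powr_add[symmetric] algebra_simps)
    have "2 * (\<tau> / 2 ^ DIM('a))\<^sup>2 / (q * mS) = c0 * (2 powr (- 2 * \<beta> * real k) / 2 powr (- s * real k)) * (2 * mS)"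
      using mpos B f(1) unfolding sq \<tau>sq q_def f(2) by (simp add: field_simps power2_eq_square)
    also have "\<dots> \<ge> c0 * (2 powr (- 2 * \<beta> * real k) / 2 powr (- s * real k)) * (2 powr (- \<alpha> * real k))"
      using m B unfolding mS_def c0_def by (intro mult_left_mono) auto
    also have "c0 * (2 powr (- 2 * \<beta> * real k) / 2 powr (- s * real k)) * (2 powr (- \<alpha> * real k)) = c0 * 2 powr (2 * \<beta> * real k)"
      using \<beta>(2) by (simp add: powr_diff[symmetric] powr_add[symmetric] algebra_simps)
    finally show ?thesis by simp
  qed
  have "prob {\<omega>\<in>space M. measure_pmf.prob p (S \<inter> far (erosion k) (\<Union> (R ` config ({k} \<times> I k) \<omega>)))
      \<le> 2 powr (- \<alpha>) * (1 - t) * mS} \<le>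
    prob {\<omega>\<in>space M. measure_pmf.prob p (S \<inter> far (erosion k) (\<Union> (R ` config ({k} \<times> I k) \<omega>)))
        \<le> a * measure_pmf.prob p (S \<inter> G) - \<tau>}"
    using ineq by (intro finite_measure_mono config_event) (use k fin in auto)
  also note main
  also have "2 ^ DIM('a) * exp (- 2 * (\<tau> / 2 ^ DIM('a))\<^sup>2 / (q * mS)) \<le> 2 ^ DIM('a) * exp (- c0 * 2 powr (2 * \<beta> * real k))"
    using expo by simp
  finally show ?thesis by (simp add: mS_def)
qed

text \<open>\<open>parent\<close> hands the mass from level \<open>n\<close> to level
  \<open>n + 1\<close> before the removals of the new level; \<open>one_level_tail\<close> is then
  applied to each of the finitely many parameters, with the past fixed. Failure is measured relative
  to \<open>intact n0\<close>, whose probability may be tiny.\<close>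

theorem chain_survival:
  fixes T :: "nat \<Rightarrow> 'p set" and P :: "nat \<Rightarrow> 'p \<Rightarrow> 'a pmf" and s C1 C2 C3 \<epsilon> :: real
  assumes s: "\<alpha> < s" and C: "0 < C2" "0 \<le> C3" and \<epsilon>: "0 < \<epsilon>"
    and finT: "\<And>n. finite (T n)" and cardT: "\<And>n. real (card (T n)) \<le> exp (C1 * (real n ^ 2 + 1))"
    and finP: "\<And>n \<theta>. \<theta> \<in> T n \<Longrightarrow> finite (set_pmf (P n \<theta>))"
    and fro: "\<And>n \<theta> x r. \<theta> \<in> T n \<Longrightarrow> (1/2) ^ n \<le> r \<Longrightarrow> measure_pmf.prob (P n \<theta>) (cball x r) \<le> C2 * r powr s"
    and grid: "\<And>n \<theta>. \<theta> \<in> T n \<Longrightarrow> measure_pmf.prob (P n \<theta>) (near_grid n) \<le> C3 * 2 powr (- (\<alpha> + 1) * real n)"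
    and parent: "\<And>n \<theta>'. \<theta>' \<in> T (Suc n) \<Longrightarrow> \<exists>\<theta>\<in>T n. \<forall>S S'. (\<forall>x\<in>S. \<forall>y. dist x y \<le> erosion n / 2 \<longrightarrow> y \<in> S') \<longrightarrow>
      measure_pmf.prob (P n \<theta>) S \<le> measure_pmf.prob (P (Suc n) \<theta>') S'"
  shows "\<exists>N0. \<forall>n0\<ge>N0. \<exists>E\<in>events. E \<subseteq> intact n0 \<and> prob (intact n0 - E) \<le> \<epsilon> * prob (intact n0) \<and>
    (\<forall>\<omega>\<in>E. \<forall>n\<ge>n0. \<forall>\<theta>\<in>T n. 1/2 * 2 powr (- \<alpha> * (real n - real n0)) \<le>
       measure_pmf.prob (P n \<theta>) (far (erosion n) (removed \<omega> n)))"
proof -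
  define \<beta> where "\<beta> = (s - \<alpha>) / 4"
  have "s - \<alpha> = 4 * \<beta>" by (simp add: \<beta>_def)
  then have \<beta>: "0 < \<beta>" "s = \<alpha> + 4 * \<beta>" using s by linarith+
  define t where "t k = (\<kappa> + 2 * C3) / 2 ^ k + 2 powr (- \<beta> * real k)" for k
  define c0 where "c0 = 2 powr (- 2 * \<alpha>) / (4 ^ DIM('a) * (C2 * (DIM('a) * (D + 2)) powr s))"
  have c0: "0 < c0" using C D by (simp add: c0_def)
  define g where "g k = exp (C1 * (real k ^ 2 + 1)) * (2 ^ DIM('a) * exp (- c0 * 2 powr (2 * \<beta> * real k)))" for k
  have tpos: "0 \<le> t k" for k using \<kappa> C by (simp add: t_def)
  have gpos: "0 \<le> g k" for k by (simp add: g_def)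
  have "summable t"
    unfolding t_def using \<beta> by (intro summable_add summable_powr_neg summable_divide)
      (use summable_mult[OF summable_geometric[of "1/2::real"], of "\<kappa> + 2 * C3"] in \<open>simp_all add: power_one_over\<close>)
  then obtain N1 where N1: "\<And>n0 n. N1 \<le> n0 \<Longrightarrow> (\<Sum>k\<in>{n0<..n}. t k) \<le> 1/2"
    using summable_tail_le[of t "1/2"] by auto
  have "summable g" unfolding g_def by (rule summable_doubly_exponential) (use c0 \<beta> in auto)
  then obtain N2 where N2: "\<And>n0 n. N2 \<le> n0 \<Longrightarrow> (\<Sum>k\<in>{n0<..n}. g k) \<le> \<epsilon>"
    using summable_tail_le[of g \<epsilon>] \<epsilon> by auto
  obtain N3 :: nat where N3: "\<kappa> < 2 ^ N3" using real_arch_pow[of 2 \<kappa>] by auto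
  show ?thesis
  proof (intro exI[of _ "max N1 (max N2 N3)"] allI impI)
    fix n0 assume "max N1 (max N2 N3) \<le> n0"
    then have n0: "N1 \<le> n0" "N2 \<le> n0" "N3 \<le> n0" by auto
    \<comment> \<open>The deterministic bound to be maintained. The product of the factors
      \<open>1 - t k\<close> is replaced by one minus the sum of the \<open>t k\<close>, which is at
      least 1/2.\<close>
    define c where "c n = 2 powr (- \<alpha> * (real n - real n0)) * (1 - (\<Sum>k\<in>{n0<..n}. t k))" for n
    have chalf: "1/2 * 2 powr (- \<alpha> * (real n - real n0)) \<le> c n" for n
      using N1[OF n0(1), of n] unfolding c_def by (subst mult.commute) (intro mult_left_mono, auto)
    \<comment> \<open>The history is good up to level \<open>n\<close>. At level \<open>n0\<close>
      this holds on \<open>intact n0\<close>: nothing is removed there and the mass is 1.\<close>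
    define H where "H n a \<longleftrightarrow> a \<inter> J n0 = {} \<and> (\<forall>k\<in>{n0..n}. \<forall>\<theta>\<in>T k. c k \<le>
        measure_pmf.prob (P k \<theta>) (far (erosion k) (\<Union> (R ` (a \<inter> J k)))))" for n a
    define E where "E n = {\<omega>\<in>space M. H n (config (J n) \<omega>)}" for n
    have cfgJ: "config (J n) \<omega> \<inter> J k = config (J k) \<omega>" if "k \<le> n" for k n \<omega>
      using J_mono[OF that] by (auto simp: config_def)
    have Eev: "E n \<in> events" for n unfolding E_def by (rule config_event[OF finJ J_sub])
    have Ealt: "E n = {\<omega>\<in>intact n0. \<forall>k\<in>{n0..n}. \<forall>\<theta>\<in>T k. c k \<le> measure_pmf.prob (P k \<theta>) (far (erosion k) (removed \<omega> k))}"
      if "n0 \<le> n" for n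
      using that cfgJ by (auto simp: E_def H_def intact_def removed_def)
    have E0: "E n0 = intact n0"
      by (subst Ealt) (auto simp: c_def intact_def removed_def)
    have fail: "prob (E n - E (Suc n)) \<le> g (Suc n) * prob (E n)" if n: "n0 \<le> n" for n
    proof -
      let ?k = "Suc n"
      let ?B = "{?k} \<times> I ?k"
      define Bad where "Bad a b \<longleftrightarrow> (\<exists>\<theta>\<in>T ?k. measure_pmf.prob (P ?k \<theta>)
          (far (erosion ?k) (\<Union> (R ` a)) \<inter> far (erosion ?k) (\<Union> (R ` b))) < c ?k)" for a b
      have Bsub: "?B \<subseteq> (SIGMA n:{1..}. I n)" and Bfin: "finite ?B" using fin by auto
      have disj: "J n \<inter> ?B = {}" by (auto simp: J_def)
      have "E n - E ?k \<subseteq> {\<omega>\<in>space M. H n (config (J n) \<omega>) \<and> Bad (config (J n) \<omega>) (config ?B \<omega>)}"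
      proof safe
        fix \<omega> assume w: "\<omega> \<in> E n" "\<omega> \<notin> E ?k"
        show "\<omega> \<in> space M" "H n (config (J n) \<omega>)" using w by (auto simp: E_def)
        have cu: "config (J ?k) \<omega> = config (J n) \<omega> \<union> config ?B \<omega>" by (auto simp: config_def J_Suc)
        obtain \<theta> where "\<theta> \<in> T ?k" "measure_pmf.prob (P ?k \<theta>) (far (erosion ?k) (removed \<omega> ?k)) < c ?k"
          using w n Ealt[of n] Ealt[of ?k] by (force simp: le_Suc_eq not_le)
        then show "Bad (config (J n) \<omega>) (config ?B \<omega>)"
          unfolding Bad_def removed_def cu image_Un Union_Un_distrib far_Un by blast
      qed
      then have "prob (E n - E ?k) \<le> prob {\<omega>\<in>space M. H n (config (J n) \<omega>) \<and> Bad (config (J n) \<omega>) (config ?B \<omega>)}"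
      proof (rule finite_measure_mono)
        have "{\<omega>\<in>space M. H n (config (J ?k) \<omega> \<inter> J n) \<and> Bad (config (J ?k) \<omega> \<inter> J n) (config (J ?k) \<omega> \<inter> ?B)} \<in> events"
          by (rule config_event[OF finJ J_sub])
        moreover have "config (J ?k) \<omega> \<inter> ?B = config ?B \<omega>" for \<omega> by (auto simp: config_def J_Suc)
        ultimately show "{\<omega>\<in>space M. H n (config (J n) \<omega>) \<and> Bad (config (J n) \<omega>) (config ?B \<omega>)} \<in> events"
          by (simp add: cfgJ)
      qed
      also have "\<dots> \<le> g ?k * prob {\<omega>\<in>space M. H n (config (J n) \<omega>)}"
      proof (rule config_conditional_bound[OF finJ J_sub Bfin Bsub disj])
        fix a assume a: "a \<subseteq> J n" "H n a"
        define bad where "bad \<theta> = {\<omega>\<in>space M. measure_pmf.prob (P ?k \<theta>)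
          (far (erosion ?k) (\<Union> (R ` a)) \<inter> far (erosion ?k) (\<Union> (R ` config ?B \<omega>))) < c ?k}" for \<theta>
        have badev: "bad \<theta> \<in> events" for \<theta> unfolding bad_def by (rule config_event[OF Bfin Bsub])
        have bad: "prob (bad \<theta>) \<le> 2 ^ DIM('a) * exp (- c0 * 2 powr (2 * \<beta> * real ?k))" if th: "\<theta> \<in> T ?k" for \<theta>
        proof -
          \<comment> \<open>What the past leaves, at the finer erosion. A point farther than
            \<open>erosion n\<close> from the past remains in \<open>S\<close> when moved by at most
            \<open>erosion n / 2\<close>.\<close>
          define S where "S = far (erosion ?k) (\<Union> (R ` a))"
          obtain \<theta>0 where t0: "\<theta>0 \<in> T n" "\<And>S S'. (\<forall>x\<in>S. \<forall>y. dist x y \<le> erosion n / 2 \<longrightarrow> y \<in> S') \<Longrightarrow>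
              measure_pmf.prob (P n \<theta>0) S \<le> measure_pmf.prob (P ?k \<theta>) S'"
            using parent[OF th] by blast
          have "c n \<le> measure_pmf.prob (P n \<theta>0) (far (erosion n) (\<Union> (R ` (a \<inter> J n))))"
            using a(2) t0(1) n by (auto simp: H_def)
          also have "a \<inter> J n = a" using a(1) by auto
          also have "measure_pmf.prob (P n \<theta>0) (far (erosion n) (\<Union> (R ` a))) \<le> measure_pmf.prob (P ?k \<theta>) S"
          proof (rule t0(2), intro ballI allI impI)
            fix x y assume x: "x \<in> far (erosion n) (\<Union> (R ` a))" and y: "dist x y \<le> erosion n / 2"
            show "y \<in> S" unfolding S_def far_def mem_Collect_eq
            proof
              fix z assume z: "z \<in> \<Union> (R ` a)"
              have "erosion n < dist x z" using x z unfolding far_def by blast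
              then show "erosion ?k < dist y z"
                using y dist_triangle[of x z y] erosion_Suc_le[of n] by linarith
            qed
          qed
          finally have cS: "c n \<le> measure_pmf.prob (P ?k \<theta>) S" .
          \<comment> \<open>\<open>c n\<close> counts levels from \<open>n0\<close> and so exceeds
            the bound that \<open>one_level_tail\<close> asks for.\<close>
          have half: "1/2 * 2 powr (- \<alpha> * real ?k) \<le> measure_pmf.prob (P ?k \<theta>) S"
          proof -
            have "\<alpha> * (real n - real n0) \<le> \<alpha> * real ?k" using alpha by (intro mult_left_mono) auto
            then have "2 powr (- \<alpha> * real ?k) \<le> 2 powr (- \<alpha> * (real n - real n0))"
              by (intro powr_mono) auto
            then show ?thesis using chalf[of n] cS by linarith
          qed
          \<comment> \<open>Keeps the factor \<open>1 - t ?k\<close> nonnegative when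
            \<open>c n\<close> is replaced by the larger mass of \<open>S\<close>.\<close>
          have t1: "t ?k \<le> 1/2"
            using N1[OF n0(1), of ?k] member_le_sum[of ?k "{n0<..?k}" t] tpos n by force
          have cstep: "c ?k \<le> 2 powr (- \<alpha>) * (1 - t ?k) * measure_pmf.prob (P ?k \<theta>) S"
          proof -
            let ?s = "\<Sum>k\<in>{n0<..n}. t k"
            have seq: "(\<Sum>k\<in>{n0<..?k}. t k) = ?s + t ?k"
            proof -
              have "{n0<..?k} = insert ?k {n0<..n}" using n by auto
              then show ?thesis by simp
            qed
            have s0: "0 \<le> ?s" by (intro sum_nonneg tpos)
            have "c ?k = 2 powr (- \<alpha>) * (2 powr (- \<alpha> * (real n - real n0)) * (1 - (?s + t ?k)))"
              unfolding c_def seq by (simp add: powr_add[symmetric] algebra_simps)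
            also have "\<dots> \<le> 2 powr (- \<alpha>) * (2 powr (- \<alpha> * (real n - real n0)) * ((1 - ?s) * (1 - t ?k)))"
              using mult_nonneg_nonneg[OF s0 tpos[of ?k]] by (intro mult_left_mono) (auto simp: algebra_simps)
            also have "\<dots> = 2 powr (- \<alpha>) * (1 - t ?k) * c n" by (simp add: c_def)
            also have "\<dots> \<le> 2 powr (- \<alpha>) * (1 - t ?k) * measure_pmf.prob (P ?k \<theta>) S"
              using cS t1 by (intro mult_left_mono) auto
            finally show ?thesis .
          qed
          have "\<kappa> \<le> 2 ^ ?k"
          proof -
            have "(2::real) ^ N3 \<le> 2 ^ ?k" using n0 n by (intro power_increasing) auto
            then show ?thesis using N3 by linarith
          qed
          then have "prob {\<omega>\<in>space M. measure_pmf.prob (P ?k \<theta>) (S \<inter> far (erosion ?k) (\<Union> (R ` config ?B \<omega>)))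
              \<le> 2 powr (- \<alpha>) * (1 - t ?k) * measure_pmf.prob (P ?k \<theta>) S} \<le> 2 ^ DIM('a) * exp (- c0 * 2 powr (2 * \<beta> * real ?k))"
            unfolding t_def c0_def
            by (intro one_level_tail \<beta> C finP[OF th] fro[OF th] grid[OF th] half) auto
          moreover have "prob (bad \<theta>) \<le> prob {\<omega>\<in>space M. measure_pmf.prob (P ?k \<theta>) (S \<inter> far (erosion ?k) (\<Union> (R ` config ?B \<omega>)))
              \<le> 2 powr (- \<alpha>) * (1 - t ?k) * measure_pmf.prob (P ?k \<theta>) S}"
            using cstep unfolding bad_def S_def
            by (intro finite_measure_mono config_event[OF Bfin Bsub]) auto
          ultimately show ?thesis by linarith
        qed
        have "{\<omega>\<in>space M. Bad a (config ?B \<omega>)} = (\<Union>\<theta>\<in>T ?k. bad \<theta>)"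
          by (auto simp: Bad_def bad_def)
        also have "prob \<dots> \<le> (\<Sum>\<theta>\<in>T ?k. prob (bad \<theta>))"
          by (rule finite_measure_subadditive_finite) (use finT badev in auto)
        also have "\<dots> \<le> (\<Sum>\<theta>\<in>T ?k. 2 ^ DIM('a) * exp (- c0 * 2 powr (2 * \<beta> * real ?k)))"
          by (intro sum_mono bad)
        also have "\<dots> = real (card (T ?k)) * (2 ^ DIM('a) * exp (- c0 * 2 powr (2 * \<beta> * real ?k)))"
          by simp
        also have "\<dots> \<le> g ?k"
          unfolding g_def by (intro mult_right_mono cardT) auto
        finally show "prob {\<omega>\<in>space M. Bad a (config ?B \<omega>)} \<le> g ?k" .
      qed
      finally show ?thesis by (simp add: E_def)
    qed
    have mono: "E (Suc n) \<subseteq> E n" if "n0 \<le> n" for n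
      using that by (subst (1 2) Ealt) auto
    have Esub: "E n \<subseteq> intact n0" if "n0 \<le> n" for n using Ealt[OF that] by auto
    have lower: "prob (intact n0) * (1 - (\<Sum>k\<in>{n0<..n}. g k)) \<le> prob (E n)" if "n0 \<le> n" for n
      using that
    proof (induction n rule: dec_induct)
      case base
      then show ?case by (simp add: E0)
    next
      case (step n)
      have "prob (E n - E (Suc n)) = prob (E n) - prob (E (Suc n))"
        by (rule finite_measure_Diff) (use Eev mono step in auto)
      then have "prob (E (Suc n)) \<ge> prob (E n) - g (Suc n) * prob (E n)"
        using fail[of n] step by linarith
      moreover have "g (Suc n) * prob (E n) \<le> g (Suc n) * prob (intact n0)"
        by (intro mult_left_mono finite_measure_mono Esub step intact_event gpos)
      moreover have "(\<Sum>k\<in>{n0<..Suc n}. g k) = (\<Sum>k\<in>{n0<..n}. g k) + g (Suc n)"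
      proof -
        have "{n0<..Suc n} = insert (Suc n) {n0<..n}" using step by auto
        then show ?thesis by simp
      qed
      ultimately show ?case using step.IH by (simp add: algebra_simps)
    qed
    define F where "F = (\<Inter>n. E (n0 + n))"
    have dec: "decseq (\<lambda>n. E (n0 + n))" by (intro decseq_SucI) (use mono in auto)
    have Fev: "F \<in> events" unfolding F_def using Eev by auto
    have FD: "F \<subseteq> intact n0" using Esub[of "n0 + 0"] INT_lower[of 0 UNIV "\<lambda>n. E (n0 + n)"] by (auto simp: F_def)
    have "(\<lambda>n. prob (E (n0 + n))) \<longlonglongrightarrow> prob F"
      unfolding F_def by (rule finite_Lim_measure_decseq) (use Eev dec in auto)
    then have "prob (intact n0) * (1 - \<epsilon>) \<le> prob F"
    proof (rule LIMSEQ_le_const, intro exI allI impI)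
      fix n
      have "prob (intact n0) * (1 - \<epsilon>) \<le> prob (intact n0) * (1 - (\<Sum>k\<in>{n0<..n0 + n}. g k))"
        using N2[OF n0(2), of "n0 + n"] by (intro mult_left_mono) auto
      also have "\<dots> \<le> prob (E (n0 + n))" by (rule lower) simp
      finally show "prob (intact n0) * (1 - \<epsilon>) \<le> prob (E (n0 + n))" .
    qed
    moreover have "prob (intact n0 - F) = prob (intact n0) - prob F"
      by (rule finite_measure_Diff[OF intact_event Fev FD])
    ultimately have "prob (intact n0 - F) \<le> \<epsilon> * prob (intact n0)" by (simp add: algebra_simps)
    moreover have "1/2 * 2 powr (- \<alpha> * (real n - real n0)) \<le> measure_pmf.prob (P n \<theta>) (far (erosion n) (removed \<omega> n))"
      if w: "\<omega> \<in> F" "n0 \<le> n" "\<theta> \<in> T n" for \<omega> n \<theta>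
    proof -
      have "\<omega> \<in> E (n0 + (n - n0))" using w unfolding F_def by blast
      then have "c n \<le> measure_pmf.prob (P n \<theta>) (far (erosion n) (removed \<omega> n))"
        using w Ealt[of n] by auto
      then show ?thesis using chalf[of n] by linarith
    qed
    ultimately show "\<exists>E\<in>events. E \<subseteq> intact n0 \<and> prob (intact n0 - E) \<le> \<epsilon> * prob (intact n0) \<and>
      (\<forall>\<omega>\<in>E. \<forall>n\<ge>n0. \<forall>\<theta>\<in>T n. 1/2 * 2 powr (- \<alpha> * (real n - real n0)) \<le>
         measure_pmf.prob (P n \<theta>) (far (erosion n) (removed \<omega> n)))"
      using Fev FD by blast
  qed
qed

end


section \<open>Nets of iterated function systems\<close>

text \<open>Coordinates are rounded to multiples of \<epsilon>, and one member of \<open>T\<close>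
  is chosen for each rounded value that occurs. The net therefore consists of genuine
  parameters.\<close>

lemma finite_net:
  fixes p :: "'p \<Rightarrow> 'k \<Rightarrow> real" and B \<epsilon> :: real
  assumes A: "finite A" and B: "\<And>\<theta> k. \<theta> \<in> T \<Longrightarrow> k \<in> A \<Longrightarrow> \<bar>p \<theta> k\<bar> \<le> B" and \<epsilon>: "0 < \<epsilon>" "0 \<le> B"
  obtains N where "N \<subseteq> T" "finite N" "real (card N) \<le> (2 * B / \<epsilon> + 3) ^ card A"
    "\<And>\<theta>. \<theta> \<in> T \<Longrightarrow> \<exists>\<theta>'\<in>N. \<forall>k\<in>A. \<bar>p \<theta> k - p \<theta>' k\<bar> \<le> \<epsilon>"
proof -
  define q where "q \<theta> = (\<lambda>k\<in>A. \<lfloor>p \<theta> k / \<epsilon>\<rfloor>)" for \<theta>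
  define Z where "Z = {\<lfloor>- (B / \<epsilon>)\<rfloor>..\<lfloor>B / \<epsilon>\<rfloor>}"
  define rep where "rep z = (SOME \<theta>. \<theta> \<in> T \<and> q \<theta> = z)" for z
  have rep: "rep (q \<theta>) \<in> T" "q (rep (q \<theta>)) = q \<theta>" if "\<theta> \<in> T" for \<theta>
    using someI[of "\<lambda>\<theta>'. \<theta>' \<in> T \<and> q \<theta>' = q \<theta>" \<theta>] that by (auto simp: rep_def)
  have qZ: "q ` T \<subseteq> (\<Pi>\<^sub>E k\<in>A. Z)"
  proof (intro image_subsetI PiE_I)
    fix \<theta> k assume "\<theta> \<in> T" "k \<in> A"
    then have "- (B / \<epsilon>) \<le> p \<theta> k / \<epsilon>" "p \<theta> k / \<epsilon> \<le> B / \<epsilon>"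
      using B[of \<theta> k] \<epsilon> by (auto simp: field_simps)
    then show "q \<theta> k \<in> Z" using \<open>k \<in> A\<close> by (auto simp: q_def Z_def intro: floor_mono)
  qed (auto simp: q_def)
  have finE: "finite (\<Pi>\<^sub>E k\<in>A. Z)" using A by (intro finite_PiE) (auto simp: Z_def)
  have finq: "finite (q ` T)" by (rule finite_subset[OF qZ finE])
  have "real (card Z) \<le> 2 * B / \<epsilon> + 3"
  proof -
    have "card Z = nat (\<lfloor>B / \<epsilon>\<rfloor> - \<lfloor>- (B / \<epsilon>)\<rfloor> + 1)" by (simp add: Z_def)
    moreover have "0 \<le> B / \<epsilon>" using \<epsilon> by simp
    ultimately show ?thesis by linarith
  qed
  then have c: "real (card Z) ^ card A \<le> (2 * B / \<epsilon> + 3) ^ card A" by (intro power_mono) auto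
  have "card (rep ` q ` T) \<le> card (q ` T)" by (rule card_image_le[OF finq])
  also have "\<dots> \<le> card (\<Pi>\<^sub>E k\<in>A. Z)" by (rule card_mono[OF finE qZ])
  also have "\<dots> = card Z ^ card A" using A by (simp add: card_PiE)
  finally have "real (card (rep ` q ` T)) \<le> real (card Z ^ card A)" by (simp only: of_nat_le_iff)
  then have card: "real (card (rep ` q ` T)) \<le> (2 * B / \<epsilon> + 3) ^ card A"
    using c unfolding of_nat_power by (rule order_trans)
  have close: "\<exists>\<theta>'\<in>rep ` q ` T. \<forall>k\<in>A. \<bar>p \<theta> k - p \<theta>' k\<bar> \<le> \<epsilon>" if th: "\<theta> \<in> T" for \<theta>
  proof (rule bexI[of _ "rep (q \<theta>)"], rule ballI)
    fix k assume k: "k \<in> A"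
    have "\<lfloor>p \<theta> k / \<epsilon>\<rfloor> = \<lfloor>p (rep (q \<theta>)) k / \<epsilon>\<rfloor>"
      using fun_cong[OF rep(2)[OF th], of k] k by (simp add: q_def)
    then have "\<bar>p \<theta> k / \<epsilon> - p (rep (q \<theta>)) k / \<epsilon>\<bar> \<le> 1" by linarith
    then have "\<bar>(p \<theta> k - p (rep (q \<theta>)) k) / \<epsilon>\<bar> \<le> 1" by (simp only: diff_divide_distrib)
    then show "\<bar>p \<theta> k - p (rep (q \<theta>)) k\<bar> \<le> \<epsilon>" using \<epsilon> by (simp add: abs_divide)
  qed (use th in blast)
  show ?thesis using that[OF _ _ card close] rep(1) finq by blast
qed

lemma norm_le_coords:
  fixes x :: "'a::euclidean_space" and e :: real
  assumes "\<And>b. b \<in> Basis \<Longrightarrow> \<bar>x \<bullet> b\<bar> \<le> e"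
  shows "norm x \<le> DIM('a) * e"
proof -
  have "norm x \<le> (\<Sum>b\<in>Basis. \<bar>x \<bullet> b\<bar>)" by (rule norm_le_l1)
  also have "\<dots> \<le> (\<Sum>b\<in>(Basis::'a set). e)" by (intro sum_mono assms)
  finally show ?thesis by simp
qed

text \<open>Being affine, the letters differ by at most \<open>K\<close> on the invariant ball.
  Splitting off the first letter of a code bounds the distance \<open>d\<close> of the coding maps
  by \<open>K + c * d\<close>, so \<open>d \<le> K / (1 - c)\<close>.\<close>

lemma ifs_dist_le_params:
  fixes F G :: "('a::euclidean_space \<Rightarrow> 'a) list" and c R e :: real
  assumes F: "ifs F m c R" and G: "ifs G m c R" and m: "0 < m" and e: "0 \<le> e"
    and close: "\<And>i z. i < m \<Longrightarrow> z \<in> insert 0 Basis \<Longrightarrow> norm ((F ! i) z - (G ! i) z) \<le> e"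
  shows "ifs_dist F G \<le> e * (1 + 2 * DIM('a) * R) / (1 - c)"
proof -
  interpret F: ifs F m c R by fact
  interpret G: ifs G m c R by fact
  define K where "K = e * (1 + 2 * DIM('a) * R)"
  have step: "norm ((F ! i) x - (G ! i) x) \<le> K" if i: "i < m" and x: "norm x \<le> R" for i x
  proof -
    have fx: "(F ! i) x = (F ! i) 0 + (\<Sum>b\<in>Basis. (x \<bullet> b) *\<^sub>R ((F ! i) b - (F ! i) 0))"
      by (rule similarity_coordinates[OF F.letter(3)[OF i] F.letter(1)[OF i]])
    have gx: "(G ! i) x = (G ! i) 0 + (\<Sum>b\<in>Basis. (x \<bullet> b) *\<^sub>R ((G ! i) b - (G ! i) 0))"
      by (rule similarity_coordinates[OF G.letter(3)[OF i] G.letter(1)[OF i]])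
    have "(F ! i) x - (G ! i) x = ((F ! i) 0 + (\<Sum>b\<in>Basis. (x \<bullet> b) *\<^sub>R ((F ! i) b - (F ! i) 0))) -
        ((G ! i) 0 + (\<Sum>b\<in>Basis. (x \<bullet> b) *\<^sub>R ((G ! i) b - (G ! i) 0)))"
      by (rule arg_cong2[OF fx gx])
    also have "\<dots> = ((F ! i) 0 - (G ! i) 0) +
        (\<Sum>b\<in>Basis. (x \<bullet> b) *\<^sub>R (((F ! i) b - (G ! i) b) - ((F ! i) 0 - (G ! i) 0)))"
      by (simp add: scaleR_right_diff_distrib sum_subtractf)
    finally have eq: "(F ! i) x - (G ! i) x = ((F ! i) 0 - (G ! i) 0) +
        (\<Sum>b\<in>Basis. (x \<bullet> b) *\<^sub>R (((F ! i) b - (G ! i) b) - ((F ! i) 0 - (G ! i) 0)))" .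
    have "norm (\<Sum>b\<in>Basis. (x \<bullet> b) *\<^sub>R (((F ! i) b - (G ! i) b) - ((F ! i) 0 - (G ! i) 0))) \<le> (\<Sum>b\<in>(Basis::'a set). R * (2 * e))"
    proof (rule sum_norm_le)
      fix b :: 'a assume b: "b \<in> Basis"
      have "norm (((F ! i) b - (G ! i) b) - ((F ! i) 0 - (G ! i) 0)) \<le> 2 * e"
        using norm_triangle_ineq4[of "(F ! i) b - (G ! i) b" "(F ! i) 0 - (G ! i) 0"] close[OF i, of b] close[OF i, of 0] b by simp
      moreover have "\<bar>x \<bullet> b\<bar> \<le> R" using Basis_le_norm[OF b, of x] x by linarith
      ultimately show "norm ((x \<bullet> b) *\<^sub>R (((F ! i) b - (G ! i) b) - ((F ! i) 0 - (G ! i) 0))) \<le> R * (2 * e)"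
        using F.R by (auto intro!: mult_mono)
    qed
    also have "(\<Sum>b\<in>(Basis::'a set). R * (2 * e)) = e * (2 * DIM('a) * R)" by simp
    finally have "norm ((F ! i) x - (G ! i) x) \<le> norm ((F ! i) 0 - (G ! i) 0) + e * (2 * DIM('a) * R)"
      unfolding eq using norm_triangle_ineq[of "(F ! i) 0 - (G ! i) 0"] by (meson add_left_mono order_trans)
    also have "\<dots> \<le> K" using close[OF i, of 0] by (simp add: K_def algebra_simps)
    finally show ?thesis .
  qed
  have "ifs_dist F G \<le> K + c * ifs_dist F G"
  proof (rule ifs_dist_le[OF F.F _ m])
    fix w assume w: "w \<in> codes m"
    define i where "i = w 0"
    define v where "v = (\<lambda>n. w (n + 1))"
    have i: "i < m" "[i] \<in> words m" using w by (auto simp: i_def codes_def)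
    have v: "v \<in> codes m" using codes_suffix[OF w, of 1] by (simp add: v_def)
    have wv: "w = [i] \<frown> v" using codes_split[of w 1] by (simp add: i_def v_def)
    have e1: "ifs_proj F w = (F ! i) (ifs_proj F v)" "ifs_proj G w = (G ! i) (ifs_proj G v)"
      unfolding wv using F.proj_conc[OF i(2) v] G.proj_conc[OF i(2) v] by auto
    have "dist (ifs_proj F w) (ifs_proj G w) \<le> dist ((F ! i) (ifs_proj F v)) ((G ! i) (ifs_proj F v)) +
        dist ((G ! i) (ifs_proj F v)) ((G ! i) (ifs_proj G v))"
      unfolding e1 by (rule dist_triangle)
    also have "dist ((F ! i) (ifs_proj F v)) ((G ! i) (ifs_proj F v)) \<le> K"
      unfolding dist_norm by (rule step[OF i(1) F.proj_norm[OF v]])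
    also have "dist ((G ! i) (ifs_proj F v)) ((G ! i) (ifs_proj G v)) = sim_ratio (G ! i) * dist (ifs_proj F v) (ifs_proj G v)"
      using G.letter(3)[OF i(1)] by (simp add: similarity_def)
    also have "\<dots> \<le> c * ifs_dist F G"
      using G.ratio_le[OF i(1)] G.letter(1)[OF i(1)] dist_proj_le_ifs_dist[OF F.F G.F v] F.c by (intro mult_mono) auto
    finally show "dist (ifs_proj F w) (ifs_proj G w) \<le> K + c * ifs_dist F G" by simp
  qed
  then have "ifs_dist F G * (1 - c) \<le> K" by (simp add: algebra_simps)
  then show ?thesis using F.c by (simp add: K_def pos_le_divide_eq)
qed

text \<open>A tuple and a translation are described by a fixed number \<open>card A\<close> of
  reals. Rounding at the scale \<open>erosion n\<close> leaves a multiple of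
  \<open>2 ^ (n\<^sup>2)\<close> values for each of them, which explains the size of the
  net.\<close>

lemma ifs_net:
  fixes \<G> :: "('a::euclidean_space \<Rightarrow> 'a) list set" and c R r :: real
  assumes G: "\<And>G. G \<in> \<G> \<Longrightarrow> ifs G m c R" and m: "0 < m" and r: "0 \<le> r" and cR: "0 < c" "c < 1" "0 \<le> R"
  obtains N :: "nat \<Rightarrow> (('a \<Rightarrow> 'a) list \<times> 'a) set" and C where "\<And>n. N n \<subseteq> \<G> \<times> cball 0 r" "\<And>n. finite (N n)"
    "\<And>n. real (card (N n)) \<le> exp (C * (real n ^ 2 + 1))"
    "\<And>n G v. G \<in> \<G> \<Longrightarrow> v \<in> cball 0 r \<Longrightarrow> \<exists>(G', v')\<in>N n. ifs_dist G G' \<le> erosion n / 8 \<and> dist v v' \<le> erosion n / 8"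
proof -
  define d where "d = real DIM('a)"
  have d: "1 \<le> d" by (simp add: d_def Suc_leI)
  \<comment> \<open>The index \<open>i = m\<close>, beyond the letters, stands for the
    translation.\<close>
  define p :: "('a \<Rightarrow> 'a) list \<times> 'a \<Rightarrow> nat \<times> 'a \<times> 'a \<Rightarrow> real" where
    "p = (\<lambda>(G, v) (i, z, b). (if i < m then (G ! i) z else v) \<bullet> b)"
  define A :: "(nat \<times> 'a \<times> 'a) set" where "A = {..m} \<times> insert 0 Basis \<times> Basis"
  define B where "B = R + 1 + r"
  have B: "0 \<le> B" using cR r by (simp add: B_def)
  have finA: "finite A" by (simp add: A_def)
  have pB: "\<bar>p \<theta> k\<bar> \<le> B" if th: "\<theta> \<in> \<G> \<times> cball 0 r" and k: "k \<in> A" for \<theta> k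
  proof -
    obtain G v where t: "\<theta> = (G, v)" "G \<in> \<G>" "norm v \<le> r" using th by auto
    obtain i z b where kk: "k = (i, z, b)" "z \<in> insert 0 Basis" "b \<in> Basis" using k by (auto simp: A_def)
    interpret ifs G m c R by (rule G[OF t(2)])
    have "norm ((G ! i) z) \<le> R + 1" if "i < m"
    proof -
      have "norm z \<le> 1" using kk by auto
      have "norm ((G ! i) z) \<le> norm ((G ! i) 0) + dist ((G ! i) z) ((G ! i) 0)"
        by (metis dist_norm norm_triangle_sub)
      also have "dist ((G ! i) z) ((G ! i) 0) = sim_ratio (G ! i) * norm z"
        using letter(3)[OF that] by (simp add: similarity_def)
      also have "\<dots> \<le> 1 * 1" using letter[OF that] \<open>norm z \<le> 1\<close> by (intro mult_mono) auto
      also have "norm ((G ! i) 0) \<le> R" using letter_cball[OF that, of 0] cR by simp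
      finally show ?thesis by simp
    qed
    then have "norm (if i < m then (G ! i) z else v) \<le> B" using t cR r by (auto simp: B_def)
    then show ?thesis using Basis_le_norm[OF kk(3), of "if i < m then (G ! i) z else v"]
      by (simp add: p_def t kk)
  qed
  define K where "K = (1 + 2 * d * R) / (1 - c)"
  have K: "0 < K" using cR d by (simp add: K_def add_pos_nonneg)
  \<comment> \<open>Small enough for the factor \<open>K\<close> of
    \<open>ifs_dist_le_params\<close> and for the passage from coordinates to norms, which costs
    \<open>d\<close>.\<close>
  define \<eta> where "\<eta> = 1 / (8 * d * (K + 1))"
  have d\<eta>: "d * \<eta> = 1 / (8 * (K + 1))" using d by (simp add: \<eta>_def)
  have \<eta>: "0 < \<eta>" "d * \<eta> * K \<le> 1 / 8" "d * \<eta> \<le> 1 / 8"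
    unfolding d\<eta> using d K by (simp_all add: \<eta>_def field_simps add_pos_pos)
  have "\<forall>n. \<exists>N. N \<subseteq> \<G> \<times> cball 0 r \<and> finite N \<and> real (card N) \<le> (2 * B / (\<eta> * erosion n) + 3) ^ card A \<and>
    (\<forall>\<theta>\<in>\<G> \<times> cball 0 r. \<exists>\<theta>'\<in>N. \<forall>k\<in>A. \<bar>p \<theta> k - p \<theta>' k\<bar> \<le> \<eta> * erosion n)"
  proof
    fix n
    have pos: "0 < \<eta> * erosion n" using \<eta> erosion_pos by simp
    show "\<exists>N. N \<subseteq> \<G> \<times> cball 0 r \<and> finite N \<and> real (card N) \<le> (2 * B / (\<eta> * erosion n) + 3) ^ card A \<and>
      (\<forall>\<theta>\<in>\<G> \<times> cball 0 r. \<exists>\<theta>'\<in>N. \<forall>k\<in>A. \<bar>p \<theta> k - p \<theta>' k\<bar> \<le> \<eta> * erosion n)"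
      by (rule finite_net[OF finA pB pos B]) blast+
  qed
  from choice[OF this] obtain N where N: "\<And>n. N n \<subseteq> \<G> \<times> cball 0 r" "\<And>n. finite (N n)"
    "\<And>n. real (card (N n)) \<le> (2 * B / (\<eta> * erosion n) + 3) ^ card A"
    "\<And>n \<theta>. \<theta> \<in> \<G> \<times> cball 0 r \<Longrightarrow> \<exists>\<theta>'\<in>N n. \<forall>k\<in>A. \<bar>p \<theta> k - p \<theta>' k\<bar> \<le> \<eta> * erosion n" by blast
  define Q where "Q = 2 * B / \<eta> + 3"
  have Q: "3 \<le> Q" using B \<eta> by (simp add: Q_def)
  define C where "C = card A * (ln Q + ln 2)"
  have card: "real (card (N n)) \<le> exp (C * (real n ^ 2 + 1))" for n
  proof -
    have e1: "erosion n = exp (- ln 2 * real n ^ 2)"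
    proof -
      have "erosion n = exp (- ln 2) ^ (n ^ 2)" by (simp add: erosion_def exp_minus inverse_eq_divide)
      also have "\<dots> = exp (real (n ^ 2) * - ln 2)" by (simp only: exp_of_nat_mult)
      finally show ?thesis by (simp add: mult.commute)
    qed
    have e1': "erosion n \<le> 1" unfolding erosion_def by (intro power_le_one) auto
    have "2 * B / (\<eta> * erosion n) + 3 \<le> Q / erosion n"
      using e1' erosion_pos[of n] by (simp add: Q_def add_divide_distrib pos_le_divide_eq)
    also have "\<dots> = exp (ln Q + ln 2 * real n ^ 2)"
      using Q by (simp add: e1 exp_add exp_minus divide_inverse)
    also have "\<dots> \<le> exp ((ln Q + ln 2) * (real n ^ 2 + 1))"
      using Q by (simp add: algebra_simps add_nonneg_nonneg)
    finally have "2 * B / (\<eta> * erosion n) + 3 \<le> exp ((ln Q + ln 2) * (real n ^ 2 + 1))" .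
    then have "(2 * B / (\<eta> * erosion n) + 3) ^ card A \<le> exp ((ln Q + ln 2) * (real n ^ 2 + 1)) ^ card A"
      using B \<eta> erosion_pos[of n] by (intro power_mono) (auto intro!: add_nonneg_nonneg divide_nonneg_nonneg)
    also have "\<dots> = exp (C * (real n ^ 2 + 1))"
      unfolding C_def exp_of_nat_mult[symmetric] by (simp add: mult_ac)
    finally show ?thesis using N(3)[of n] by linarith
  qed
  have close: "\<exists>(G', v')\<in>N n. ifs_dist G G' \<le> erosion n / 8 \<and> dist v v' \<le> erosion n / 8"
    if Gv: "G \<in> \<G>" "v \<in> cball 0 r" for n G v
  proof -
    obtain \<theta>' where th: "\<theta>' \<in> N n" "\<And>k. k \<in> A \<Longrightarrow> \<bar>p (G, v) k - p \<theta>' k\<bar> \<le> \<eta> * erosion n"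
      using N(4)[of "(G, v)" n] Gv by blast
    obtain G' v' where t': "\<theta>' = (G', v')" by (cases \<theta>')
    have G': "G' \<in> \<G>" using N(1)[of n] th(1) t' by blast
    let ?e = "d * (\<eta> * erosion n)"
    have v: "norm (v - v') \<le> ?e"
      unfolding d_def
    proof (rule norm_le_coords)
      fix b :: 'a assume "b \<in> Basis"
      then show "\<bar>(v - v') \<bullet> b\<bar> \<le> \<eta> * erosion n"
        using th(2)[of "(m, 0, b)"] by (simp add: t' p_def A_def inner_diff_left)
    qed
    have z: "norm ((G ! i) z - (G' ! i) z) \<le> ?e" if "i < m" "z \<in> insert 0 Basis" for i z
      unfolding d_def
    proof (rule norm_le_coords)
      fix b :: 'a assume "b \<in> Basis"
      then show "\<bar>((G ! i) z - (G' ! i) z) \<bullet> b\<bar> \<le> \<eta> * erosion n"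
        using th(2)[of "(i, z, b)"] that by (simp add: t' p_def A_def inner_diff_left)
    qed
    have e0: "0 < erosion n" by (rule erosion_pos)
    have "ifs_dist G G' \<le> ?e * (1 + 2 * DIM('a) * R) / (1 - c)"
      by (rule ifs_dist_le_params[OF G[OF Gv(1)] G[OF G'] m _ z]) (use d \<eta> e0 in auto)
    also have "\<dots> = (d * \<eta> * K) * erosion n" by (simp add: K_def d_def)
    also have "\<dots> \<le> 1 / 8 * erosion n" using \<eta>(2) e0 by (intro mult_right_mono) auto
    finally have "ifs_dist G G' \<le> erosion n / 8" by simp
    moreover have "dist v v' \<le> erosion n / 8"
    proof -
      have "?e = (d * \<eta>) * erosion n" by simp
      also have "\<dots> \<le> 1 / 8 * erosion n" using \<eta>(3) e0 by (intro mult_right_mono) auto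
      finally show ?thesis using v by (simp add: dist_norm)
    qed
    ultimately show ?thesis using th(1) t' by (intro bexI[of _ "(G', v')"]) auto
  qed
  show ?thesis
  proof (rule that[of N C])
    show "N n \<subseteq> \<G> \<times> cball 0 r" "finite (N n)" "real (card (N n)) \<le> exp (C * (real n ^ 2 + 1))" for n
      by (fact N(1), fact N(2), fact card)
    show "\<exists>(G', v')\<in>N n. ifs_dist G G' \<le> erosion n / 8 \<and> dist v v' \<le> erosion n / 8"
      if "G \<in> \<G>" "v \<in> cball 0 r" for n G v by (rule close[OF that])
  qed
qed


section \<open>Uniform laws on blocks of words\<close>

lemma pair_pmf_of_set:
  assumes "finite A" "A \<noteq> {}" "finite B" "B \<noteq> {}"
  shows "pair_pmf (pmf_of_set A) (pmf_of_set B) = pmf_of_set (A \<times> B)"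
proof (rule pmf_eqI)
  fix p
  show "pmf (pair_pmf (pmf_of_set A) (pmf_of_set B)) p = pmf (pmf_of_set (A \<times> B)) p"
    using assms by (cases p) (simp add: pmf_pair pmf_of_set indicator_def card_cartesian_product)
qed

text \<open>Both laws are images of one \<open>q\<close>; under this coupling the first event is
  contained in the second.\<close>

lemma map_pmf_prob_mono:
  assumes "\<And>u. u \<in> set_pmf q \<Longrightarrow> f u \<in> S \<Longrightarrow> f' u \<in> S'"
  shows "measure_pmf.prob (map_pmf f q) S \<le> measure_pmf.prob (map_pmf f' q) S'"
proof -
  have "measure_pmf.prob (map_pmf f q) S = measure_pmf.prob q (f -` S \<inter> set_pmf q)"
    by (simp add: measure_Int_set_pmf)
  also have "\<dots> \<le> measure_pmf.prob q (f' -` S')"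
    using assms by (intro measure_pmf.finite_measure_mono) auto
  finally show ?thesis by simp
qed

text \<open>A family of tuples with common words and constants. The prefix \<open>pre\<close>
  confines the measures to a small cylinder, which can be placed in a prescribed open region;
  \<open>\<kappa>p\<close> bounds its ratio from below and \<open>r0\<close> is the size of the
  translations.\<close>

locale ifs_patch =
  fixes \<G> :: "('a::euclidean_space \<Rightarrow> 'a) list set" and m :: nat and c R :: real
    and W :: "nat list set" and b g \<delta> s \<alpha> :: real and pre :: "nat list" and \<kappa>p r0 :: real
  assumes sub: "\<And>G. G \<in> \<G> \<Longrightarrow> subsystem G m c R W b g \<delta>" and ne: "\<G> \<noteq> {}"
    and \<alpha>: "0 < \<alpha>" "\<alpha> < s" and dimension: "1 \<le> card W * b powr s"
    and pre: "pre \<in> words m" and \<kappa>p: "0 < \<kappa>p" "\<kappa>p \<le> 1"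
    and pre_ratio: "\<And>G. G \<in> \<G> \<Longrightarrow> \<kappa>p \<le> wratio G pre"
    and r0: "0 < r0"
begin

definition blk :: "nat \<Rightarrow> nat list list set" where "blk L = {us. set us \<subseteq> W \<and> length us = L}"

definition node :: "('a \<Rightarrow> 'a) list \<times> 'a \<Rightarrow> nat list list \<Rightarrow> 'a" where
  "node \<theta> us = ifs_proj (fst \<theta>) ((pre @ concat us) \<frown> (\<lambda>_. 0)) + snd \<theta>"

text \<open>The number of blocks that resolves the scale \<open>erosion n\<close>. The factor
  \<open>2 * R + g + \<delta>\<close> and the base \<open>max b c\<close> secure the three bounds of
  \<open>len_bounds\<close> at once.\<close>

definition len :: "nat \<Rightarrow> nat" where
  "len n = (LEAST l. (2 * R + g + \<delta>) * max b c ^ l \<le> erosion n / 8)"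

definition law :: "nat \<Rightarrow> ('a \<Rightarrow> 'a) list \<times> 'a \<Rightarrow> 'a pmf" where
  "law n \<theta> = map_pmf (node \<theta>) (pmf_of_set (blk (len n)))"

definition par :: "(('a \<Rightarrow> 'a) list \<times> 'a) set" where "par = \<G> \<times> cball 0 r0"

lemma constants: "0 < b" "b < 1" "0 < c" "c < 1" "0 \<le> R" "0 < g" "0 < \<delta>" "finite W" "2 \<le> card W" "0 < m"
proof -
  obtain G where "G \<in> \<G>" using ne by blast
  then interpret subsystem G m c R W b g \<delta> by (rule sub)
  show "0 < b" "b < 1" "0 < c" "c < 1" "0 \<le> R" "0 < g" "0 < \<delta>" "finite W" "2 \<le> card W" "0 < m"
    using b c R g \<delta> finW card_W m_pos by auto
qed

lemma blk_finite: "finite (blk L)"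
  unfolding blk_def by (rule finite_lists_length_eq[OF constants(8)])

lemma blk_card: "card (blk L) = card W ^ L"
  unfolding blk_def by (rule card_lists_length_eq[OF constants(8)])

lemma blk_ne: "blk L \<noteq> {}"
proof -
  have "0 < card (blk L)" using constants(9) by (simp add: blk_card)
  then show ?thesis by (auto simp: card_gt_0_iff)
qed

lemma len_spec: "(2 * R + g + \<delta>) * max b c ^ len n \<le> erosion n / 8"
proof -
  have "(\<lambda>l. (2 * R + g + \<delta>) * max b c ^ l) \<longlonglongrightarrow> (2 * R + g + \<delta>) * 0"
    using constants by (intro tendsto_mult_left LIMSEQ_realpow_zero) auto
  then have "eventually (\<lambda>l. (2 * R + g + \<delta>) * max b c ^ l < erosion n / 8) sequentially"
    using erosion_pos[of n] by (intro order_tendstoD(2)) auto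
  then obtain l where "(2 * R + g + \<delta>) * max b c ^ l < erosion n / 8" by (auto simp: eventually_sequentially)
  then show ?thesis unfolding len_def by (intro LeastI[of "\<lambda>l. (2 * R + g + \<delta>) * max b c ^ l \<le> erosion n / 8" l]) simp
qed

lemma len_bounds:
  "c ^ len n * (2 * R) \<le> erosion n / 8" "g * b ^ len n \<le> erosion n / 8" "\<delta> * b ^ len n \<le> erosion n / 8"
proof -
  have bc: "b ^ len n \<le> max b c ^ len n" "c ^ len n \<le> max b c ^ len n" "0 \<le> max b c ^ len n"
    using constants by (auto intro!: power_mono)
  have mono: "x * y \<le> (2 * R + g + \<delta>) * max b c ^ len n"
    if "0 \<le> x" "x \<le> 2 * R + g + \<delta>" "0 \<le> y" "y \<le> max b c ^ len n" for x y
    using that bc(3) by (intro mult_mono) auto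
  have "2 * R * c ^ len n \<le> (2 * R + g + \<delta>) * max b c ^ len n"
    "g * b ^ len n \<le> (2 * R + g + \<delta>) * max b c ^ len n" "\<delta> * b ^ len n \<le> (2 * R + g + \<delta>) * max b c ^ len n"
    by (rule mono; use bc constants in simp)+
  then show "c ^ len n * (2 * R) \<le> erosion n / 8" "g * b ^ len n \<le> erosion n / 8" "\<delta> * b ^ len n \<le> erosion n / 8"
    using len_spec[of n] by (simp_all add: mult.commute)
qed

lemma erosion_mono: "n \<le> k \<Longrightarrow> erosion k \<le> erosion n"
  unfolding erosion_def by (intro power_decreasing) auto

lemma len_mono: "n \<le> k \<Longrightarrow> len n \<le> len k"
  unfolding len_def[of n] using len_spec[of k] erosion_mono[of n k] by (intro Least_le) simp

lemma law_finite: "finite (set_pmf (law n \<theta>))"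
  by (simp add: law_def blk_ne blk_finite)

lemma law_prob: "measure_pmf.prob (law n \<theta>) S = card {us\<in>blk (len n). node \<theta> us \<in> S} / real (card W) ^ len n"
  by (simp add: law_def measure_pmf_of_set blk_ne blk_finite blk_card vimage_def Int_def)

lemma node_eq:
  assumes "G \<in> \<G>" "us \<in> blk L"
  shows "node (G, v) us = wmap G pre (subsystem.point G us) + v"
proof -
  interpret G: subsystem G m c R W b g \<delta> by (rule sub[OF assms(1)])
  have "concat us \<in> words m" using G.concat_words assms(2) by (auto simp: blk_def)
  then have "ifs_proj G (pre \<frown> (concat us \<frown> (\<lambda>_. 0))) = wmap G pre (G.point us)"
    unfolding G.point_def by (intro G.proj_conc pre conc_codes G.zero_code)
  then show ?thesis by (simp add: node_def)
qed

lemma node_code: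
  assumes "G \<in> \<G>" "us \<in> blk L"
  obtains w where "w \<in> codes m" "node (G, v) us = ifs_proj G (pre \<frown> w) + v"
proof -
  interpret G: subsystem G m c R W b g \<delta> by (rule sub[OF assms(1)])
  have "concat us \<in> words m" using G.concat_words assms(2) by (auto simp: blk_def)
  then have "concat us \<frown> (\<lambda>_. 0) \<in> codes m" by (intro conc_codes G.zero_code)
  then show ?thesis using that[of "concat us \<frown> (\<lambda>_. 0)"] by (simp add: node_def)
qed

text \<open>Points of a ball of radius \<open>r\<close> are at most \<open>2 * r\<close> apart, and
  undoing the prefix enlarges this by at most \<open>1 / \<kappa>p\<close>. The sequences are long
  enough for \<open>frostman_count\<close> because
  \<open>erosion n \<le> (1/2) ^ n \<le> r\<close>.\<close>

lemma law_frostman: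
  assumes th: "\<theta> \<in> par" and r: "(1/2) ^ n \<le> r"
  shows "measure_pmf.prob (law n \<theta>) (cball x r) \<le> (2 / (\<kappa>p * g)) powr s * r powr s"
proof -
  obtain G v where t: "\<theta> = (G, v)" "G \<in> \<G>" using th by (auto simp: par_def)
  interpret G: subsystem G m c R W b g \<delta> by (rule sub[OF t(2)])
  have rpos: "0 < r" using r by (meson less_le_trans zero_less_divide_1_iff zero_less_numeral zero_less_power)
  define A where "A = {us\<in>blk (len n). node \<theta> us \<in> cball x r}"
  have "real (card A) \<le> real (card W) ^ len n * ((2 * r / \<kappa>p) / g) powr s"
  proof (rule G.frostman_count)
    show "A \<subseteq> G.blocks (len n)" by (auto simp: A_def blk_def G.blocks_def)
    fix us vs assume uv: "us \<in> A" "vs \<in> A"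
    have "dist (node \<theta> us) (node \<theta> vs) \<le> 2 * r"
      using uv dist_triangle2[of "node \<theta> us" "node \<theta> vs" x] by (auto simp: A_def dist_commute)
    moreover have "dist (node \<theta> us) (node \<theta> vs) = wratio G pre * dist (G.point us) (G.point vs)"
    proof -
      have "us \<in> blk (len n)" "vs \<in> blk (len n)" using uv by (auto simp: A_def)
      then show ?thesis unfolding t(1) by (simp only: node_eq[OF t(2)] dist_add_cancel2 G.dist_wmap[OF pre])
    qed
    moreover have "\<kappa>p * dist (G.point us) (G.point vs) \<le> wratio G pre * dist (G.point us) (G.point vs)"
      using pre_ratio[OF t(2)] by (intro mult_right_mono) auto
    ultimately show "dist (G.point us) (G.point vs) \<le> 2 * r / \<kappa>p"
      using \<kappa>p by (simp add: pos_le_divide_eq mult.commute)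
  next
    have "g * b ^ len n \<le> (1/2) ^ n" using len_bounds(2)[of n] erosion_le[of n] erosion_pos[of n] by linarith
    also have "\<dots> \<le> r" by (rule r)
    also have "r \<le> 2 * r / \<kappa>p" using \<kappa>p rpos by (simp add: pos_le_divide_eq)
    finally show "g * b ^ len n \<le> 2 * r / \<kappa>p" .
  qed (use \<alpha> dimension in auto)
  moreover have "(2 * r / \<kappa>p) / g = 2 / (\<kappa>p * g) * r" by simp
  moreover have "(2 / (\<kappa>p * g) * r) powr s = (2 / (\<kappa>p * g)) powr s * r powr s"
    using \<kappa>p constants rpos by (intro powr_mult)
  moreover have "0 < real (card W) ^ len n" using constants by auto
  ultimately show ?thesis unfolding law_prob A_def by (simp add: pos_divide_le_eq mult.commute)
qed

lemma law_strip:
  assumes th: "\<theta> \<in> par" and a: "norm a = 1"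
  shows "measure_pmf.prob (law n \<theta>) {x. \<bar>a \<bullet> x - t\<bar> \<le> erosion n}
    \<le> (erosion n / (\<kappa>p * \<delta>)) powr (log b (1 - 1 / card W))"
proof -
  obtain G v where th': "\<theta> = (G, v)" "G \<in> \<G>" using th by (auto simp: par_def)
  interpret G: subsystem G m c R W b g \<delta> by (rule sub[OF th'(2)])
  obtain a' where a': "norm a' = norm a" "\<And>x. a \<bullet> wmap G pre x = a \<bullet> wmap G pre 0 + wratio G pre * (a' \<bullet> x)"
    using similarity_inner[OF G.word_similarity[OF pre] G.wratio_pos[OF pre], of a] by blast
  define t' where "t' = (t - a \<bullet> v - a \<bullet> wmap G pre 0) / wratio G pre"
  have r: "\<kappa>p \<le> wratio G pre" "0 < wratio G pre" using pre_ratio[OF th'(2)] \<kappa>p by auto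
  have sub: "{us\<in>blk (len n). node \<theta> us \<in> {x. \<bar>a \<bullet> x - t\<bar> \<le> erosion n}} \<subseteq>
      {us\<in>G.blocks (len n). \<bar>a' \<bullet> G.point us - t'\<bar> \<le> erosion n / \<kappa>p}"
  proof safe
    fix us assume us: "us \<in> blk (len n)" and le: "\<bar>a \<bullet> node \<theta> us - t\<bar> \<le> erosion n"
    show "us \<in> G.blocks (len n)" using us by (simp add: blk_def G.blocks_def)
    have "a \<bullet> node \<theta> us - t = wratio G pre * (a' \<bullet> G.point us - t')"
      using r unfolding th'(1) node_eq[OF th'(2) us] inner_add_right a'(2)[of "G.point us"] by (simp add: t'_def field_simps)
    then have "wratio G pre * \<bar>a' \<bullet> G.point us - t'\<bar> \<le> erosion n" using le r by (simp add: abs_mult)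
    moreover have "\<kappa>p * \<bar>a' \<bullet> G.point us - t'\<bar> \<le> wratio G pre * \<bar>a' \<bullet> G.point us - t'\<bar>"
      using r by (intro mult_right_mono) auto
    ultimately show "\<bar>a' \<bullet> G.point us - t'\<bar> \<le> erosion n / \<kappa>p"
      using \<kappa>p by (simp add: pos_le_divide_eq mult.commute)
  qed
  have "real (card {us\<in>blk (len n). node \<theta> us \<in> {x. \<bar>a \<bullet> x - t\<bar> \<le> erosion n}}) \<le>
     real (card {us\<in>G.blocks (len n). \<bar>a' \<bullet> G.point us - t'\<bar> \<le> erosion n / \<kappa>p})"
    using card_mono[OF _ sub] G.finite_blocks by simp
  also have "\<dots> \<le> real (card W) ^ len n * ((erosion n / \<kappa>p) / \<delta>) powr (log b (1 - 1 / card W))"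
  proof (rule G.hyperplane_count)
    have "\<delta> * b ^ len n \<le> erosion n" using len_bounds(3)[of n] erosion_pos[of n] by linarith
    also have "\<dots> \<le> erosion n / \<kappa>p" using \<kappa>p erosion_pos[of n] by (simp add: pos_le_divide_eq)
    finally show "\<delta> * b ^ len n \<le> erosion n / \<kappa>p" .
  qed (use a' a in simp)
  finally show ?thesis
    unfolding law_prob using constants(9) by (subst pos_divide_le_eq) (auto simp: mult.commute)
qed

lemma node_norm:
  assumes "\<theta> \<in> par" "us \<in> blk L"
  shows "norm (node \<theta> us) \<le> R + r0"
proof -
  obtain G v where t: "\<theta> = (G, v)" "G \<in> \<G>" "norm v \<le> r0" using assms by (auto simp: par_def)
  interpret G: subsystem G m c R W b g \<delta> by (rule sub[OF t(2)])
  obtain w where w: "w \<in> codes m" "node (G, v) us = ifs_proj G (pre \<frown> w) + v"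
    by (rule node_code[OF t(2) assms(2)])
  then show ?thesis
    using G.proj_norm[OF conc_codes[OF pre w(1)]] t norm_triangle_ineq[of "ifs_proj G (pre \<frown> w)" v] by simp
qed

text \<open>At most a multiple of \<open>2 ^ n\<close> of the strips in \<open>near_grid n\<close>
  meet the support, and each has mass at most of order \<open>erosion n powr \<gamma>\<close>, that
  is \<open>2 powr (- \<gamma> * n\<^sup>2)\<close>. However small \<gamma> is, this decays faster
  than any exponential.\<close>

lemma law_grid:
  obtains C3 where "0 \<le> C3"
    "\<And>n \<theta>. \<theta> \<in> par \<Longrightarrow> measure_pmf.prob (law n \<theta>) (near_grid n) \<le> C3 * 2 powr (- (\<alpha> + 1) * real n)"
proof -
  define X where "X = R + r0"
  have X: "0 < X" using constants r0 by (simp add: X_def)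
  define \<gamma> where "\<gamma> = log b (1 - 1 / card W)"
  have \<gamma>: "0 < \<gamma>"
  proof -
    have "ln (1 - 1 / real (card W)) < 0" "ln b < 0" using constants by auto
    then show ?thesis unfolding \<gamma>_def log_def by (simp add: divide_neg_neg)
  qed
  define C where "C = DIM('a) * (2 * X + 5) * (1 / (\<kappa>p * \<delta>)) powr \<gamma>"
  have C: "0 \<le> C" using X by (simp add: C_def)
  have bound: "measure_pmf.prob (law n \<theta>) (near_grid n) \<le> C * 2 powr ((\<alpha> + 2)\<^sup>2 / (4 * \<gamma>)) * 2 powr (- (\<alpha> + 1) * real n)"
    if th: "\<theta> \<in> par" for n \<theta>
  proof -
    define K where "K = \<lceil>(X + 1) * 2 ^ n\<rceil>"
    define Jn where "Jn = {- K..K}"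
    define strip where "strip = (\<lambda>(b::'a, j::int). {x. \<bar>b \<bullet> x - real_of_int j / 2 ^ n\<bar> \<le> erosion n})"
    have e1: "erosion n \<le> 1" unfolding erosion_def by (intro power_le_one) auto
    have "measure_pmf.prob (law n \<theta>) (near_grid n) = measure_pmf.prob (law n \<theta>) (near_grid n \<inter> set_pmf (law n \<theta>))"
      by (simp add: measure_Int_set_pmf)
    also have "\<dots> \<le> measure_pmf.prob (law n \<theta>) (\<Union>p\<in>Basis \<times> Jn. strip p)"
    proof (intro measure_pmf.finite_measure_mono subsetI)
      fix x assume x: "x \<in> near_grid n \<inter> set_pmf (law n \<theta>)"
      then obtain b j where bj: "b \<in> Basis" "\<bar>x \<bullet> b - real_of_int j / 2 ^ n\<bar> \<le> erosion n" by (auto simp: near_grid_def)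
      have "norm x \<le> X" using x node_norm[OF th] by (auto simp: law_def blk_ne blk_finite X_def)
      then have "\<bar>x \<bullet> b\<bar> \<le> X" using Basis_le_norm[OF bj(1), of x] by linarith
      then have "\<bar>real_of_int j / 2 ^ n\<bar> \<le> X + 1" using bj(2) e1 by linarith
      then have "\<bar>real_of_int j\<bar> \<le> (X + 1) * 2 ^ n" by (simp add: abs_divide pos_divide_le_eq)
      then have "\<bar>j\<bar> \<le> K" unfolding K_def by linarith
      then have "j \<in> Jn" by (auto simp: Jn_def)
      then show "x \<in> (\<Union>p\<in>Basis \<times> Jn. strip p)" using bj by (auto simp: strip_def inner_commute intro!: bexI[of _ b] bexI[of _ j])
    qed simp
    also have "\<dots> \<le> (\<Sum>p\<in>Basis \<times> Jn. measure_pmf.prob (law n \<theta>) (strip p))"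
      by (rule measure_pmf.finite_measure_subadditive_finite) (auto simp: Jn_def)
    also have "\<dots> \<le> (\<Sum>p\<in>(Basis::'a set) \<times> Jn. (erosion n / (\<kappa>p * \<delta>)) powr \<gamma>)"
      unfolding strip_def \<gamma>_def by (intro sum_mono) (auto intro!: law_strip[OF th])
    also have "\<dots> = real DIM('a) * real (card Jn) * (erosion n / (\<kappa>p * \<delta>)) powr \<gamma>"
      by (simp add: card_cartesian_product)
    also have "\<dots> \<le> real DIM('a) * ((2 * X + 5) * 2 ^ n) * (erosion n / (\<kappa>p * \<delta>)) powr \<gamma>"
    proof (intro mult_right_mono mult_left_mono)
      have p1: "1 \<le> (2::real) ^ n" by simp
      have "0 < K" unfolding K_def using X by simp
      then have p2: "real (card Jn) = 2 * real_of_int K + 1" by (simp add: Jn_def)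
      have p3: "real_of_int K < (X + 1) * 2 ^ n + 1" unfolding K_def by linarith
      have "real_of_int K < X * 2 ^ n + 2 ^ n + 1" using p3 by (simp add: distrib_right)
      then have "real (card Jn) \<le> 2 * (X * 2 ^ n) + 5 * 2 ^ n" using p1 p2 by linarith
      then show "real (card Jn) \<le> (2 * X + 5) * 2 ^ n" by (simp add: distrib_right)
    qed auto
    also have "\<dots> = C * (2 powr real n * erosion n powr \<gamma>)"
      using \<kappa>p constants erosion_pos[of n] by (simp add: C_def powr_realpow powr_divide powr_mult mult_ac)
    also have "2 powr real n * erosion n powr \<gamma> = 2 powr (real n - \<gamma> * real n ^ 2)"
    proof -
      have e: "erosion n = 2 powr (- (real n ^ 2))"
        by (simp add: erosion_def powr_minus power_one_over inverse_eq_divide flip: powr_realpow of_nat_power)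
      have "erosion n powr \<gamma> = 2 powr (- (\<gamma> * real n ^ 2))" unfolding e powr_powr by (simp add: mult.commute)
      then show ?thesis by (simp add: powr_add[symmetric])
    qed
    also have "\<dots> \<le> 2 powr ((\<alpha> + 2)\<^sup>2 / (4 * \<gamma>) + - (\<alpha> + 1) * real n)"
    proof (rule powr_mono)
      \<comment> \<open>Completing the square is the origin of the constant
        \<open>(\<alpha> + 2)\<^sup>2 / (4 * \<gamma>)\<close>.\<close>
      have "0 \<le> \<gamma> * (real n - (\<alpha> + 2) / (2 * \<gamma>))\<^sup>2" using \<gamma> by simp
      also have "\<dots> = \<gamma> * real n ^ 2 - (\<alpha> + 2) * real n + (\<alpha> + 2)\<^sup>2 / (4 * \<gamma>)"
        using \<gamma> by (simp add: power2_eq_square field_simps)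
      finally show "real n - \<gamma> * real n ^ 2 \<le> (\<alpha> + 2)\<^sup>2 / (4 * \<gamma>) + - (\<alpha> + 1) * real n"
        by (simp add: algebra_simps)
    qed simp
    finally show ?thesis using C by (simp add: powr_add mult_left_mono mult.assoc)
  qed
  show ?thesis by (rule that[OF _ bound]) (use C in simp)
qed

text \<open>Cutting a sequence after \<open>k\<close> blocks identifies the uniform law with a
  product of uniform laws. This couples the laws of different levels.\<close>

lemma take_blocks:
  assumes "k \<le> l"
  shows "map_pmf (take k) (pmf_of_set (blk l)) = pmf_of_set (blk k)"
proof -
  let ?f = "\<lambda>(x, y). x @ (y :: nat list list)"
  have bij: "bij_betw ?f (blk k \<times> blk (l - k)) (blk l)"
  proof (rule bij_betw_imageI)
    show "inj_on ?f (blk k \<times> blk (l - k))" by (auto simp: inj_on_def blk_def)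
    have "us \<in> ?f ` (blk k \<times> blk (l - k))" if "us \<in> blk l" for us
      using that assms by (intro image_eqI[of _ _ "(take k us, drop k us)"])
        (auto simp: blk_def dest: in_set_takeD in_set_dropD)
    then show "?f ` (blk k \<times> blk (l - k)) = blk l" using assms by (auto simp: blk_def)
  qed
  have "pmf_of_set (blk l) = map_pmf ?f (pmf_of_set (blk k \<times> blk (l - k)))"
    by (rule map_pmf_of_set_bij_betw[OF bij, symmetric]) (use blk_ne blk_finite in auto)
  also have "pmf_of_set (blk k \<times> blk (l - k)) = pair_pmf (pmf_of_set (blk k)) (pmf_of_set (blk (l - k)))"
    by (rule pair_pmf_of_set[symmetric]) (use blk_ne blk_finite in auto)
  finally have "map_pmf (take k) (pmf_of_set (blk l)) =
      map_pmf (\<lambda>p. take k (?f p)) (pair_pmf (pmf_of_set (blk k)) (pmf_of_set (blk (l - k))))"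
    by (simp add: map_pmf_comp)
  also have "\<dots> = map_pmf fst (pair_pmf (pmf_of_set (blk k)) (pmf_of_set (blk (l - k))))"
    by (rule map_pmf_cong[OF refl]) (use blk_ne blk_finite in \<open>auto simp: blk_def\<close>)
  finally show ?thesis by (simp add: map_fst_pair_pmf)
qed

text \<open>Both laws are read off one uniform block sequence of length \<open>len k\<close>.
  Truncating it, changing the tuple and changing the translation move the point by at most
  \<open>erosion n / 8\<close> each, which is less than \<open>erosion n / 2\<close> in total. With
  \<open>n = k\<close> the lemma compares two parameters of one level.\<close>

lemma law_transport:
  assumes th: "(G, v) \<in> par" "(G', v') \<in> par" and nk: "n \<le> k"
    and close: "ifs_dist G G' \<le> erosion n / 8" "dist v v' \<le> erosion n / 8"
    and S: "\<And>x y. x \<in> S \<Longrightarrow> dist x y \<le> erosion n / 2 \<Longrightarrow> y \<in> S'"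
  shows "measure_pmf.prob (law n (G, v)) S \<le> measure_pmf.prob (law k (G', v')) S'"
proof -
  have G: "G \<in> \<G>" "G' \<in> \<G>" using th by (auto simp: par_def)
  interpret G: subsystem G m c R W b g \<delta> by (rule sub[OF G(1)])
  interpret G': subsystem G' m c R W b g \<delta> by (rule sub[OF G(2)])
  have "law n (G, v) = map_pmf (\<lambda>us. node (G, v) (take (len n) us)) (pmf_of_set (blk (len k)))"
    unfolding law_def take_blocks[OF len_mono[OF nk], symmetric] by (simp add: map_pmf_comp)
  moreover have "measure_pmf.prob (map_pmf (\<lambda>us. node (G, v) (take (len n) us)) (pmf_of_set (blk (len k)))) S
      \<le> measure_pmf.prob (law k (G', v')) S'"
    unfolding law_def
  proof (rule map_pmf_prob_mono)
    fix us assume us: "us \<in> set_pmf (pmf_of_set (blk (len k)))" and x: "node (G, v) (take (len n) us) \<in> S"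
    have usb: "set us \<subseteq> W" "length us = len k" using us by (auto simp: blk_ne blk_finite) (auto simp: blk_def)
    let ?t = "take (len n) us" let ?d = "drop (len n) us"
    have tW: "set ?t \<subseteq> W" "set ?d \<subseteq> W" using usb by (auto dest: in_set_takeD in_set_dropD)
    have words: "concat ?t \<in> words m" "concat ?d \<in> words m" using G.concat_words tW by auto
    have cc: "concat us = concat ?t @ concat ?d" by (metis append_take_drop_id concat_append)
    let ?z = "(\<lambda>_. 0) :: nat \<Rightarrow> nat"
    have zc: "?z \<in> codes m" "concat ?d \<frown> ?z \<in> codes m" using G.zero_code words conc_codes by auto
    have pw: "pre @ concat ?t \<in> words m" using pre words by simp
    \<comment> \<open>No word of \<open>W\<close> is empty, so \<open>len n\<close> blocks contain
      at least \<open>len n\<close> letters.\<close>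
    have "length ?t \<le> length (concat ?t)"
    proof -
      have "length xs \<le> length (concat xs)" if "set xs \<subseteq> W" for xs
        using that
      proof (induction xs)
        case (Cons a xs)
        have "a \<noteq> []" using Cons.prems G.Nil_W by auto
        then have "1 \<le> length a" by (simp add: Suc_leI)
        then show ?case using Cons by simp
      qed simp
      then show ?thesis using tW by blast
    qed
    then have ll: "len n \<le> length (pre @ concat ?t)" using usb len_mono[OF nk] by simp
    have "dist (ifs_proj G ((pre @ concat ?t) \<frown> ?z)) (ifs_proj G ((pre @ concat ?t) \<frown> (concat ?d \<frown> ?z)))
        \<le> c ^ length (pre @ concat ?t) * (2 * R)"
      by (rule G.dist_proj_conc_le[OF pw zc])
    also have "\<dots> \<le> c ^ len n * (2 * R)"
      using constants ll by (intro mult_right_mono power_decreasing) auto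
    finally have d1: "dist (ifs_proj G ((pre @ concat ?t) \<frown> ?z)) (ifs_proj G ((pre @ concat us) \<frown> ?z)) \<le> erosion n / 8"
      using len_bounds(1)[of n] by (simp add: cc)
    have "(pre @ concat us) \<frown> ?z \<in> codes m" using pre words zc cc by (intro conc_codes) auto
    then have d2: "dist (ifs_proj G ((pre @ concat us) \<frown> ?z)) (ifs_proj G' ((pre @ concat us) \<frown> ?z)) \<le> erosion n / 8"
      using dist_proj_le_ifs_dist[OF G.F G'.F] close(1) by (meson order_trans)
    have "dist (node (G, v) ?t) (node (G', v') us) \<le>
       dist (ifs_proj G ((pre @ concat ?t) \<frown> ?z)) (ifs_proj G' ((pre @ concat us) \<frown> ?z)) + dist v v'"
      unfolding node_def by (simp add: dist_triangle_add)
    also have "\<dots> \<le> erosion n / 2"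
      using d1 d2 close(2) erosion_pos[of n]
        dist_triangle[of "ifs_proj G ((pre @ concat ?t) \<frown> ?z)" "ifs_proj G' ((pre @ concat us) \<frown> ?z)" "ifs_proj G ((pre @ concat us) \<frown> ?z)"]
      by linarith
    finally show "node (G', v') us \<in> S'" by (rule S[OF x])
  qed
  ultimately show ?thesis by simp
qed

end


section \<open>Compact families\<close>

lemma ifs_dist_commute: "F \<in> sim_tuples m \<Longrightarrow> G \<in> sim_tuples m \<Longrightarrow> ifs_dist F G = ifs_dist G F"
  by (simp add: ifs_dist_def sim_tuples_def norm_minus_commute)

text \<open>A Lebesgue number argument. If \<open>H\<close> failed for \<Gamma> but held for all
  balls of radius \<eta>, finitely many of them could not cover \<Gamma>, and an \<eta>-separated
  sequence would contradict compactness. So there are bad balls of every radius; their centres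
  accumulate at some \<open>l\<close>, and a good neighbourhood of \<open>l\<close> swallows one of
  them.\<close>

lemma ifs_compact_local_to_global:
  fixes \<Gamma> :: "('a::euclidean_space \<Rightarrow> 'a) list set"
  assumes \<Gamma>: "\<Gamma> \<subseteq> sim_tuples m" "ifs_compact \<Gamma>" and m: "0 < m"
    and empty: "H {}" and sub: "\<And>A B. H B \<Longrightarrow> A \<subseteq> B \<Longrightarrow> H A" and Un: "\<And>A B. H A \<Longrightarrow> H B \<Longrightarrow> H (A \<union> B)"
    and loc: "\<And>F. F \<in> \<Gamma> \<Longrightarrow> \<exists>\<epsilon>>0. H {G\<in>\<Gamma>. ifs_dist G F < \<epsilon>}"
  shows "H \<Gamma>"
proof (rule ccontr)
  assume no: "\<not> H \<Gamma>"
  have bad: "\<exists>F\<in>\<Gamma>. \<not> H {G\<in>\<Gamma>. ifs_dist G F < \<eta>}" if \<eta>: "0 < \<eta>" for \<eta> :: real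
  proof (rule ccontr)
    assume all: "\<not> (\<exists>F\<in>\<Gamma>. \<not> H {G\<in>\<Gamma>. ifs_dist G F < \<eta>})"
    have "\<exists>f. \<forall>n::nat. f n \<in> \<Gamma> \<and> (\<forall>j<n. \<eta> \<le> ifs_dist (f n) (f j))"
    proof (rule dependent_wellorder_choice)
      fix n :: nat and f assume f: "\<And>y. y < n \<Longrightarrow> f y \<in> \<Gamma> \<and> (\<forall>j<y. \<eta> \<le> ifs_dist (f y) (f j))"
      have "H (\<Union>j<k. {G\<in>\<Gamma>. ifs_dist G (f j) < \<eta>})" if "k \<le> n" for k
        using that
      proof (induction k)
        case (Suc k)
        have "H {G\<in>\<Gamma>. ifs_dist G (f k) < \<eta>}" using f[of k] all Suc.prems by auto
        then have "H ((\<Union>j<k. {G\<in>\<Gamma>. ifs_dist G (f j) < \<eta>}) \<union> {G\<in>\<Gamma>. ifs_dist G (f k) < \<eta>})"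
          using Suc by (intro Un) auto
        then show ?case by (simp add: lessThan_Suc Un_commute)
      qed (simp add: empty)
      then have "\<not> \<Gamma> \<subseteq> (\<Union>j<n. {G\<in>\<Gamma>. ifs_dist G (f j) < \<eta>})" using no sub by blast
      then show "\<exists>r. r \<in> \<Gamma> \<and> (\<forall>j<n. \<eta> \<le> ifs_dist r (f j))" by (force simp: not_less)
    qed auto
    then obtain f where f: "\<And>n::nat. f n \<in> \<Gamma>" "\<And>n j. j < n \<Longrightarrow> \<eta> \<le> ifs_dist (f n) (f j)" by blast
    obtain r l where r: "strict_mono (r::nat \<Rightarrow> nat)" "l \<in> \<Gamma>" "(\<lambda>n. ifs_dist (f (r n)) l) \<longlonglongrightarrow> 0"
      using \<Gamma>(2) f(1) unfolding ifs_compact_def by blast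
    have "eventually (\<lambda>n. ifs_dist (f (r n)) l < \<eta> / 2) sequentially"
      using r(3) \<eta> by (intro order_tendstoD(2)) auto
    then obtain n where n: "\<And>k. n \<le> k \<Longrightarrow> ifs_dist (f (r k)) l < \<eta> / 2" by (auto simp: eventually_sequentially)
    have "\<eta> \<le> ifs_dist (f (r (Suc n))) (f (r n))" using r(1) by (intro f(2)) (simp add: strict_mono_def)
    also have "\<dots> \<le> ifs_dist (f (r (Suc n))) l + ifs_dist (f (r n)) l"
      using f(1) r(2) \<Gamma>(1) m by (intro ifs_dist_triangle) auto
    also have "\<dots> < \<eta>" using n[of n] n[of "Suc n"] by simp
    finally show False by simp
  qed
  have "\<forall>k. \<exists>F. F \<in> \<Gamma> \<and> \<not> H {G\<in>\<Gamma>. ifs_dist G F < 1 / real (Suc k)}"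
    using bad by (metis of_nat_0_less_iff zero_less_Suc zero_less_divide_1_iff)
  from choice[OF this] obtain f where f: "\<And>k. f k \<in> \<Gamma>" "\<And>k. \<not> H {G\<in>\<Gamma>. ifs_dist G (f k) < 1 / real (Suc k)}" by blast
  obtain r l where r: "strict_mono (r::nat \<Rightarrow> nat)" "l \<in> \<Gamma>" "(\<lambda>n. ifs_dist (f (r n)) l) \<longlonglongrightarrow> 0"
    using \<Gamma>(2) f(1) unfolding ifs_compact_def by blast
  obtain \<epsilon> where \<epsilon>: "0 < \<epsilon>" "H {G\<in>\<Gamma>. ifs_dist G l < \<epsilon>}" using loc[OF r(2)] by blast
  have "eventually (\<lambda>n. ifs_dist (f (r n)) l < \<epsilon> / 2) sequentially"
    using r(3) \<epsilon> by (intro order_tendstoD(2)) auto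
  moreover have "eventually (\<lambda>n. 1 / real (Suc n) < \<epsilon> / 2) sequentially"
    using LIMSEQ_inverse_real_of_nat \<epsilon> by (intro order_tendstoD(2)) (auto simp: inverse_eq_divide)
  ultimately have "eventually (\<lambda>n. ifs_dist (f (r n)) l < \<epsilon> / 2 \<and> 1 / real (Suc n) < \<epsilon> / 2) sequentially"
    by eventually_elim auto
  then obtain n where n: "ifs_dist (f (r n)) l < \<epsilon> / 2" "1 / real (Suc n) < \<epsilon> / 2" by (auto simp: eventually_sequentially)
  have "1 / real (Suc (r n)) \<le> 1 / real (Suc n)" using seq_suble[OF r(1), of n] by (simp add: frac_le)
  then have small: "1 / real (Suc (r n)) < \<epsilon> / 2" using n by linarith
  have "{G\<in>\<Gamma>. ifs_dist G (f (r n)) < 1 / real (Suc (r n))} \<subseteq> {G\<in>\<Gamma>. ifs_dist G l < \<epsilon>}"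
  proof safe
    fix G assume G: "G \<in> \<Gamma>" "ifs_dist G (f (r n)) < 1 / real (Suc (r n))"
    have "ifs_dist G l \<le> ifs_dist G (f (r n)) + ifs_dist l (f (r n))"
      using G f(1) r(2) \<Gamma>(1) m by (intro ifs_dist_triangle) auto
    also have "ifs_dist l (f (r n)) = ifs_dist (f (r n)) l"
      using f(1) r(2) \<Gamma>(1) by (intro ifs_dist_commute) auto
    finally show "ifs_dist G l < \<epsilon>" using G n small by linarith
  qed
  then show False using sub[OF \<epsilon>(2)] f(2) by blast
qed

text \<open>Every requirement of a patch holds at \<open>F0\<close> with room to spare and concerns
  coded points or ratios of words. \<open>ifs_dist\<close> controls coded points directly, and
  ratios through them, uniformly over all words.\<close>

lemma patch_at:
  fixes F0 :: "('a::euclidean_space \<Rightarrow> 'a) list"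
  assumes F0: "F0 \<in> sim_tuples m" and nh: "\<not> in_hyperplane (attractor F0)"
    and \<alpha>: "0 < \<alpha>" "\<alpha> < hausdorff_dim (attractor F0)"
    and U: "open U" "attractor F0 \<inter> U \<noteq> {}"
  obtains \<epsilon> where "0 < \<epsilon>" "\<And>\<G>. \<G> \<subseteq> {G\<in>sim_tuples m. ifs_dist G F0 < \<epsilon>} \<Longrightarrow> \<G> \<noteq> {} \<Longrightarrow>
     \<exists>c R W b g \<delta> s pre \<kappa>p r0. ifs_patch \<G> m c R W b g \<delta> s \<alpha> pre \<kappa>p r0 \<and>
       (\<forall>G\<in>\<G>. \<forall>w\<in>codes m. cball (ifs_proj G (pre \<frown> w)) r0 \<subseteq> U)"
proof -
  obtain c0 R0 where "ifs F0 m c0 R0" by (rule sim_tuple_ifs[OF F0])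
  then interpret F: ifs F0 m c0 R0 .
  obtain W b g \<delta> s where sb: "subsystem F0 m c0 R0 W b g \<delta>" and s: "\<alpha> < s" "1 \<le> card W * b powr s"
    and strict: "\<And>u. u \<in> W \<Longrightarrow> b < wratio F0 u"
    by (rule F.subsystem_exists[OF nh \<alpha>]) (rule that)
  interpret S: subsystem F0 m c0 R0 W b g \<delta> by (rule sb)
  \<comment> \<open>Two codes with distinct images serve as a yardstick: the ratio of
    \<open>u\<close> is the distance of the images of \<open>u \<frown> w1\<close> and
    \<open>u \<frown> w2\<close> divided by that of the images of \<open>w1\<close> and
    \<open>w2\<close>.\<close>
  obtain w1 w2 where w12: "w1 \<in> codes m" "w2 \<in> codes m" "ifs_proj F0 w1 \<noteq> ifs_proj F0 w2"
  proof (rule ccontr)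
    assume "\<not> thesis"
    then have same: "ifs_proj F0 w = ifs_proj F0 (\<lambda>_. 0)" if "w \<in> codes m" for w
      using S.zero_code that \<open>\<And>w1 w2. w1 \<in> codes m \<Longrightarrow> w2 \<in> codes m \<Longrightarrow> ifs_proj F0 w1 \<noteq> ifs_proj F0 w2 \<Longrightarrow> thesis\<close> by blast
    obtain a :: 'a where "norm a = 1" using vector_choose_size[of 1] by auto
    then have "in_hyperplane (attractor F0)"
      unfolding in_hyperplane_def F.attractor_eq using same
      by (intro exI[of _ a] exI[of _ "a \<bullet> ifs_proj F0 (\<lambda>_. 0)"]) (auto simp del: norm_eq_zero)
    then show False using nh by blast
  qed
  define L where "L = dist (ifs_proj F0 w1) (ifs_proj F0 w2)"
  have L: "0 < L" using w12 by (simp add: L_def)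
  obtain ws where ws: "ws \<in> codes m" "ifs_proj F0 ws \<in> U" using U(2) by (auto simp: F.attractor_eq)
  obtain e0 where e0: "0 < e0" "ball (ifs_proj F0 ws) e0 \<subseteq> U" using U(1) ws(2) openE by blast
  \<comment> \<open>A quarter of the radius each for the size of the cylinder of \<open>pre\<close>,
    for the change of the tuple and for the translation; the last quarter makes the inclusion
    strict.\<close>
  define \<rho> where "\<rho> = e0 / 4"
  have \<rho>: "0 < \<rho>" using e0 by (simp add: \<rho>_def)
  have "(\<lambda>N. c0 ^ N * (2 * R0)) \<longlonglongrightarrow> 0 * (2 * R0)" using F.c by (intro tendsto_mult_right LIMSEQ_realpow_zero) auto
  then have "eventually (\<lambda>N. c0 ^ N * (2 * R0) < \<rho>) sequentially" using \<rho> by (intro order_tendstoD(2)) auto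
  then obtain N where N: "c0 ^ N * (2 * R0) < \<rho>" by (auto simp: eventually_sequentially)
  define pre where "pre = map ws [0..<N]"
  have pre: "pre \<in> words m" "length pre = N" using codes_prefix[OF ws(1)] by (simp_all add: pre_def)
  have prepos: "0 < wratio F0 pre" "wratio F0 pre \<le> 1"
    using F.wratio_pos[OF pre(1)] F.wratio_le[OF pre(1)] power_le_one[of c0 N] F.c pre(2) by auto
  \<comment> \<open>The strict inequality \<open>b < wratio F0 u\<close> leaves this room for a
    change of the ratios, so \<open>b\<close> can be kept.\<close>
  define gap where "gap = Min ((\<lambda>u. wratio F0 u - b) ` W)"
  have Wne: "W \<noteq> {}" using S.card_W by auto
  have gap1: "0 < gap" using S.finW Wne strict unfolding gap_def by (subst Min_gr_iff) auto
  have gap2: "gap \<le> wratio F0 u - b" if "u \<in> W" for u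
    unfolding gap_def by (rule Min_le) (use S.finW that in simp_all)
  note gap = gap1 gap2
  define \<tau> where "\<tau> = Min {gap, (1 - c0) / 2, wratio F0 pre / 2}"
  have \<tau>: "0 < \<tau>" "\<tau> \<le> gap" "\<tau> \<le> (1 - c0) / 2" "\<tau> \<le> wratio F0 pre / 2"
  proof -
    show "0 < \<tau>" using gap1 F.c prepos by (simp add: \<tau>_def)
    show "\<tau> \<le> gap" "\<tau> \<le> (1 - c0) / 2" "\<tau> \<le> wratio F0 pre / 2" unfolding \<tau>_def by (rule Min_le; simp)+
  qed
  define \<epsilon> where "\<epsilon> = Min {\<tau> * L / 4, g / 4, \<delta> / 2, \<rho>, 1}"
  have \<epsilon>: "0 < \<epsilon>" "\<epsilon> \<le> \<tau> * L / 4" "\<epsilon> \<le> g / 4" "\<epsilon> \<le> \<delta> / 2" "\<epsilon> \<le> \<rho>" "\<epsilon> \<le> 1"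
  proof -
    show "0 < \<epsilon>" using \<tau>(1) L S.g S.\<delta> \<rho> by (simp add: \<epsilon>_def)
    show "\<epsilon> \<le> \<tau> * L / 4" "\<epsilon> \<le> g / 4" "\<epsilon> \<le> \<delta> / 2" "\<epsilon> \<le> \<rho>" "\<epsilon> \<le> 1" unfolding \<epsilon>_def by (rule Min_le; simp)+
  qed
  define c where "c = (1 + c0) / 2"
  have c: "0 < c" "c < 1" using F.c by (auto simp: c_def)
  \<comment> \<open>Coded points of nearby tuples have norm at most \<open>R0 + 1\<close>. The value
    of a letter at 0 is compared with its value at a coded point, which gives twice this
    bound.\<close>
  define R where "R = 2 * (R0 + 1) / (1 - c)"
  have R: "0 \<le> R" "(1 - c) * R = 2 * (R0 + 1)" using F.R c by (auto simp: R_def)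
  have near: "\<exists>cG RG. ifs G m cG RG \<and> (\<forall>w\<in>codes m. dist (ifs_proj G w) (ifs_proj F0 w) \<le> \<epsilon>) \<and>
     (\<forall>u\<in>words m. \<bar>wratio G u - wratio F0 u\<bar> \<le> \<tau>)"
    if G: "G \<in> sim_tuples m" "ifs_dist G F0 < \<epsilon>" for G
  proof -
    obtain cG RG where "ifs G m cG RG" by (rule sim_tuple_ifs[OF G(1)])
    then interpret G: ifs G m cG RG .
    have d: "dist (ifs_proj G w) (ifs_proj F0 w) \<le> \<epsilon>" if "w \<in> codes m" for w
      using dist_proj_le_ifs_dist[OF G(1) F0 that] G(2) by linarith
    have "\<bar>wratio G u - wratio F0 u\<bar> \<le> \<tau>" if u: "u \<in> words m" for u
    proof -
      define x where "x = dist (ifs_proj G (u \<frown> w1)) (ifs_proj G (u \<frown> w2))"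
      define y where "y = dist (ifs_proj G w1) (ifs_proj G w2)"
      define r where "r = wratio G u"
      have r: "0 < r" "r \<le> 1" using G.wratio_pos[OF u] G.wratio_le[OF u] power_le_one[of cG "length u"] G.c by (auto simp: r_def)
      have diff: "\<bar>dist a b - dist a' b'\<bar> \<le> 2 * \<epsilon>" if "dist a a' \<le> \<epsilon>" "dist b b' \<le> \<epsilon>" for a b a' b' :: 'a
        using that dist_triangle[of a b a'] dist_triangle[of a' b b'] dist_triangle[of a' b' a] dist_triangle[of a b' b]
        by (simp add: dist_commute abs_le_iff)
      have x: "x = r * y" unfolding x_def r_def y_def by (rule G.dist_proj_conc[OF u w12(1,2)])
      have "dist (ifs_proj F0 (u \<frown> w1)) (ifs_proj F0 (u \<frown> w2)) = wratio F0 u * L"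
        unfolding L_def by (rule F.dist_proj_conc[OF u w12(1,2)])
      then have 1: "\<bar>r * y - wratio F0 u * L\<bar> \<le> 2 * \<epsilon>"
        using diff[OF d[OF conc_codes[OF u w12(1)]] d[OF conc_codes[OF u w12(2)]]] by (simp add: x[symmetric] x_def)
      have "\<bar>y - L\<bar> \<le> 2 * \<epsilon>" unfolding y_def L_def by (rule diff[OF d[OF w12(1)] d[OF w12(2)]])
      then have "r * \<bar>y - L\<bar> \<le> 1 * (2 * \<epsilon>)" using r \<epsilon>(1) by (intro mult_mono) auto
      then have 2: "\<bar>r * y - r * L\<bar> \<le> 2 * \<epsilon>" using r by (simp add: right_diff_distrib[symmetric] abs_mult)
      have "\<bar>r * L - wratio F0 u * L\<bar> \<le> 4 * \<epsilon>" using 1 2 by linarith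
      also have "\<dots> \<le> \<tau> * L" using \<epsilon>(2) by simp
      finally have "\<bar>r - wratio F0 u\<bar> * L \<le> \<tau> * L" using L by (simp add: left_diff_distrib[symmetric] abs_mult)
      then show ?thesis using L by (simp add: r_def)
    qed
    then show ?thesis using d \<open>ifs G m cG RG\<close> by blast
  qed
  have patch: "\<exists>c R W b g \<delta> s pre \<kappa>p r0. ifs_patch \<G> m c R W b g \<delta> s \<alpha> pre \<kappa>p r0 \<and>
       (\<forall>G\<in>\<G>. \<forall>w\<in>codes m. cball (ifs_proj G (pre \<frown> w)) r0 \<subseteq> U)"
    if \<G>: "\<G> \<subseteq> {G\<in>sim_tuples m. ifs_dist G F0 < \<epsilon>}" "\<G> \<noteq> {}" for \<G>
  proof -
    have sub: "subsystem G m c R W b (g / 2) (\<delta> / 2)" if GG: "G \<in> \<G>" for G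
    proof -
      have G: "G \<in> sim_tuples m" "ifs_dist G F0 < \<epsilon>" using \<G>(1) GG by auto
      obtain cG RG where ifsG: "ifs G m cG RG" and d: "\<forall>w\<in>codes m. dist (ifs_proj G w) (ifs_proj F0 w) \<le> \<epsilon>"
        and rat: "\<forall>u\<in>words m. \<bar>wratio G u - wratio F0 u\<bar> \<le> \<tau>" using near[OF G] by blast
      interpret G: ifs G m cG RG by (rule ifsG)
      have pn: "norm (ifs_proj G w) \<le> R0 + 1" if "w \<in> codes m" for w
      proof -
        have "norm (ifs_proj G w) \<le> norm (ifs_proj F0 w) + dist (ifs_proj G w) (ifs_proj F0 w)"
          by (metis dist_norm norm_triangle_sub)
        then show ?thesis using F.proj_norm[OF that] bspec[OF d that] \<epsilon>(6) by linarith
      qed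
      show ?thesis
      proof unfold_locales
        show "G \<in> sim_tuples m" "0 < c" "c < 1" "0 \<le> R" "finite W" "W \<subseteq> words m" "[] \<notin> W" "0 < b" "b < 1" "0 < g / 2" "0 < \<delta> / 2"
          using G c R S.finW S.W S.Nil_W S.b S.g S.\<delta> by simp_all
        show "sim_ratio (G ! i) \<le> c" if i: "i < m" for i
        proof -
          have "\<bar>wratio G [i] - wratio F0 [i]\<bar> \<le> \<tau>" using i by (intro bspec[OF rat]) simp
          then have "sim_ratio (G ! i) \<le> sim_ratio (F0 ! i) + \<tau>" by (simp add: abs_le_iff)
          then show ?thesis using F.ratio_le[OF i] \<tau>(3) by (simp add: c_def field_simps)
        qed
        show "norm ((G ! i) 0) \<le> (1 - c) * R" if i: "i < m" for i
        proof -
          let ?z = "(\<lambda>_. 0) :: nat \<Rightarrow> nat"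
          have e: "ifs_proj G ([i] \<frown> ?z) = (G ! i) (ifs_proj G ?z)"
            using G.proj_conc[of "[i]" ?z] i S.zero_code by simp
          have iz: "[i] \<frown> ?z \<in> codes m" using i S.zero_code by (intro conc_codes) auto
          have "norm ((G ! i) 0) \<le> norm ((G ! i) (ifs_proj G ?z)) + dist ((G ! i) 0) ((G ! i) (ifs_proj G ?z))"
            by (metis dist_norm norm_triangle_sub)
          also have "dist ((G ! i) 0) ((G ! i) (ifs_proj G ?z)) = sim_ratio (G ! i) * norm (ifs_proj G ?z)"
            using G.letter(3)[OF i] by (simp add: similarity_def)
          also have "\<dots> \<le> 1 * (R0 + 1)" using G.letter[OF i] pn[OF S.zero_code] by (intro mult_mono) auto
          also have "norm ((G ! i) (ifs_proj G ?z)) \<le> R0 + 1" using pn[OF iz] e by simp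
          finally show ?thesis unfolding R(2) by simp
        qed
        show "b \<le> wratio G u" if u: "u \<in> W" for u
        proof -
          have "\<bar>wratio G u - wratio F0 u\<bar> \<le> \<tau>" using u S.W by (intro bspec[OF rat]) auto
          then show ?thesis using gap(2)[OF u] \<tau>(2) by (simp add: abs_le_iff)
        qed
        show "g / 2 \<le> dist (ifs_proj G (u \<frown> w)) (ifs_proj G (u' \<frown> w'))"
          if u: "u \<in> W" "u' \<in> W" "u \<noteq> u'" and w: "w \<in> codes m" "w' \<in> codes m" for u u' w w'
        proof -
          have cw: "u \<frown> w \<in> codes m" "u' \<frown> w' \<in> codes m" using u w S.W by (auto intro!: conc_codes)
          have "g \<le> dist (ifs_proj F0 (u \<frown> w)) (ifs_proj F0 (u' \<frown> w'))" by (rule S.separated[OF u w])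
          also have "\<dots> \<le> dist (ifs_proj G (u \<frown> w)) (ifs_proj F0 (u \<frown> w)) + dist (ifs_proj G (u \<frown> w)) (ifs_proj G (u' \<frown> w')) +
              dist (ifs_proj G (u' \<frown> w')) (ifs_proj F0 (u' \<frown> w'))"
            using dist_triangle[of "ifs_proj F0 (u \<frown> w)" "ifs_proj F0 (u' \<frown> w')" "ifs_proj G (u \<frown> w)"]
              dist_triangle[of "ifs_proj G (u \<frown> w)" "ifs_proj F0 (u' \<frown> w')" "ifs_proj G (u' \<frown> w')"]
            by (simp add: dist_commute)
          finally show ?thesis using bspec[OF d cw(1)] bspec[OF d cw(2)] \<epsilon>(3) by linarith
        qed
        show "\<exists>u\<in>W. \<forall>w\<in>codes m. \<delta> / 2 < \<bar>a \<bullet> ifs_proj G (u \<frown> w) - t\<bar>" if a: "norm a = 1" for a t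
        proof -
          obtain u where u: "u \<in> W" "\<forall>w\<in>codes m. \<delta> < \<bar>a \<bullet> ifs_proj F0 (u \<frown> w) - t\<bar>" using S.escape[OF a] by blast
          have "\<delta> / 2 < \<bar>a \<bullet> ifs_proj G (u \<frown> w) - t\<bar>" if w: "w \<in> codes m" for w
          proof -
            have "u \<frown> w \<in> codes m" using u(1) w S.W by (intro conc_codes) auto
            then have "dist (ifs_proj G (u \<frown> w)) (ifs_proj F0 (u \<frown> w)) \<le> \<epsilon>" using d by blast
            moreover have "\<bar>a \<bullet> ifs_proj G (u \<frown> w) - a \<bullet> ifs_proj F0 (u \<frown> w)\<bar> \<le> dist (ifs_proj G (u \<frown> w)) (ifs_proj F0 (u \<frown> w))"
              using Cauchy_Schwarz_ineq2[of a "ifs_proj G (u \<frown> w) - ifs_proj F0 (u \<frown> w)"] a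
              by (simp add: inner_diff_right dist_norm)
            ultimately show ?thesis using bspec[OF u(2) w] \<epsilon>(4) by linarith
          qed
          then show ?thesis using u(1) by blast
        qed
      qed
    qed
    have "ifs_patch \<G> m c R W b (g / 2) (\<delta> / 2) s \<alpha> pre (wratio F0 pre / 2) \<rho>"
    proof (rule ifs_patch.intro[OF sub \<G>(2) \<alpha>(1) s pre(1)])
      show "0 < wratio F0 pre / 2" "wratio F0 pre / 2 \<le> 1" "0 < \<rho>" using prepos \<rho> by auto
      show "wratio F0 pre / 2 \<le> wratio G pre" if GG: "G \<in> \<G>" for G
      proof -
        have G: "G \<in> sim_tuples m" "ifs_dist G F0 < \<epsilon>" using \<G>(1) GG by auto
        have "\<bar>wratio G pre - wratio F0 pre\<bar> \<le> \<tau>" using near[OF G] pre(1) by blast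
        then show ?thesis using \<tau>(4) by (simp add: abs_le_iff)
      qed
    qed
    moreover have "cball (ifs_proj G (pre \<frown> w)) \<rho> \<subseteq> U" if GG: "G \<in> \<G>" and w: "w \<in> codes m" for G w
    proof -
      have G: "G \<in> sim_tuples m" "ifs_dist G F0 < \<epsilon>" using \<G>(1) GG by auto
      have pw: "pre \<frown> w \<in> codes m" by (intro conc_codes pre w)
      have 1: "dist (ifs_proj G (pre \<frown> w)) (ifs_proj F0 (pre \<frown> w)) \<le> \<rho>" using near[OF G] pw \<epsilon>(5) by force
      have "ws = pre \<frown> (\<lambda>i. ws (i + N))" unfolding pre_def by (rule codes_split)
      then have 2: "dist (ifs_proj F0 ws) (ifs_proj F0 (pre \<frown> w)) \<le> \<rho>"
        using F.dist_proj_conc_le[OF pre(1) codes_suffix[OF ws(1), of N] w] N pre(2) by simp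
      have "cball (ifs_proj G (pre \<frown> w)) \<rho> \<subseteq> ball (ifs_proj F0 ws) e0"
      proof
        fix z assume z: "z \<in> cball (ifs_proj G (pre \<frown> w)) \<rho>"
        have "dist (ifs_proj F0 ws) z \<le> 3 * \<rho>"
          using z 1 2 dist_triangle[of "ifs_proj F0 ws" z "ifs_proj F0 (pre \<frown> w)"]
            dist_triangle[of "ifs_proj F0 (pre \<frown> w)" z "ifs_proj G (pre \<frown> w)"] by (simp add: dist_commute)
        then show "z \<in> ball (ifs_proj F0 ws) e0" using e0(1) by (simp add: \<rho>_def)
      qed
      then show ?thesis using e0(2) by blast
    qed
    ultimately show ?thesis by blast
  qed
  show ?thesis by (rule that[OF \<epsilon>(1) patch])
qed

section \<open>Uniform survival for compact families\<close>

context removal_model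
begin

text \<open>The measure \<open>p\<close> must not depend on the translation \<open>v\<close>, over which it is integrated later on.\<close>

definition good_event :: "'a set \<Rightarrow> real \<Rightarrow> nat \<Rightarrow> ('a \<Rightarrow> 'a) list set \<Rightarrow> 'w set \<Rightarrow> bool" where
  "good_event U r n0 \<G> E \<longleftrightarrow> (\<forall>\<omega>\<in>E. \<forall>G\<in>\<G>. \<forall>n\<ge>n0. \<exists>p. finite (set_pmf p) \<and> set_pmf p \<subseteq> attractor G \<and>
     (\<forall>x\<in>set_pmf p. cball x r \<subseteq> U) \<and>
     (\<forall>v. norm v \<le> r \<longrightarrow> 1/2 * 2 powr (- \<alpha> * (real n - real n0)) \<le> measure_pmf.prob p {x. x + v \<notin> removed \<omega> n}))"

definition survives :: "'a set \<Rightarrow> ('a \<Rightarrow> 'a) list set \<Rightarrow> bool" where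
  "survives U \<G> \<longleftrightarrow> (\<exists>r>0. \<forall>\<epsilon>>0. \<exists>N0. \<forall>n0\<ge>N0. \<exists>E\<in>events. E \<subseteq> intact n0 \<and>
     prob (intact n0 - E) \<le> \<epsilon> * prob (intact n0) \<and> good_event U r n0 \<G> E)"

lemma good_event_mono:
  assumes "good_event U r n0 \<G> E" "r' \<le> r" "\<G>' \<subseteq> \<G>" "E' \<subseteq> E"
  shows "good_event U r' n0 \<G>' E'"
  unfolding good_event_def
proof (intro ballI allI impI)
  fix \<omega> G n assume "\<omega> \<in> E'" "G \<in> \<G>'" "n0 \<le> n"
  then obtain p where p: "finite (set_pmf p)" "set_pmf p \<subseteq> attractor G" "\<forall>x\<in>set_pmf p. cball x r \<subseteq> U"
     "\<forall>v. norm v \<le> r \<longrightarrow> 1/2 * 2 powr (- \<alpha> * (real n - real n0)) \<le> measure_pmf.prob p {x. x + v \<notin> removed \<omega> n}"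
    using assms unfolding good_event_def by blast
  have "cball x r' \<subseteq> U" if "x \<in> set_pmf p" for x using p(3) that assms(2) subset_cball[of r' r x] by blast
  then show "\<exists>p. finite (set_pmf p) \<and> set_pmf p \<subseteq> attractor G \<and> (\<forall>x\<in>set_pmf p. cball x r' \<subseteq> U) \<and>
     (\<forall>v. norm v \<le> r' \<longrightarrow> 1/2 * 2 powr (- \<alpha> * (real n - real n0)) \<le> measure_pmf.prob p {x. x + v \<notin> removed \<omega> n})"
    using p assms(2) by (intro exI[of _ p]) auto
qed

lemma survives_subset: "survives U B \<Longrightarrow> A \<subseteq> B \<Longrightarrow> survives U A"
  unfolding survives_def using good_event_mono[OF _ order_refl _ order_refl] by meson

lemma survives_empty: "survives U {}"
  unfolding survives_def good_event_def
  by (intro exI[of _ 1] conjI allI impI exI[of _ 0] bexI[of _ "intact _"]) (auto simp: intact_event)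

lemma survives_Un:
  assumes "survives U A" "survives U B" shows "survives U (A \<union> B)"
proof -
  obtain r1 r2 where r: "0 < r1" "0 < r2"
    and 1: "\<And>\<epsilon>. 0 < \<epsilon> \<Longrightarrow> \<exists>N0. \<forall>n0\<ge>N0. \<exists>E\<in>events. E \<subseteq> intact n0 \<and> prob (intact n0 - E) \<le> \<epsilon> * prob (intact n0) \<and> good_event U r1 n0 A E"
    and 2: "\<And>\<epsilon>. 0 < \<epsilon> \<Longrightarrow> \<exists>N0. \<forall>n0\<ge>N0. \<exists>E\<in>events. E \<subseteq> intact n0 \<and> prob (intact n0 - E) \<le> \<epsilon> * prob (intact n0) \<and> good_event U r2 n0 B E"
    using assms unfolding survives_def by blast
  show ?thesis
    unfolding survives_def
  proof (intro exI[of _ "min r1 r2"] conjI allI impI)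
    fix \<epsilon> :: real assume "0 < \<epsilon>"
    then have e: "0 < \<epsilon> / 2" by simp
    obtain N1 where N1: "\<And>n0. N1 \<le> n0 \<Longrightarrow> \<exists>E\<in>events. E \<subseteq> intact n0 \<and> prob (intact n0 - E) \<le> \<epsilon> / 2 * prob (intact n0) \<and> good_event U r1 n0 A E"
      using 1[OF e] by blast
    obtain N2 where N2: "\<And>n0. N2 \<le> n0 \<Longrightarrow> \<exists>E\<in>events. E \<subseteq> intact n0 \<and> prob (intact n0 - E) \<le> \<epsilon> / 2 * prob (intact n0) \<and> good_event U r2 n0 B E"
      using 2[OF e] by blast
    show "\<exists>N0. \<forall>n0\<ge>N0. \<exists>E\<in>events. E \<subseteq> intact n0 \<and> prob (intact n0 - E) \<le> \<epsilon> * prob (intact n0) \<and> good_event U (min r1 r2) n0 (A \<union> B) E"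
    proof (intro exI[of _ "max N1 N2"] allI impI)
      fix n0 assume n0: "max N1 N2 \<le> n0"
      obtain E1 where E1: "E1 \<in> events" "E1 \<subseteq> intact n0" "prob (intact n0 - E1) \<le> \<epsilon> / 2 * prob (intact n0)" "good_event U r1 n0 A E1"
        using N1[of n0] n0 by auto
      obtain E2 where E2: "E2 \<in> events" "E2 \<subseteq> intact n0" "prob (intact n0 - E2) \<le> \<epsilon> / 2 * prob (intact n0)" "good_event U r2 n0 B E2"
        using N2[of n0] n0 by auto
      have "prob (intact n0 - E1 \<inter> E2) \<le> prob ((intact n0 - E1) \<union> (intact n0 - E2))"
        using E1 E2 intact_event by (intro finite_measure_mono) auto
      also have "\<dots> \<le> prob (intact n0 - E1) + prob (intact n0 - E2)"
        using E1 E2 intact_event by (intro measure_Un_le) auto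
      finally have "prob (intact n0 - E1 \<inter> E2) \<le> \<epsilon> * prob (intact n0)" using E1(3) E2(3) by simp
      moreover have "good_event U (min r1 r2) n0 (A \<union> B) (E1 \<inter> E2)"
      proof -
        have "good_event U (min r1 r2) n0 A (E1 \<inter> E2)" "good_event U (min r1 r2) n0 B (E1 \<inter> E2)"
          using good_event_mono[OF E1(4)] good_event_mono[OF E2(4)] by auto
        then show ?thesis unfolding good_event_def by blast
      qed
      ultimately show "\<exists>E\<in>events. E \<subseteq> intact n0 \<and> prob (intact n0 - E) \<le> \<epsilon> * prob (intact n0) \<and> good_event U (min r1 r2) n0 (A \<union> B) E"
        using E1 E2 by (intro bexI[of _ "E1 \<inter> E2"]) auto
    qed
  qed (use r in simp)
qed

text \<open>\<open>chain_survival\<close> treats the members of the nets \<open>T n\<close> only.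
  Any other tuple and translation is compared with a net parameter of the same level; this uses half
  of the erosion, and the other half keeps the points outside the removed set.\<close>

lemma survives_patch:
  assumes patch: "ifs_patch \<G> m c Rb W b g \<delta> s \<alpha> pre \<kappa>p r0"
    and region: "\<And>G w. G \<in> \<G> \<Longrightarrow> w \<in> codes m \<Longrightarrow> cball (ifs_proj G (pre \<frown> w)) r0 \<subseteq> U"
  shows "survives U \<G>"
proof -
  interpret P: ifs_patch \<G> m c Rb W b g \<delta> s \<alpha> pre \<kappa>p r0 by (rule patch)
  have sub: "subsystem G m c Rb W b g \<delta>" if "G \<in> \<G>" for G by (rule P.sub[OF that])
  have ifsG: "ifs G m c Rb" if "G \<in> \<G>" for G using sub[OF that] by (simp add: subsystem_def)
  have simG: "G \<in> sim_tuples m" if "G \<in> \<G>" for G using ifsG[OF that] by (simp add: ifs_def)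
  obtain T :: "nat \<Rightarrow> (('a \<Rightarrow> 'a) list \<times> 'a) set" and C where
    T: "\<And>n. T n \<subseteq> \<G> \<times> cball 0 r0" "\<And>n. finite (T n)" "\<And>n. real (card (T n)) \<le> exp (C * (real n ^ 2 + 1))"
    and close: "\<And>n G v. G \<in> \<G> \<Longrightarrow> v \<in> cball 0 r0 \<Longrightarrow> \<exists>(G', v')\<in>T n. ifs_dist G G' \<le> erosion n / 8 \<and> dist v v' \<le> erosion n / 8"
    by (rule ifs_net[where \<G> = \<G>, OF ifsG P.constants(10) less_imp_le[OF P.r0] P.constants(3,4,5)], assumption, rule that)
  obtain C3 where C3: "0 \<le> C3"
    "\<And>n \<theta>. \<theta> \<in> P.par \<Longrightarrow> measure_pmf.prob (P.law n \<theta>) (near_grid n) \<le> C3 * 2 powr (- (\<alpha> + 1) * real n)"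
    by (rule P.law_grid) (rule that)
  have Tpar: "T n \<subseteq> P.par" for n using T(1) by (simp add: P.par_def)
  have C2: "0 < (2 / (\<kappa>p * g)) powr s" using P.\<kappa>p P.constants by simp
  have approx: "\<exists>\<theta>'\<in>T n. \<forall>S S'. (\<forall>x\<in>S. \<forall>y. dist x y \<le> erosion n / 2 \<longrightarrow> y \<in> S') \<longrightarrow>
      measure_pmf.prob (P.law n \<theta>') S \<le> measure_pmf.prob (P.law k \<theta>) S'" if th: "\<theta> \<in> P.par" and k: "n \<le> k" for n k \<theta>
  proof -
    obtain G v where t: "\<theta> = (G, v)" "G \<in> \<G>" "v \<in> cball 0 r0" using th by (auto simp: P.par_def)
    obtain G' v' where t': "(G', v') \<in> T n" "ifs_dist G G' \<le> erosion n / 8" "dist v v' \<le> erosion n / 8"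
      using close[OF t(2,3), of n] by blast
    have p': "(G', v') \<in> P.par" using t'(1) Tpar by blast
    have "G' \<in> \<G>" using p' by (simp add: P.par_def)
    then have d: "ifs_dist G' G \<le> erosion n / 8" using t'(2) ifs_dist_commute[OF simG simG] t(2) by metis
    have dv: "dist v' v \<le> erosion n / 8" using t'(3) by (simp add: dist_commute)
    show ?thesis
    proof (rule bexI[OF _ t'(1)], intro allI impI)
      fix S S' :: "'a set" assume S: "\<forall>x\<in>S. \<forall>y. dist x y \<le> erosion n / 2 \<longrightarrow> y \<in> S'"
      show "measure_pmf.prob (P.law n (G', v')) S \<le> measure_pmf.prob (P.law k \<theta>) S'"
        unfolding t(1) using S by (intro P.law_transport[OF p' _ k d dv]) (use th t in auto)
    qed
  qed
  show ?thesis
    unfolding survives_def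
  proof (intro exI[of _ r0] conjI allI impI P.r0)
    fix \<epsilon> :: real assume \<epsilon>: "0 < \<epsilon>"
    have "\<exists>N0. \<forall>n0\<ge>N0. \<exists>E\<in>events. E \<subseteq> intact n0 \<and> prob (intact n0 - E) \<le> \<epsilon> * prob (intact n0) \<and>
      (\<forall>\<omega>\<in>E. \<forall>n\<ge>n0. \<forall>\<theta>\<in>T n. 1/2 * 2 powr (- \<alpha> * (real n - real n0)) \<le>
         measure_pmf.prob (P.law n \<theta>) (far (erosion n) (removed \<omega> n)))"
    proof (rule chain_survival[OF P.\<alpha>(2) C2 C3(1) \<epsilon> T(2) T(3)])
      show "finite (set_pmf (P.law n \<theta>))" for n \<theta> by (rule P.law_finite)
      show "measure_pmf.prob (P.law n \<theta>) (cball x r) \<le> (2 / (\<kappa>p * g)) powr s * r powr s"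
        if "\<theta> \<in> T n" "(1/2) ^ n \<le> r" for n \<theta> x r by (rule P.law_frostman[OF subsetD[OF Tpar that(1)] that(2)])
      show "measure_pmf.prob (P.law n \<theta>) (near_grid n) \<le> C3 * 2 powr (- (\<alpha> + 1) * real n)" if "\<theta> \<in> T n" for n \<theta>
        by (rule C3(2)[OF subsetD[OF Tpar that]])
      show "\<exists>\<theta>\<in>T n. \<forall>S S'. (\<forall>x\<in>S. \<forall>y. dist x y \<le> erosion n / 2 \<longrightarrow> y \<in> S') \<longrightarrow>
        measure_pmf.prob (P.law n \<theta>) S \<le> measure_pmf.prob (P.law (Suc n) \<theta>') S'" if "\<theta>' \<in> T (Suc n)" for n \<theta>'
      proof -
        have "\<theta>' \<in> P.par" using that Tpar by blast
        then show ?thesis by (rule approx) simp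
      qed
    qed
    then obtain N0 where N0: "\<forall>n0\<ge>N0. \<exists>E\<in>events. E \<subseteq> intact n0 \<and> prob (intact n0 - E) \<le> \<epsilon> * prob (intact n0) \<and>
      (\<forall>\<omega>\<in>E. \<forall>n\<ge>n0. \<forall>\<theta>\<in>T n. 1/2 * 2 powr (- \<alpha> * (real n - real n0)) \<le>
         measure_pmf.prob (P.law n \<theta>) (far (erosion n) (removed \<omega> n)))" by (elim exE) (rule that)
    show "\<exists>N0. \<forall>n0\<ge>N0. \<exists>E\<in>events. E \<subseteq> intact n0 \<and> prob (intact n0 - E) \<le> \<epsilon> * prob (intact n0) \<and> good_event U r0 n0 \<G> E"
    proof (intro exI[of _ N0] allI impI)
      fix n0 assume "N0 \<le> n0"
      from N0[rule_format, OF this] obtain E where Eev: "E \<in> events" and Eall: "E \<subseteq> intact n0 \<and>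
        prob (intact n0 - E) \<le> \<epsilon> * prob (intact n0) \<and>
        (\<forall>\<omega>\<in>E. \<forall>n\<ge>n0. \<forall>\<theta>\<in>T n. 1/2 * 2 powr (- \<alpha> * (real n - real n0)) \<le>
         measure_pmf.prob (P.law n \<theta>) (far (erosion n) (removed \<omega> n)))" by (elim bexE) (rule that)
      have E: "E \<in> events" "E \<subseteq> intact n0" "prob (intact n0 - E) \<le> \<epsilon> * prob (intact n0)"
        using Eev Eall by simp_all
      have EE: "1/2 * 2 powr (- \<alpha> * (real n - real n0)) \<le>
         measure_pmf.prob (P.law n \<theta>) (far (erosion n) (removed \<omega> n))" if "\<omega> \<in> E" "n0 \<le> n" "\<theta> \<in> T n" for \<omega> n \<theta>
        using Eall that by (elim conjE) (drule (1) bspec, drule spec, drule (1) mp, drule (1) bspec, assumption)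
      have "good_event U r0 n0 \<G> E"
        unfolding good_event_def
      proof (intro ballI allI impI)
        fix \<omega> G n assume w: "\<omega> \<in> E" and G: "G \<in> \<G>" and n: "n0 \<le> n"
        interpret G: subsystem G m c Rb W b g \<delta> by (rule sub[OF G])
        \<comment> \<open>The law for the translation 0; the laws for the other \<open>v\<close> are
          its translates.\<close>
        let ?p = "P.law n (G, 0)"
        have supp: "\<exists>w\<in>codes m. x = ifs_proj G (pre \<frown> w)" if x: "x \<in> set_pmf ?p" for x
        proof -
          obtain us where us: "us \<in> P.blk (P.len n)" "x = P.node (G, 0) us"
            using x by (auto simp: P.law_def P.blk_ne P.blk_finite)
          obtain w where "w \<in> codes m" "P.node (G, 0) us = ifs_proj G (pre \<frown> w) + 0"
            by (rule P.node_code[OF G us(1)])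
          then show ?thesis using us(2) by auto
        qed
        have "1/2 * 2 powr (- \<alpha> * (real n - real n0)) \<le> measure_pmf.prob ?p {x. x + v \<notin> removed \<omega> n}" if v: "norm v \<le> r0" for v
        proof -
          have "(G, v) \<in> P.par" using G v by (simp add: P.par_def)
          then obtain \<theta> where th: "\<theta> \<in> T n" "\<And>S S'. (\<forall>x\<in>S. \<forall>y. dist x y \<le> erosion n / 2 \<longrightarrow> y \<in> S') \<Longrightarrow>
             measure_pmf.prob (P.law n \<theta>) S \<le> measure_pmf.prob (P.law n (G, v)) S'" using approx[OF _ order_refl] by blast
          have "1/2 * 2 powr (- \<alpha> * (real n - real n0)) \<le> measure_pmf.prob (P.law n \<theta>) (far (erosion n) (removed \<omega> n))"
            by (rule EE[OF w n th(1)])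
          also have "\<dots> \<le> measure_pmf.prob (P.law n (G, v)) {y. y \<notin> removed \<omega> n}"
            using erosion_pos[of n] by (intro th(2)) (force simp: far_def)
          also have "P.law n (G, v) = map_pmf (\<lambda>x. x + v) ?p"
            by (simp add: P.law_def map_pmf_comp P.node_def[abs_def])
          finally show ?thesis by (simp add: vimage_def)
        qed
        moreover have "set_pmf ?p \<subseteq> attractor G"
        proof
          fix x assume "x \<in> set_pmf ?p"
          then obtain w where "w \<in> codes m" "x = ifs_proj G (pre \<frown> w)" using supp by blast
          then show "x \<in> attractor G" unfolding G.attractor_eq using conc_codes[OF P.pre] by blast
        qed
        moreover have "cball x r0 \<subseteq> U" if "x \<in> set_pmf ?p" for x using supp[OF that] region[OF G] by blast
        ultimately show "\<exists>p. finite (set_pmf p) \<and> set_pmf p \<subseteq> attractor G \<and> (\<forall>x\<in>set_pmf p. cball x r0 \<subseteq> U) \<and>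
          (\<forall>v. norm v \<le> r0 \<longrightarrow> 1/2 * 2 powr (- \<alpha> * (real n - real n0)) \<le> measure_pmf.prob p {x. x + v \<notin> removed \<omega> n})"
          using P.law_finite by blast
      qed
      then show "\<exists>E\<in>events. E \<subseteq> intact n0 \<and> prob (intact n0 - E) \<le> \<epsilon> * prob (intact n0) \<and> good_event U r0 n0 \<G> E"
        using E by blast
    qed
  qed
qed

theorem survives_compact:
  assumes \<Gamma>: "\<Gamma> \<subseteq> sim_tuples m" "ifs_compact \<Gamma>" and U: "open U"
    and F: "\<And>F. F \<in> \<Gamma> \<Longrightarrow> \<not> in_hyperplane (attractor F)" "\<And>F. F \<in> \<Gamma> \<Longrightarrow> attractor F \<inter> U \<noteq> {}"
      "\<And>F. F \<in> \<Gamma> \<Longrightarrow> \<alpha> < hausdorff_dim (attractor F)"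
  shows "survives U \<Gamma>"
proof (cases "\<Gamma> = {}")
  case True
  then show ?thesis by (simp add: survives_empty)
next
  case False
  then obtain F1 where F1: "F1 \<in> \<Gamma>" by blast
  have "length F1 = m" using F1 \<Gamma> by (auto simp: sim_tuples_def)
  \<comment> \<open>The attractor of an empty tuple is empty and cannot meet
    \<open>U\<close>.\<close>
  then have m: "0 < m" using F(2)[OF F1] by (cases m) (auto simp: attractor_def codes_def)
  show ?thesis
  proof (rule ifs_compact_local_to_global[OF \<Gamma> m, where H = "survives U"])
    fix F0 assume F0: "F0 \<in> \<Gamma>"
    have F0s: "F0 \<in> sim_tuples m" using F0 \<Gamma> by auto
    obtain \<epsilon> where \<epsilon>: "0 < \<epsilon>" "\<And>\<G>. \<G> \<subseteq> {G\<in>sim_tuples m. ifs_dist G F0 < \<epsilon>} \<Longrightarrow> \<G> \<noteq> {} \<Longrightarrow>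
     \<exists>c R W b g \<delta> s pre \<kappa>p r0. ifs_patch \<G> m c R W b g \<delta> s \<alpha> pre \<kappa>p r0 \<and>
       (\<forall>G\<in>\<G>. \<forall>w\<in>codes m. cball (ifs_proj G (pre \<frown> w)) r0 \<subseteq> U)"
      by (rule patch_at[OF F0s F(1)[OF F0] alpha F(3)[OF F0] U F(2)[OF F0]]) (rule that)
    have "survives U {G\<in>\<Gamma>. ifs_dist G F0 < \<epsilon>}"
    proof (cases "{G\<in>\<Gamma>. ifs_dist G F0 < \<epsilon>} = {}")
      case True
      then show ?thesis by (simp only: survives_empty)
    next
      case False
      have "{G\<in>\<Gamma>. ifs_dist G F0 < \<epsilon>} \<subseteq> {G\<in>sim_tuples m. ifs_dist G F0 < \<epsilon>}" using \<Gamma> by auto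
      from \<epsilon>(2)[OF this False] obtain c Rb W b g \<delta> s pre \<kappa>p r0 where
        patch: "ifs_patch {G\<in>\<Gamma>. ifs_dist G F0 < \<epsilon>} m c Rb W b g \<delta> s \<alpha> pre \<kappa>p r0"
        and region: "\<forall>G\<in>{G\<in>\<Gamma>. ifs_dist G F0 < \<epsilon>}. \<forall>w\<in>codes m. cball (ifs_proj G (pre \<frown> w)) r0 \<subseteq> U"
        by (elim exE conjE)
      show ?thesis by (rule survives_patch[OF patch]) (use region in blast)
    qed
    then show "\<exists>\<epsilon>>0. survives U {G\<in>\<Gamma>. ifs_dist G F0 < \<epsilon>}" using \<epsilon>(1) by blast
  qed (use survives_empty survives_subset survives_Un in blast)+
qed

end


section \<open>Passage to the limit measure\<close>

text \<open>Integrate the hypothesis over \<open>v\<close> and exchange the finite sum with the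
  integral. For each atom \<open>x\<close> the points \<open>x + v\<close> are distributed according
  to Lebesgue measure, and they lie within \<delta> of \<open>E\<close>.\<close>

lemma emeasure_thickening_lower_bound:
  fixes p :: "'a::euclidean_space pmf"
  assumes fin: "finite (set_pmf p)" and E: "set_pmf p \<subseteq> E" and A: "A \<in> sets borel" and \<kappa>: "0 \<le> \<kappa>"
    and low: "\<And>v. norm v < \<delta> \<Longrightarrow> \<kappa> \<le> measure_pmf.prob p {x. x + v \<in> A}"
  shows "ennreal \<kappa> * emeasure lborel (ball (0::'a) \<delta>) \<le> emeasure lborel (A \<inter> {x. infdist x E \<le> \<delta>})"
proof -
  define K where "K = A \<inter> {x. infdist x E \<le> \<delta>}"
  have "closed {x. infdist x E \<le> \<delta>}" by (intro closed_Collect_le continuous_intros)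
  then have K: "K \<in> sets borel" using A by (simp add: K_def)
  have pt: "\<kappa> * indicator (ball 0 \<delta>) v \<le> (\<Sum>x\<in>set_pmf p. pmf p x * indicator K (x + v))" for v
  proof (cases "norm v < \<delta>")
    case True
    have "\<kappa> \<le> (\<Sum>x\<in>set_pmf p. pmf p x * indicator {x. x + v \<in> A} x)"
      using low[OF True] measure_pmf_finite_support[OF fin] by simp
    also have "\<dots> = (\<Sum>x\<in>set_pmf p. pmf p x * indicator K (x + v))"
    proof (rule sum.cong[OF refl])
      fix x assume "x \<in> set_pmf p"
      then have "x \<in> E" using E by blast
      then have "infdist (x + v) E \<le> norm v" using infdist_le[of x E "x + v"] by (simp add: dist_norm)
      then show "pmf p x * indicator {x. x + v \<in> A} x = pmf p x * indicator K (x + v)"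
        using True by (auto simp: indicator_def K_def)
    qed
    finally show ?thesis using True by simp
  qed (auto intro!: sum_nonneg)
  have "ennreal \<kappa> * emeasure lborel (ball (0::'a) \<delta>) = (\<integral>\<^sup>+v. ennreal \<kappa> * indicator (ball (0::'a) \<delta>) v \<partial>lborel)"
    by (simp add: nn_integral_cmult_indicator)
  also have "\<dots> \<le> (\<integral>\<^sup>+v. (\<Sum>x\<in>set_pmf p. ennreal (pmf p x) * indicator K (x + v)) \<partial>lborel)"
  proof (rule nn_integral_mono)
    fix v :: 'a
    have "ennreal (\<kappa> * indicator (ball 0 \<delta>) v) \<le> ennreal (\<Sum>x\<in>set_pmf p. pmf p x * indicator K (x + v))"
      by (rule ennreal_leI[OF pt])
    then show "ennreal \<kappa> * indicator (ball 0 \<delta>) v \<le> (\<Sum>x\<in>set_pmf p. ennreal (pmf p x) * indicator K (x + v))"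
      using \<kappa> by (simp add: ennreal_mult sum_ennreal[symmetric] ennreal_indicator)
  qed
  also have "\<dots> = (\<Sum>x\<in>set_pmf p. ennreal (pmf p x) * (\<integral>\<^sup>+v. indicator K (x + v) \<partial>lborel))"
    using K by (simp add: nn_integral_sum nn_integral_cmult)
  also have "\<dots> = (\<Sum>x\<in>set_pmf p. ennreal (pmf p x) * emeasure lborel K)"
  proof (rule sum.cong[OF refl])
    fix x
    have "(\<integral>\<^sup>+v. indicator K (x + v) \<partial>lborel) = (\<integral>\<^sup>+v. indicator K v \<partial>distr lborel borel ((+) x))"
      using K by (subst nn_integral_distr) auto
    also have "\<dots> = emeasure lborel K" using K by (simp add: lborel_distr_plus)
    finally show "ennreal (pmf p x) * (\<integral>\<^sup>+v. indicator K (x + v) \<partial>lborel) = ennreal (pmf p x) * emeasure lborel K" by simp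
  qed
  also have "\<dots> = ennreal (\<Sum>x\<in>set_pmf p. pmf p x) * emeasure lborel K"
    by (simp add: sum_distrib_right[symmetric] sum_ennreal)
  also have "(\<Sum>x\<in>set_pmf p. pmf p x) = 1" by (rule sum_pmf_eq_1[OF fin order_refl])
  finally show ?thesis by (simp add: K_def)
qed

text \<open>If the support missed the compact set \<open>E\<close>, some neighbourhood of
  \<open>E\<close> would be a null set of the limit. A continuous function that vanishes outside it
  has integral 0 in the limit, but integrals bounded away from 0 along the sequence.\<close>

lemma msupp_meets:
  fixes E :: "'a::euclidean_space set" and \<mu> :: "'a measure" and c :: "nat \<Rightarrow> real"
  assumes E: "compact E" "E \<noteq> {}" and \<mu>: "sets \<mu> = sets borel" "finite_measure \<mu>"
    and weak: "weak_conv_measures (\<lambda>n. density lborel (\<lambda>x. ennreal (c n * indicator (A n) x))) \<mu>"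
    and A: "\<And>n. A n \<in> sets borel" "\<And>n. bounded (A n)" and c: "\<And>n. 0 \<le> c n"
    and low: "\<And>\<delta>. 0 < \<delta> \<Longrightarrow> \<exists>\<eta>>0. \<exists>N. \<forall>n\<ge>N. \<eta> \<le> c n * measure lborel (A n \<inter> {x. infdist x E \<le> \<delta>})"
  shows "msupp \<mu> \<inter> E \<noteq> {}"
proof
  assume disj: "msupp \<mu> \<inter> E = {}"
  have "\<forall>x\<in>E. \<exists>e>0. emeasure \<mu> (ball x e) = 0"
    using disj unfolding msupp_def by (force simp: zero_less_iff_neq_zero)
  from bchoice[OF this] obtain e where e: "\<forall>x\<in>E. 0 < e x \<and> emeasure \<mu> (ball x (e x)) = 0" by blast
  have "E \<subseteq> (\<Union>x\<in>E. ball x (e x))" using e by force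
  then obtain S where S: "S \<subseteq> E" "finite S" "E \<subseteq> (\<Union>x\<in>S. ball x (e x))"
    using compactE_image[OF E(1), of E "\<lambda>x. ball x (e x)"] by (metis open_ball)
  define T where "T = (\<Union>x\<in>S. ball x (e x))"
  have T: "open T" "E \<subseteq> T" using S by (auto simp: T_def)
  have "emeasure \<mu> T \<le> (\<Sum>x\<in>S. emeasure \<mu> (ball x (e x)))"
    unfolding T_def using S \<mu> by (intro emeasure_subadditive_finite) auto
  also have "\<dots> = 0" using S e by (intro sum.neutral) auto
  finally have T0: "emeasure \<mu> T = 0" by simp
  obtain d where d: "0 < d" "(\<Union>x\<in>E. cball x d) \<subseteq> T"
    by (rule compact_subset_open_imp_cball_epsilon_subset[OF E(1) T])
  \<comment> \<open>A tent: 1 on \<open>E\<close>, at least 1/2 within distance \<open>d / 2\<close>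
    of it, and 0 from distance \<open>d\<close> on.\<close>
  define f where "f x = max 0 (1 - infdist x E / d)" for x
  have f: "continuous_on UNIV f" unfolding f_def using d by (intro continuous_intros) auto
  have f01: "0 \<le> f x" "f x \<le> 1" for x using d infdist_nonneg[of x E] by (auto simp: f_def)
  have fm: "f \<in> borel_measurable borel" using f by (rule borel_measurable_continuous_onI)
  have fT: "f x = 0" if "x \<notin> T" for x
  proof (rule ccontr)
    assume "f x \<noteq> 0"
    then have "infdist x E < d" using d by (auto simp: f_def max_def divide_simps split: if_splits)
    obtain a where a: "a \<in> E" "infdist x E = dist x a"
      by (rule infdist_attains_inf[OF compact_imp_closed[OF E(1)] E(2)])
    have "x \<in> cball a d" using a(2) \<open>infdist x E < d\<close> by (simp add: dist_commute)
    then show False using d(2) a(1) that by blast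
  qed
  have "AE x in \<mu>. f x = 0"
  proof (rule AE_I[of _ _ T])
    show "{x \<in> space \<mu>. \<not> f x = 0} \<subseteq> T" using fT by blast
  qed (use T T0 \<mu> in auto)
  then have int0: "integral\<^sup>L \<mu> f = 0" by (rule integral_eq_zero_AE)
  have bd: "bounded (range f)" unfolding bounded_iff using f01 by (intro exI[of _ 1]) auto
  have lim: "(\<lambda>n. integral\<^sup>L (density lborel (\<lambda>x. ennreal (c n * indicator (A n) x))) f) \<longlonglongrightarrow> 0"
    using weak[unfolded weak_conv_measures_def, rule_format, OF conjI[OF f bd]] unfolding int0 .
  define K where "K = {x. infdist x E \<le> d / 2}"
  have "closed K" unfolding K_def by (intro closed_Collect_le continuous_intros)
  then have Km: "K \<in> sets borel" by simp
  have ge: "1/2 * (c n * measure lborel (A n \<inter> K)) \<le> integral\<^sup>L (density lborel (\<lambda>x. ennreal (c n * indicator (A n) x))) f" for n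
  proof -
    have finA: "emeasure lborel (A n) < \<infinity>" by (rule emeasure_bounded_finite[OF A(2)])
    have finAK: "emeasure lborel (A n \<inter> K) < \<infinity>"
      using A Km by (intro emeasure_bounded_finite bounded_subset[OF A(2)]) auto
    have iA: "integrable lborel (\<lambda>x. c n * indicator (A n) x :: real)"
      using A finA by (intro integrable_mult_right) (simp add: integrable_indicator_iff)
    have iAK: "integrable lborel (\<lambda>x. (1/2 * c n) * indicator (A n \<inter> K) x :: real)"
      using A Km finAK by (intro integrable_mult_right) (simp add: integrable_indicator_iff)
    have iAf: "integrable lborel (\<lambda>x. c n * indicator (A n) x * f x)"
    proof (rule Bochner_Integration.integrable_bound[OF iA])
      show "(\<lambda>x. c n * indicator (A n) x * f x) \<in> borel_measurable lborel" using A(1)[of n] fm by simp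
      show "AE x in lborel. norm (c n * indicator (A n) x * f x) \<le> norm (c n * indicator (A n) x)"
        using f01 c[of n] by (auto simp: abs_mult indicator_def intro!: mult_left_le)
    qed
    have "1/2 * (c n * measure lborel (A n \<inter> K)) = (\<integral>x. (1/2 * c n) * indicator (A n \<inter> K) x \<partial>lborel)"
      using A Km by simp
    also have "\<dots> \<le> (\<integral>x. c n * indicator (A n) x * f x \<partial>lborel)"
    proof (rule integral_mono[OF iAK iAf])
      fix x
      have "1/2 \<le> f x" if "x \<in> K" using that d by (simp add: K_def f_def field_simps)
      then show "(1/2 * c n) * indicator (A n \<inter> K) x \<le> c n * indicator (A n) x * f x"
        using c[of n] f01[of x] mult_left_mono[of "1/2" "f x" "c n"] by (auto simp: indicator_def)
    qed
    also have "\<dots> = integral\<^sup>L (density lborel (\<lambda>x. ennreal (c n * indicator (A n) x))) f"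
      using A(1)[of n] fm c by (subst integral_density) auto
    finally show ?thesis .
  qed
  obtain \<eta> N where \<eta>: "0 < \<eta>" "\<And>n. N \<le> n \<Longrightarrow> \<eta> \<le> c n * measure lborel (A n \<inter> K)"
    using low[of "d / 2"] d unfolding K_def by auto
  have "1/2 * \<eta> \<le> integral\<^sup>L (density lborel (\<lambda>x. ennreal (c n * indicator (A n) x))) f" if "N \<le> n" for n
    using \<eta>(2)[OF that] ge[of n] by linarith
  then have "1/2 * \<eta> \<le> 0" by (intro LIMSEQ_le_const[OF lim]) blast
  then show False using \<eta>(1) by simp
qed

text \<open>The decay of the surviving mass cancels against the density, so the bound
  \<open>1/2 * 2 powr (\<alpha> * n0)\<close> times the volume of a small ball holds at every level
  \<open>n \<ge> n0\<close>. The null set on which the weak convergence may fail is taken out of the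
  event.\<close>

theorem (in removal_model) support_meets_attractors:
  fixes A :: "'w \<Rightarrow> nat \<Rightarrow> 'a set"
  assumes \<Gamma>: "\<Gamma> \<subseteq> sim_tuples m" and surv: "survives U \<Gamma>"
    and A: "\<And>\<omega> n. \<omega> \<in> space M \<Longrightarrow> U - removed \<omega> n \<subseteq> A \<omega> n" "\<And>\<omega> n. A \<omega> n \<in> sets borel" "\<And>\<omega> n. bounded (A \<omega> n)"
    and \<mu>: "\<And>n \<omega> x. \<mu> n \<omega> x = 2 powr (\<alpha> * real n) * indicator (A \<omega> n) x"
    and lim: "AE \<omega> in M. sets (\<mu>inf \<omega>) = sets borel \<and> finite_measure (\<mu>inf \<omega>) \<and>
       weak_conv_measures (\<lambda>n. density lborel (\<lambda>x. ennreal (\<mu> n \<omega> x))) (\<mu>inf \<omega>)"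
  shows "\<exists>B\<in>events. 0 < prob B \<and> (\<forall>\<omega>\<in>B. \<forall>F\<in>\<Gamma>. msupp (\<mu>inf \<omega>) \<inter> attractor F \<noteq> {})"
proof -
  obtain r where r: "0 < r" "\<forall>\<epsilon>>0. \<exists>N0. \<forall>n0\<ge>N0. \<exists>E\<in>events. E \<subseteq> intact n0 \<and>
     prob (intact n0 - E) \<le> \<epsilon> * prob (intact n0) \<and> good_event U r n0 \<Gamma> E"
    using surv unfolding survives_def by (elim exE conjE) (rule that)
  have "(0::real) < 1/2" by simp
  from r(2)[rule_format, OF this] obtain n0 where "\<forall>n\<ge>n0. \<exists>E\<in>events. E \<subseteq> intact n \<and>
     prob (intact n - E) \<le> 1/2 * prob (intact n) \<and> good_event U r n \<Gamma> E" by (elim exE) (rule that)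
  from this[rule_format, OF order_refl] obtain E where E: "E \<in> events" "E \<subseteq> intact n0"
    "prob (intact n0 - E) \<le> 1/2 * prob (intact n0)" "good_event U r n0 \<Gamma> E" by (elim bexE conjE) (rule that)
  have "prob (intact n0 - E) = prob (intact n0) - prob E" by (rule finite_measure_Diff[OF intact_event E(1,2)])
  then have Epos: "0 < prob E" using E(3) intact_pos[of n0] by linarith
  obtain Z where Z: "{\<omega>\<in>space M. \<not> (sets (\<mu>inf \<omega>) = sets borel \<and> finite_measure (\<mu>inf \<omega>) \<and>
       weak_conv_measures (\<lambda>n. density lborel (\<lambda>x. ennreal (\<mu> n \<omega> x))) (\<mu>inf \<omega>))} \<subseteq> Z"
    "emeasure M Z = 0" "Z \<in> events" using lim by (rule AE_E)
  have Znull: "Z \<in> null_sets M" using Z by auto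
  have "prob (E - Z) = prob E" unfolding measure_def using emeasure_Diff_null_set[OF Znull E(1)] by simp
  moreover have "msupp (\<mu>inf \<omega>) \<inter> attractor F \<noteq> {}" if w: "\<omega> \<in> E - Z" and F: "F \<in> \<Gamma>" for \<omega> F
  proof -
    have wE: "\<omega> \<in> E" using w by simp
    have ws: "\<omega> \<in> space M" using wE E(1) sets.sets_into_space by blast
    have lims: "sets (\<mu>inf \<omega>) = sets borel" "finite_measure (\<mu>inf \<omega>)"
       "weak_conv_measures (\<lambda>n. density lborel (\<lambda>x. ennreal (2 powr (\<alpha> * real n) * indicator (A \<omega> n) x))) (\<mu>inf \<omega>)"
      using w ws Z(1) by (auto simp: \<mu>)
    obtain c R where "ifs F m c R" using sim_tuple_ifs F \<Gamma> by blast
    then interpret F: ifs F m c R .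
    have ex: "\<exists>p. finite (set_pmf p) \<and> set_pmf p \<subseteq> attractor F \<and> (\<forall>x\<in>set_pmf p. cball x r \<subseteq> U) \<and>
       (\<forall>v. norm v \<le> r \<longrightarrow> 1/2 * 2 powr (- \<alpha> * (real n - real n0)) \<le> measure_pmf.prob p {x. x + v \<notin> removed \<omega> n})"
      if n: "n0 \<le> n" for n
      using E(4)[unfolded good_event_def, rule_format, OF wE F n] .
    from ex[OF order_refl] obtain q where q: "set_pmf q \<subseteq> attractor F" by (elim exE conjE) (rule that)
    have ne: "attractor F \<noteq> {}" using q set_pmf_not_empty[of q] by auto
    have low: "\<exists>\<eta>>0. \<exists>N. \<forall>n\<ge>N. \<eta> \<le> 2 powr (\<alpha> * real n) * measure lborel (A \<omega> n \<inter> {x. infdist x (attractor F) \<le> \<delta>})"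
      if \<delta>: "0 < \<delta>" for \<delta>
    proof -
      define d where "d = min r \<delta>"
      have d: "0 < d" "d \<le> r" "d \<le> \<delta>" using r(1) \<delta> by (auto simp: d_def)
      define V where "V = measure lborel (ball (0::'a) d)"
      have V: "0 < V" unfolding V_def using d(1) by (rule content_ball_pos)
      have "1/2 * 2 powr (\<alpha> * real n0) * V \<le> 2 powr (\<alpha> * real n) * measure lborel (A \<omega> n \<inter> {x. infdist x (attractor F) \<le> \<delta>})"
        if n: "n0 \<le> n" for n
      proof -
        let ?\<kappa> = "1/2 * 2 powr (- \<alpha> * (real n - real n0))"
        from ex[OF n] obtain p where p: "finite (set_pmf p)" "set_pmf p \<subseteq> attractor F"
          and pU: "\<forall>x\<in>set_pmf p. cball x r \<subseteq> U"
          and pk: "\<forall>v. norm v \<le> r \<longrightarrow> ?\<kappa> \<le> measure_pmf.prob p {x. x + v \<notin> removed \<omega> n}"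
          by (elim exE conjE) (rule that)
        have "ennreal ?\<kappa> * emeasure lborel (ball (0::'a) d) \<le> emeasure lborel (A \<omega> n \<inter> {x. infdist x (attractor F) \<le> d})"
        proof (rule emeasure_thickening_lower_bound[OF p(1,2) A(2)])
          fix v :: 'a assume v: "norm v < d"
          have "?\<kappa> \<le> measure_pmf.prob p {x. x + v \<notin> removed \<omega> n}" using v d by (intro pk[rule_format]) simp
          also have "\<dots> = measure_pmf.prob p ({x. x + v \<notin> removed \<omega> n} \<inter> set_pmf p)" by (simp add: measure_Int_set_pmf)
          also have "\<dots> \<le> measure_pmf.prob p {x. x + v \<in> A \<omega> n}"
          proof (intro measure_pmf.finite_measure_mono subsetI)
            fix x assume x: "x \<in> {x. x + v \<notin> removed \<omega> n} \<inter> set_pmf p"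
            have "x + v \<in> cball x r" using v d by (simp add: dist_norm)
            then have "x + v \<in> U" using pU x by blast
            then show "x \<in> {x. x + v \<in> A \<omega> n}" using x A(1)[OF ws, of n] by blast
          qed simp
          finally show "?\<kappa> \<le> measure_pmf.prob p {x. x + v \<in> A \<omega> n}" .
        qed simp
        also have "\<dots> \<le> emeasure lborel (A \<omega> n \<inter> {x. infdist x (attractor F) \<le> \<delta>})"
        proof (rule emeasure_mono)
          have "closed {x. infdist x (attractor F) \<le> \<delta>}" by (intro closed_Collect_le continuous_intros)
          then show "A \<omega> n \<inter> {x. infdist x (attractor F) \<le> \<delta>} \<in> sets lborel" using A(2) by simp
        qed (use d in auto)
        finally have "ennreal ?\<kappa> * emeasure lborel (ball (0::'a) d) \<le> emeasure lborel (A \<omega> n \<inter> {x. infdist x (attractor F) \<le> \<delta>})" .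
        moreover have "emeasure lborel (ball (0::'a) d) = ennreal V"
          unfolding V_def using emeasure_bounded_finite[OF bounded_ball[of "0::'a" d]]
          by (intro emeasure_eq_ennreal_measure) auto
        moreover have "emeasure lborel (A \<omega> n \<inter> {x. infdist x (attractor F) \<le> \<delta>}) = ennreal (measure lborel (A \<omega> n \<inter> {x. infdist x (attractor F) \<le> \<delta>}))"
        proof (rule emeasure_eq_ennreal_measure)
          have "emeasure lborel (A \<omega> n \<inter> {x. infdist x (attractor F) \<le> \<delta>}) < \<infinity>"
            by (rule emeasure_bounded_finite, rule bounded_subset[OF A(3)]) auto
          then show "emeasure lborel (A \<omega> n \<inter> {x. infdist x (attractor F) \<le> \<delta>}) \<noteq> top" by simp
        qed
        moreover have "ennreal (?\<kappa> * V) = ennreal ?\<kappa> * ennreal V"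
          using V by (intro ennreal_mult) auto
        ultimately have "ennreal (?\<kappa> * V) \<le> ennreal (measure lborel (A \<omega> n \<inter> {x. infdist x (attractor F) \<le> \<delta>}))"
          by (simp only:)
        then have "?\<kappa> * V \<le> measure lborel (A \<omega> n \<inter> {x. infdist x (attractor F) \<le> \<delta>})"
          by (subst (asm) ennreal_le_iff) auto
        note le = this
        have "2 powr (\<alpha> * real n) * 2 powr (- \<alpha> * (real n - real n0)) = 2 powr (\<alpha> * real n0)"
          by (simp add: powr_add[symmetric] algebra_simps)
        then have "1/2 * 2 powr (\<alpha> * real n0) * V = 2 powr (\<alpha> * real n) * (?\<kappa> * V)"
          by (metis mult.assoc mult.left_commute)
        also have "\<dots> \<le> 2 powr (\<alpha> * real n) * measure lborel (A \<omega> n \<inter> {x. infdist x (attractor F) \<le> \<delta>})"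
          using le by (rule mult_left_mono) simp
        finally show ?thesis .
      qed
      then show ?thesis using V by (intro exI[of _ "1/2 * 2 powr (\<alpha> * real n0) * V"] conjI exI[of _ n0]) auto
    qed
    show ?thesis
      by (rule msupp_meets[OF F.attractor_compact ne lims A(2) A(3) _ low]) simp_all
  qed
  ultimately show ?thesis using E(1) Z(3) Epos by (intro bexI[of _ "E - Z"]) auto
qed


section \<open>Fractal percolation\<close>

lemma msupp_density_subset:
  fixes C :: "'a::euclidean_space set"
  assumes "closed C" "A \<in> sets borel" "A \<subseteq> C"
  shows "msupp (density lborel (\<lambda>x. ennreal (c * indicator A x))) \<subseteq> C"
proof
  fix x assume x: "x \<in> msupp (density lborel (\<lambda>x. ennreal (c * indicator A x)))"
  show "x \<in> C"
  proof (rule ccontr)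
    assume "x \<notin> C"
    then obtain e where e: "0 < e" "ball x e \<subseteq> - C"
      using assms(1) openE[of "- C" x] by auto
    have "emeasure (density lborel (\<lambda>x. ennreal (c * indicator A x))) (ball x e)
       = (\<integral>\<^sup>+y. ennreal (c * indicator A y) * indicator (ball x e) y \<partial>lborel)"
      using assms(2) by (intro emeasure_density) auto
    also have "\<dots> = (\<integral>\<^sup>+y. 0 \<partial>(lborel :: 'a measure))"
    proof (rule nn_integral_cong)
      fix y show "ennreal (c * indicator A y) * indicator (ball x e) y = 0"
        using e(2) assms(3) by (cases "y \<in> A"; cases "y \<in> ball x e") auto
    qed
    finally show False using x e(1) by (auto simp: msupp_def)
  qed
qed

text \<open>The support of the initial measure is enclosed in a closed set \<open>C\<close> that
  does not depend on the random element; \<open>interior C\<close> is then the open region in which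
  the measures on the attractors are placed.\<close>

theorem (in removal_model) support_meets_all_attractors:
  fixes A :: "'w \<Rightarrow> nat \<Rightarrow> 'a set"
  assumes A: "\<And>\<omega> n. \<omega> \<in> space M \<Longrightarrow> interior C - removed \<omega> n \<subseteq> A \<omega> n" "\<And>\<omega> n. A \<omega> n \<in> sets borel"
      "\<And>\<omega> n. bounded (A \<omega> n)" "closed C" "\<And>\<omega>. A \<omega> 0 \<subseteq> C"
    and \<mu>: "\<And>n \<omega> x. \<mu> n \<omega> x = 2 powr (\<alpha> * real n) * indicator (A \<omega> n) x"
    and lim: "AE \<omega> in M. sets (\<mu>inf \<omega>) = sets borel \<and> finite_measure (\<mu>inf \<omega>) \<and>
       weak_conv_measures (\<lambda>n. density lborel (\<lambda>x. ennreal (\<mu> n \<omega> x))) (\<mu>inf \<omega>)"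
    and \<Gamma>: "\<Gamma> \<subseteq> sim_tuples m" "ifs_compact \<Gamma>"
    and F: "\<forall>F\<in>\<Gamma>. \<not> in_hyperplane (attractor F)"
      "\<forall>F\<in>\<Gamma>. \<forall>\<omega>\<in>space M. attractor F \<inter> interior (msupp (density lborel (\<lambda>x. ennreal (\<mu> 0 \<omega> x)))) \<noteq> {}"
      "\<forall>F\<in>\<Gamma>. hausdorff_dim (attractor F) > \<alpha>"
  shows "\<exists>B\<in>events. 0 < prob B \<and> (\<forall>\<omega>\<in>B. \<forall>F\<in>\<Gamma>. msupp (\<mu>inf \<omega>) \<inter> attractor F \<noteq> {})"
proof (rule support_meets_attractors[OF \<Gamma>(1) _ A(1,2,3) \<mu> lim])
  show "survives (interior C) \<Gamma>"
  proof (rule survives_compact[OF \<Gamma> open_interior])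
    fix G assume G: "G \<in> \<Gamma>"
    show "\<not> in_hyperplane (attractor G)" "\<alpha> < hausdorff_dim (attractor G)" using F G by auto
    obtain \<omega> where \<omega>: "\<omega> \<in> space M" using not_empty by blast
    have "msupp (density lborel (\<lambda>x. ennreal (\<mu> 0 \<omega> x))) \<subseteq> C"
      unfolding \<mu> by (rule msupp_density_subset[OF A(4,2,5)])
    then have "interior (msupp (density lborel (\<lambda>x. ennreal (\<mu> 0 \<omega> x)))) \<subseteq> interior C" by (rule interior_mono)
    then show "attractor G \<inter> interior C \<noteq> {}" using F(2) G \<omega> by blast
  qed
qed

lemma dyadic_cube_eq_cbox:
  "dyadic_cube n k = cbox (\<Sum>i\<in>Basis. (real (k i) / 2 ^ n) *\<^sub>R i) (\<Sum>i\<in>Basis. ((real (k i) + 1) / 2 ^ n) *\<^sub>R i)"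
  by (auto simp: dyadic_cube_def cbox_def)

lemma finite_dyadic_index: "finite (dyadic_index n :: ('a::euclidean_space \<Rightarrow> nat) set)"
proof -
  have "dyadic_index n = {k :: 'a \<Rightarrow> nat. \<forall>i. (i \<in> Basis \<longrightarrow> k i \<in> {..<2 ^ n}) \<and> (i \<notin> Basis \<longrightarrow> k i = 0)}"
    by (auto simp: dyadic_index_def)
  then show ?thesis using finite_set_of_finite_funs[of "Basis :: 'a set" "{..<2 ^ n :: nat}" 0] by simp
qed

text \<open>A point that is more than an erosion away from all dyadic hyperplanes lies strictly
  inside every cube that comes within an erosion of it. Hence only one cube of the level can
  threaten it.\<close>

lemma dyadic_cube_coordinate:
  assumes k: "k \<in> dyadic_index n" and near: "x \<notin> far (erosion n) (dyadic_cube n k)" and grid: "x \<notin> near_grid n"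
    and i: "i \<in> Basis"
  shows "int (k i) = \<lfloor>x \<bullet> i * 2 ^ n\<rfloor>"
proof -
  obtain y where y: "y \<in> dyadic_cube n k" "dist x y \<le> erosion n" using near by (auto simp: far_def not_less)
  have d: "\<bar>x \<bullet> i - y \<bullet> i\<bar> \<le> erosion n"
    using Basis_le_norm[OF i, of "x - y"] y(2) by (simp add: inner_diff_left dist_norm)
  have yb: "real (k i) / 2 ^ n \<le> y \<bullet> i" "y \<bullet> i \<le> (real (k i) + 1) / 2 ^ n" using y(1) i by (auto simp: dyadic_cube_def)
  have g: "erosion n < \<bar>x \<bullet> i - real_of_int j / 2 ^ n\<bar>" for j :: int
    using grid i unfolding near_grid_def by (auto simp: not_le)
  have g1: "erosion n < \<bar>x \<bullet> i - real (k i) / 2 ^ n\<bar>" using g[of "int (k i)"] by simp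
  have g2: "erosion n < \<bar>x \<bullet> i - (real (k i) + 1) / 2 ^ n\<bar>" using g[of "int (k i) + 1"] by simp
  have "real (k i) / 2 ^ n < x \<bullet> i" using d yb(1) g1 by linarith
  moreover have "x \<bullet> i < (real (k i) + 1) / 2 ^ n" using d yb(2) g2 by linarith
  ultimately have "real (k i) \<le> x \<bullet> i * 2 ^ n" "x \<bullet> i * 2 ^ n < real (k i) + 1" by (simp_all add: field_simps)
  then show ?thesis by linarith
qed

text \<open>A cube that is not retained counts as removed, whatever happens to its ancestors. Away
  from the grid at most one cube threatens a point, so survival has at least the retention
  probability and \<kappa> is 0. The diameter constant comes from bounding the norm by the sum of
  the coordinates.\<close>

lemma percolation_removal_model:
  fixes X :: "nat \<times> ('a::euclidean_space \<Rightarrow> nat) \<Rightarrow> 'w \<Rightarrow> bool"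
  assumes M: "prob_space M" and \<alpha>: "0 < \<alpha>"
    and indep: "prob_space.indep_vars M (\<lambda>_. count_space UNIV) X perc_index"
    and p: "\<forall>c\<in>perc_index. measure M {\<omega>\<in>space M. X c \<omega>} = 2 powr (- \<alpha>)"
  shows "removal_model M dyadic_index (\<lambda>c \<omega>. \<not> X c \<omega>) (\<lambda>c. dyadic_cube (fst c) (snd c)) \<alpha> (real DIM('a)) 0"
proof -
  interpret prob_space M by (rule M)
  have idx: "(SIGMA n:{1..}. dyadic_index n) = (perc_index :: (nat \<times> ('a \<Rightarrow> nat)) set)" by (auto simp: perc_index_def)
  show ?thesis
  proof unfold_locales
    show "0 < \<alpha>" "0 \<le> real DIM('a)" "(0::real) \<le> 0" using \<alpha> by auto
    show "finite (dyadic_index n :: ('a \<Rightarrow> nat) set)" for n by (rule finite_dyadic_index)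
    show "indep_vars (\<lambda>_. count_space UNIV) (\<lambda>c \<omega>. \<not> X c \<omega>) (SIGMA n:{1..}. dyadic_index n)"
      unfolding idx by (rule indep_vars_compose2[OF indep]) simp
    show "dist x y \<le> real DIM('a) / 2 ^ n"
      if "1 \<le> n" "i \<in> dyadic_index n" and xy: "x \<in> dyadic_cube (fst (n, i)) (snd (n, i))" "y \<in> dyadic_cube (fst (n, i)) (snd (n, i))"
      for n and i :: "'a \<Rightarrow> nat" and x y
    proof -
      have "norm (x - y) \<le> DIM('a) * (1 / 2 ^ n)"
      proof (rule norm_le_coords)
        fix b :: 'a assume b: "b \<in> Basis"
        have "real (i b) / 2 ^ n \<le> x \<bullet> b" "x \<bullet> b \<le> real (i b) / 2 ^ n + 1 / 2 ^ n"
          "real (i b) / 2 ^ n \<le> y \<bullet> b" "y \<bullet> b \<le> real (i b) / 2 ^ n + 1 / 2 ^ n"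
          using xy b by (auto simp: dyadic_cube_def add_divide_distrib)
        then show "\<bar>(x - y) \<bullet> b\<bar> \<le> 1 / 2 ^ n" unfolding inner_diff_left by linarith
      qed
      then show ?thesis by (simp add: dist_norm)
    qed
    show "0 < prob {\<omega>\<in>space M. \<not> \<not> X (n, i) \<omega>}" if "1 \<le> n" "i \<in> dyadic_index n" for n and i :: "'a \<Rightarrow> nat"
      using p that by (simp add: perc_index_def)
    show "2 powr (- \<alpha>) * (1 - 0 / 2 ^ n) \<le> prob {\<omega>\<in>space M. \<forall>i\<in>dyadic_index n. \<not> X (n, i) \<omega> \<longrightarrow>
        x \<in> far (erosion n) (dyadic_cube (fst (n, i)) (snd (n, i)))}"
      if n: "1 \<le> n" and x: "x \<notin> near_grid n" for n and x :: 'a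
    proof -
      have Xev: "{\<omega>\<in>space M. \<not> X (n, i) \<omega> \<longrightarrow> Q} \<in> events" if "i \<in> dyadic_index n" for i Q
      proof -
        have [measurable]: "X (n, i) \<in> measurable M (count_space UNIV)"
          using indep that n unfolding indep_vars_def by (auto simp: perc_index_def)
        show ?thesis by measurable
      qed
      let ?S = "{\<omega>\<in>space M. \<forall>i\<in>dyadic_index n. \<not> X (n, i) \<omega> \<longrightarrow> x \<in> far (erosion n) (dyadic_cube (fst (n, i)) (snd (n, i)))}"
      have Sev: "?S \<in> events"
        by (intro sets.sets_Collect_finite_All finite_dyadic_index Xev)
      show ?thesis
      proof (cases "\<exists>k\<in>dyadic_index n. x \<notin> far (erosion n) (dyadic_cube n k)")
        case False
        then have "?S = space M" by auto
        moreover have "2 powr (- \<alpha>) \<le> 2 powr 0" using \<alpha> by (intro powr_mono) auto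
        ultimately show ?thesis by (simp add: prob_space)
      next
        case True
        then obtain k where k: "k \<in> dyadic_index n" "x \<notin> far (erosion n) (dyadic_cube n k)" by blast
        have uniq: "k' = k" if k': "k' \<in> dyadic_index n" "x \<notin> far (erosion n) (dyadic_cube n k')" for k'
        proof
          fix i
          show "k' i = k i"
          proof (cases "i \<in> Basis")
            case True
            have "int (k' i) = int (k i)"
              using dyadic_cube_coordinate[OF k x True] dyadic_cube_coordinate[OF k' x True] by simp
            then show ?thesis by simp
          next
            case False
            then show ?thesis using k k' by (simp add: dyadic_index_def)
          qed
        qed
        have "2 powr (- \<alpha>) = prob {\<omega>\<in>space M. X (n, k) \<omega>}" using p k n by (simp add: perc_index_def)
        also have "\<dots> \<le> prob ?S"
          by (rule finite_measure_mono[OF _ Sev]) (use uniq in auto)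
        finally show ?thesis by simp
      qed
    qed
  qed
qed

text \<open>Rounding down gives a cube of level \<open>n\<close> that contains \<open>x\<close>, and
  integer division gives its ancestors. Only an inclusion is claimed, as a boundary point of a
  removed closed cube may survive in a neighbouring cube.\<close>

lemma box_Diff_removed_subset_perc_set:
  fixes x :: "'a::euclidean_space"
  assumes x: "x \<in> box 0 One" and keep: "\<And>j k. j \<in> {1..n} \<Longrightarrow> k \<in> dyadic_index j \<Longrightarrow> x \<in> dyadic_cube j k \<Longrightarrow> X (j, k) \<omega>"
  shows "x \<in> perc_set X \<omega> n"
proof -
  define k :: "'a \<Rightarrow> nat" where "k i = (if i \<in> Basis then nat \<lfloor>x \<bullet> i * 2 ^ n\<rfloor> else 0)" for i
  have x01: "0 < x \<bullet> i" "x \<bullet> i < 1" if "i \<in> Basis" for i using x that by (auto simp: box_def)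
  have kb: "real (k i) \<le> x \<bullet> i * 2 ^ n" "x \<bullet> i * 2 ^ n < real (k i) + 1" if i: "i \<in> Basis" for i
  proof -
    have "0 \<le> x \<bullet> i * 2 ^ n" using x01[OF i] by simp
    then show "real (k i) \<le> x \<bullet> i * 2 ^ n" "x \<bullet> i * 2 ^ n < real (k i) + 1"
      using i unfolding k_def by simp_all
  qed
  have k2: "k i < 2 ^ n" if i: "i \<in> Basis" for i
  proof -
    have "real (k i) \<le> x \<bullet> i * 2 ^ n" by (rule kb(1)[OF i])
    also have "\<dots> < 1 * 2 ^ n" using x01[OF i] by (intro mult_strict_right_mono) auto
    finally have "real (k i) < real (2 ^ n)" by simp
    then show ?thesis by (simp only: of_nat_less_iff)
  qed
  have anc: "(\<lambda>i. k i div 2 ^ (n - j)) \<in> dyadic_index j \<and> x \<in> dyadic_cube j (\<lambda>i. k i div 2 ^ (n - j))" if j: "j \<le> n" for j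
  proof -
    have pw: "(2::nat) ^ n = 2 ^ j * 2 ^ (n - j)" using j by (simp add: power_add[symmetric])
    then have pwr: "(2::real) ^ n = 2 ^ j * 2 ^ (n - j)" using j by (simp add: power_add[symmetric])
    have "k i div 2 ^ (n - j) < 2 ^ j" if "i \<in> Basis" for i
      using k2[OF that] pw by (intro less_mult_imp_div_less) simp
    moreover have "k i div 2 ^ (n - j) = 0" if "i \<notin> Basis" for i using that by (simp add: k_def)
    moreover have "real (k i div 2 ^ (n - j)) / 2 ^ j \<le> x \<bullet> i \<and> x \<bullet> i \<le> (real (k i div 2 ^ (n - j)) + 1) / 2 ^ j"
      if i: "i \<in> Basis" for i
    proof -
      define q where "q = k i div 2 ^ (n - j)"
      have "q * 2 ^ (n - j) \<le> k i" unfolding q_def by (rule div_times_less_eq_dividend)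
      then have q1: "real q * 2 ^ (n - j) \<le> real (k i)" by (metis of_nat_le_iff of_nat_mult of_nat_numeral of_nat_power)
      have "k i < (q + 1) * 2 ^ (n - j)" unfolding q_def using div_less_iff_less_mult[of "2 ^ (n - j)" "k i" "k i div 2 ^ (n - j) + 1"] by simp
      then have "k i + 1 \<le> (q + 1) * 2 ^ (n - j)" by simp
      then have "real (k i + 1) \<le> real ((q + 1) * 2 ^ (n - j))" by (simp only: of_nat_le_iff)
      then have q2: "real (k i) + 1 \<le> (real q + 1) * 2 ^ (n - j)" by (simp add: algebra_simps)
      have xe: "x \<bullet> i * 2 ^ n = x \<bullet> i * 2 ^ j * 2 ^ (n - j)" by (simp only: pwr mult.assoc)
      have "real q * 2 ^ (n - j) \<le> x \<bullet> i * 2 ^ j * 2 ^ (n - j)" using q1 kb(1)[OF i] xe by linarith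
      moreover have "x \<bullet> i * 2 ^ j * 2 ^ (n - j) \<le> (real q + 1) * 2 ^ (n - j)" using q2 kb(2)[OF i] xe by linarith
      ultimately have "real q \<le> x \<bullet> i * 2 ^ j" "x \<bullet> i * 2 ^ j \<le> real q + 1" by simp_all
      then show ?thesis unfolding q_def[symmetric] by (simp add: pos_divide_le_eq pos_le_divide_eq)
    qed
    ultimately show ?thesis by (auto simp: dyadic_index_def dyadic_cube_def)
  qed
  have kn: "k \<in> dyadic_index n" "x \<in> dyadic_cube n k" using anc[of n] by auto
  have "\<forall>j\<in>{1..n}. X (j, \<lambda>i. k i div 2 ^ (n - j)) \<omega>" using keep anc by auto
  then show ?thesis unfolding perc_set_def using kn by blast
qed

theorem percolation_support_meets_all_attractors:
  fixes M :: "'w measure" and \<mu> :: "nat \<Rightarrow> 'w \<Rightarrow> 'a::euclidean_space \<Rightarrow> real"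
  assumes M: "prob_space M" and \<alpha>: "0 < \<alpha>" and model: "fractal_percolation_model M \<alpha> \<mu>"
    and lim: "AE \<omega> in M. sets (\<mu>inf \<omega>) = sets borel \<and> finite_measure (\<mu>inf \<omega>) \<and>
       weak_conv_measures (\<lambda>n. density lborel (\<lambda>x. ennreal (\<mu> n \<omega> x))) (\<mu>inf \<omega>)"
    and \<Gamma>: "\<Gamma> \<subseteq> sim_tuples m" "ifs_compact \<Gamma>"
    and F: "\<forall>F\<in>\<Gamma>. \<not> in_hyperplane (attractor F)"
      "\<forall>F\<in>\<Gamma>. \<forall>\<omega>\<in>space M. attractor F \<inter> interior (msupp (density lborel (\<lambda>x. ennreal (\<mu> 0 \<omega> x)))) \<noteq> {}"
      "\<forall>F\<in>\<Gamma>. hausdorff_dim (attractor F) > \<alpha>"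
  shows "\<exists>B\<in>sets M. 0 < measure M B \<and> (\<forall>\<omega>\<in>B. \<forall>F\<in>\<Gamma>. msupp (\<mu>inf \<omega>) \<inter> attractor F \<noteq> {})"
proof -
  obtain X where X: "prob_space.indep_vars M (\<lambda>_. count_space UNIV) X perc_index"
    "\<forall>c\<in>perc_index. measure M {\<omega>\<in>space M. X c \<omega>} = 2 powr (- \<alpha>)"
    "\<forall>n \<omega> x. \<mu> n \<omega> x = (2 powr (- \<alpha>)) powr (- real n) * indicator (perc_set X \<omega> n) x"
    using model unfolding fractal_percolation_model_def by blast
  interpret removal_model M dyadic_index "\<lambda>c \<omega>. \<not> X c \<omega>" "\<lambda>c. dyadic_cube (fst c) (snd c)" \<alpha> "real DIM('a)" 0
    by (rule percolation_removal_model[OF M \<alpha> X(1,2)])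
  have cubes: "perc_set X \<omega> n = \<Union> (dyadic_cube n ` {k \<in> dyadic_index n. \<forall>j\<in>{1..n}. X (j, \<lambda>i. k i div 2 ^ (n - j)) \<omega>})" for \<omega> n
    by (auto simp: perc_set_def)
  have finite_cubes: "finite {k \<in> (dyadic_index n :: ('a \<Rightarrow> nat) set). \<forall>j\<in>{1..n}. X (j, \<lambda>i. k i div 2 ^ (n - j)) \<omega>}" for \<omega> n
    by (rule finite_subset[OF _ finite_dyadic_index]) auto
  have comp: "compact (perc_set X \<omega> n)" for \<omega> n
    unfolding cubes using finite_cubes by (intro compact_UN) (auto simp: dyadic_cube_eq_cbox)
  show ?thesis
  proof (rule support_meets_all_attractors[where C = "cbox 0 One" and A = "perc_set X", OF _ _ _ _ _ _ lim \<Gamma> F])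
    show "interior (cbox 0 One) - removed \<omega> n \<subseteq> perc_set X \<omega> n" if "\<omega> \<in> space M" for \<omega> n
    proof
      fix x assume x: "x \<in> interior (cbox 0 One) - removed \<omega> n"
      show "x \<in> perc_set X \<omega> n"
      proof (rule box_Diff_removed_subset_perc_set)
        show "x \<in> box 0 One" using x by (simp add: interior_cbox)
        fix j k assume "j \<in> {1..n}" "k \<in> dyadic_index j" "x \<in> dyadic_cube j k"
        then show "X (j, k) \<omega>" using x by (force simp: removed_def config_def J_def)
      qed
    qed
    show "perc_set X \<omega> n \<in> sets borel" "bounded (perc_set X \<omega> n)" for \<omega> n
      by (intro borel_closed compact_imp_closed comp, intro compact_imp_bounded comp)
    show "perc_set X \<omega> 0 \<subseteq> cbox 0 One" for \<omega>
      unfolding perc_set_def by (auto simp: dyadic_index_def dyadic_cube_def cbox_def)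
    show "\<mu> n \<omega> x = 2 powr (\<alpha> * real n) * indicator (perc_set X \<omega> n) x" for n \<omega> x
      using X(3) by (simp add: powr_powr)
  qed (rule closed_cbox)
qed


section \<open>Ball cutouts\<close>

text \<open>The process provides independence of counts for finite sequences of sets, so each finite
  subfamily is enumerated. A set is hit iff its count is not 0, which turns the events into events
  of counts.\<close>

lemma (in prob_space) indep_vars_nonempty_poisson:
  assumes ppp: "poisson_point_process M \<nu> Y" and B: "\<And>i. i \<in> S \<Longrightarrow> B i \<in> sets \<nu>" and disj: "disjoint_family_on B S"
  shows "indep_vars (\<lambda>_. count_space UNIV) (\<lambda>i \<omega>. Y \<omega> \<inter> B i \<noteq> {}) S"
proof -
  have rv: "pcount Y (B i) \<in> borel_measurable M" if "i \<in> S" for i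
    using ppp B[OF that] by (auto simp: poisson_point_process_def)
  have eq: "(\<lambda>\<omega>. Y \<omega> \<inter> B i \<noteq> {}) = (\<lambda>\<omega>. pcount Y (B i) \<omega> \<noteq> 0)" for i
    by (auto simp: pcount_def emeasure_count_space_eq_0 fun_eq_iff)
  have brv: "(\<lambda>\<omega>. Y \<omega> \<inter> B i \<noteq> {}) \<in> measurable M (count_space UNIV)" if "i \<in> S" for i
    unfolding eq using rv[OF that] by measurable
  show ?thesis
    unfolding indep_vars_def2
  proof (rule conjI, intro ballI brv, assumption, rule indep_setsI)
    show "{(\<lambda>\<omega>. Y \<omega> \<inter> B i \<noteq> {}) -` A \<inter> space M |A. A \<in> sets (count_space UNIV)} \<subseteq> events" if "i \<in> S" for i
    proof
      fix Z assume "Z \<in> {(\<lambda>\<omega>. Y \<omega> \<inter> B i \<noteq> {}) -` A \<inter> space M |A. A \<in> sets (count_space UNIV)}"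
      then obtain A where Z: "Z = (\<lambda>\<omega>. Y \<omega> \<inter> B i \<noteq> {}) -` A \<inter> space M" by (elim CollectE exE conjE) (rule that)
      show "Z \<in> events" unfolding Z by (rule measurable_sets[OF brv[OF that]]) simp
    qed
    fix A J assume J: "J \<noteq> {}" "J \<subseteq> S" "finite J"
      and A: "\<forall>j\<in>J. A j \<in> {(\<lambda>\<omega>. Y \<omega> \<inter> B j \<noteq> {}) -` A \<inter> space M |A. A \<in> sets (count_space UNIV)}"
    have "\<forall>j\<in>J. \<exists>C. A j = (\<lambda>\<omega>. pcount Y (B j) \<omega> \<noteq> 0) -` C \<inter> space M"
    proof
      fix j assume "j \<in> J"
      from bspec[OF A this] obtain C where "A j = (\<lambda>\<omega>. Y \<omega> \<inter> B j \<noteq> {}) -` C \<inter> space M" by (elim CollectE exE conjE) (rule that)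
      then show "\<exists>C. A j = (\<lambda>\<omega>. pcount Y (B j) \<omega> \<noteq> 0) -` C \<inter> space M" unfolding eq by (rule exI)
    qed
    from bchoice[OF this] obtain C where C0: "\<forall>j\<in>J. A j = (\<lambda>\<omega>. pcount Y (B j) \<omega> \<noteq> 0) -` C j \<inter> space M"
      by (elim exE) (rule that)
    note C = bspec[OF C0]
    obtain f where f: "bij_betw f {..<card J} J" using ex_bij_betw_nat_finite[OF J(3)] by (auto simp: atLeast0LessThan)
    have fJ: "f ` {..<card J} = J" using f by (simp add: bij_betw_def)
    have fi: "f i \<in> J" if "i < card J" for i using fJ that by blast
    have dj: "disjoint_family_on (\<lambda>i. B (f i)) {..<card J}"
      unfolding disjoint_family_on_def
    proof (intro ballI impI)
      fix i k assume ik: "i \<in> {..<card J}" "k \<in> {..<card J}" "i \<noteq> k"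
      have ne: "f i \<noteq> f k"
      proof
        assume "f i = f k"
        then show False using inj_onD[OF bij_betw_imp_inj_on[OF f] _ ik(1,2)] ik(3) by simp
      qed
      have "f i \<in> S" "f k \<in> S" by (rule subsetD[OF J(2) fi], use ik in simp)+
      then show "B (f i) \<inter> B (f k) = {}"
        using ne by (rule disj[unfolded disjoint_family_on_def, rule_format])
    qed
    have Bs: "\<forall>i<card J. B (f i) \<in> sets \<nu>"
      by (intro allI impI B subsetD[OF J(2)] fi)
    have "\<forall>(B :: nat \<Rightarrow> _) k. (\<forall>i<k. B i \<in> sets \<nu>) \<and> disjoint_family_on B {..<k} \<longrightarrow>
        indep_vars (\<lambda>_. borel) (\<lambda>i. pcount Y (B i)) {..<k}"
      using ppp unfolding poisson_point_process_def by (elim conjE)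
    from this[rule_format, OF conjI[OF Bs dj]]
    have ind: "indep_vars (\<lambda>_. borel) (\<lambda>i. pcount Y (B (f i))) {..<card J}" .
    define D where "D i = {x::ennreal. (x \<noteq> 0) \<in> C (f i)}" for i
    have D: "D i \<in> sets borel" for i
    proof -
      have "D i = (if True \<in> C (f i) then - {0} else {}) \<union> (if False \<in> C (f i) then {0} else {})"
        unfolding D_def by (auto; metis (full_types))
      then show ?thesis by simp
    qed
    have AD: "A (f i) = pcount Y (B (f i)) -` D i \<inter> space M" if "i < card J" for i
      using C[OF fi[OF that]] by (auto simp: D_def)
    have "prob (\<Inter>i\<in>{..<card J}. pcount Y (B (f i)) -` D i \<inter> space M) = (\<Prod>i\<in>{..<card J}. prob (pcount Y (B (f i)) -` D i \<inter> space M))"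
    proof (rule indep_varsD_finite[OF ind _ _ D])
      show "{..<card J} \<noteq> {}" using J by (simp add: lessThan_empty_iff card_eq_0_iff)
    qed simp
    moreover have "(\<Inter>i\<in>{..<card J}. pcount Y (B (f i)) -` D i \<inter> space M) = (\<Inter>j\<in>J. A j)"
    proof -
      have "(\<Inter>i\<in>{..<card J}. pcount Y (B (f i)) -` D i \<inter> space M) = (\<Inter>i\<in>{..<card J}. A (f i))"
        using AD by (intro INF_cong) auto
      also have "\<dots> = (\<Inter>j\<in>f ` {..<card J}. A j)" by auto
      finally show ?thesis by (simp only: fJ)
    qed
    moreover have "(\<Prod>i\<in>{..<card J}. prob (pcount Y (B (f i)) -` D i \<inter> space M)) = (\<Prod>j\<in>J. prob (A j))"
    proof -
      have "(\<Prod>i\<in>{..<card J}. prob (pcount Y (B (f i)) -` D i \<inter> space M)) = (\<Prod>i\<in>{..<card J}. prob (A (f i)))"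
        using AD by (intro prod.cong) auto
      also have "\<dots> = (\<Prod>j\<in>J. prob (A j))" by (rule prod.reindex_bij_betw[OF f])
      finally show ?thesis .
    qed
    ultimately show "prob (\<Inter>j\<in>J. A j) = (\<Prod>j\<in>J. prob (A j))" by simp
  qed
qed

lemma (in prob_space) prob_void_poisson:
  assumes ppp: "poisson_point_process M \<nu> Y" and B: "B \<in> sets \<nu>" "emeasure \<nu> B < \<infinity>"
  shows "prob {\<omega>\<in>space M. Y \<omega> \<inter> B = {}} = exp (- enn2real (emeasure \<nu> B))"
proof -
  have "{\<omega>\<in>space M. Y \<omega> \<inter> B = {}} = {\<omega>\<in>space M. pcount Y B \<omega> = of_nat 0}"
    by (auto simp: pcount_def emeasure_count_space_eq_0)
  moreover have "prob {\<omega>\<in>space M. pcount Y B \<omega> = of_nat 0} = exp (- enn2real (emeasure \<nu> B)) * enn2real (emeasure \<nu> B) ^ 0 / fact 0"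
  proof -
    have "\<forall>B\<in>sets \<nu>. emeasure \<nu> B < \<infinity> \<longrightarrow> (\<forall>k::nat. prob {\<omega>\<in>space M. pcount Y B \<omega> = of_nat k} =
        exp (- enn2real (emeasure \<nu> B)) * enn2real (emeasure \<nu> B) ^ k / fact k)"
      using ppp unfolding poisson_point_process_def by (elim conjE)
    from this[rule_format, OF B] show ?thesis .
  qed
  ultimately show ?thesis by simp
qed

section \<open>Dyadic levels and cells of the Poisson intensity\<close>

definition level_interval :: "nat \<Rightarrow> real set" where "level_interval j = {1 / 2 ^ j..<2 / 2 ^ j}"

text \<open>A linear bound for the growth of the volume of an enlarged ball; 7 is the largest value
  of the base \<open>1 + u\<close>.\<close>

lemma one_plus_power_le:
  fixes u :: real
  assumes "0 \<le> u" "u \<le> 6" shows "(1 + u) ^ n \<le> 1 + real n * 7 ^ n * u"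
proof (induction n)
  case (Suc n)
  have "(1 + u) ^ Suc n = (1 + u) ^ n + u * (1 + u) ^ n" by (simp add: algebra_simps)
  moreover have "u * (1 + u) ^ n \<le> u * 7 ^ n" using assms by (intro mult_left_mono power_mono) auto
  ultimately have "(1 + u) ^ Suc n \<le> 1 + real n * 7 ^ n * u + u * 7 ^ n" using Suc.IH by linarith
  also have "\<dots> = 1 + real (Suc n) * 7 ^ n * u" by (simp add: algebra_simps)
  also have "\<dots> \<le> 1 + real (Suc n) * 7 ^ Suc n * u"
    using assms by (intro add_left_mono mult_right_mono mult_left_mono) auto
  finally show ?case .
qed simp

lemma level_integral:
  assumes "0 \<le> c"
  shows "(\<integral>\<^sup>+s. ennreal (c / s) * indicator (level_interval j) s \<partial>lborel) \<le> ennreal (c * ln 2)"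
proof -
  have "(\<integral>\<^sup>+s. ennreal (c / s) * indicator (level_interval j) s \<partial>lborel) \<le>
      (\<integral>\<^sup>+s. ennreal (c / s) * indicator {1 / 2 ^ j..2 / 2 ^ j} s \<partial>lborel)"
    by (intro nn_integral_mono mult_left_mono) (auto simp: level_interval_def indicator_def)
  also have "\<dots> = ennreal (c * ln (2 / 2 ^ j) - c * ln (1 / 2 ^ j))"
  proof (rule nn_integral_FTC_Icc)
    fix s :: real assume "s \<in> {1 / 2 ^ j..2 / 2 ^ j}"
    then have s: "1 / 2 ^ j \<le> s" by simp
    have s0: "0 < s" using s less_le_trans[of 0 "1 / 2 ^ j" s] by simp
    show "((\<lambda>s. c * ln s) has_real_derivative c / s) (at s)"
      using s0 by (auto intro!: derivative_eq_intros)
    show "0 \<le> c / s" using s0 assms by simp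
  qed (auto simp: divide_right_mono)
  also have "c * ln (2 / 2 ^ j) - c * ln (1 / 2 ^ j) = c * ln 2"
    by (simp add: ln_div algebra_simps)
  finally show ?thesis .
qed

text \<open>For fixed \<open>s\<close> the admissible \<open>t\<close> form a ball of radius
  \<open>1/2 + e / s\<close>, and \<open>ds / s\<close> gives one dyadic level the mass
  \<open>ln 2\<close>. For \<open>e = 0\<close> the bound is \<alpha> times \<open>ln 2\<close>, the
  source of the survival factor \<open>2 powr (- \<alpha>)\<close>.\<close>

lemma ppp_intensity_near_point:
  fixes x :: "'a::euclidean_space" and j :: nat
  assumes r: "0 < r" and e: "0 \<le> e"
  defines "B \<equiv> {p :: 'a \<times> real. snd p \<in> level_interval j \<and> dist x (snd p *\<^sub>R fst p) \<le> snd p / 2 + e}"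
  shows "B \<in> sets (ppp_intensity r :: ('a \<times> real) measure)"
    and "emeasure (ppp_intensity r) B \<le> ennreal (r * measure lborel (ball (0::'a) (1/2)) * (1 + 2 * e * 2 ^ j) ^ DIM('a) * ln 2)"
proof -
  have "{p :: 'a \<times> real. snd p \<in> level_interval j \<and> dist x (snd p *\<^sub>R fst p) \<le> snd p / 2 + e}
      = {p \<in> space (borel \<Otimes>\<^sub>M borel). snd p \<in> level_interval j \<and> dist x (snd p *\<^sub>R fst p) \<le> snd p / 2 + e}"
    by (auto simp: space_pair_measure)
  also have "\<dots> \<in> sets (borel \<Otimes>\<^sub>M borel)"
    unfolding level_interval_def atLeastLessThan_iff by measurable
  finally have Bm: "B \<in> sets (borel \<Otimes>\<^sub>M borel)" by (simp add: B_def)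
  then show "B \<in> sets (ppp_intensity r :: ('a \<times> real) measure)"
    by (simp add: ppp_intensity_def cong: sets_pair_measure_cong)
  define V where "V = unit_ball_vol (real DIM('a))"
  have V: "0 \<le> V" by (simp add: V_def)
  define d where "d = DIM('a)"
  let ?f = "\<lambda>p :: 'a \<times> real. (case p of (t, s) \<Rightarrow> if 0 < s then ennreal (r / s) else 0)"
  have fm: "?f \<in> borel_measurable (lborel \<Otimes>\<^sub>M lborel)" by measurable
  have Bm': "B \<in> sets (lborel \<Otimes>\<^sub>M lborel)" using Bm by (simp cong: sets_pair_measure_cong)
  have "emeasure (ppp_intensity r) B = (\<integral>\<^sup>+p. ?f p * indicator B p \<partial>(lborel \<Otimes>\<^sub>M lborel))"
    unfolding ppp_intensity_def by (rule emeasure_density[OF fm Bm'])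
  also have "\<dots> = (\<integral>\<^sup>+s. \<integral>\<^sup>+t. ?f (t, s) * indicator B (t, s) \<partial>lborel \<partial>lborel)"
    by (rule lborel_pair.nn_integral_snd[symmetric]) (use fm Bm' in measurable)
  also have "\<dots> \<le> (\<integral>\<^sup>+s. ennreal ((r * (V * ((1 + 2 * e * 2 ^ j) / 2) ^ d)) / s) * indicator (level_interval j) s \<partial>lborel)"
  proof (rule nn_integral_mono)
    fix s :: real
    show "(\<integral>\<^sup>+t. ?f (t, s) * indicator B (t, s) \<partial>lborel) \<le>
      ennreal ((r * (V * ((1 + 2 * e * 2 ^ j) / 2) ^ d)) / s) * indicator (level_interval j) s"
    proof (cases "s \<in> level_interval j")
      case False
      then show ?thesis by (simp add: B_def)
    next
      case True
      then have s: "1 / 2 ^ j \<le> s" by (simp add: level_interval_def)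
      have s0: "0 < s" using s less_le_trans[of 0 "1 / 2 ^ j" s] by simp
      define \<rho> where "\<rho> = (s / 2 + e) / s"
      have \<rho>0: "0 \<le> \<rho>" using s0 e by (simp add: \<rho>_def)
      have ball: "(t, s) \<in> B \<longleftrightarrow> t \<in> cball (x /\<^sub>R s) \<rho>" for t
      proof -
        have "x - s *\<^sub>R t = s *\<^sub>R (x /\<^sub>R s - t)" using s0 by (simp add: algebra_simps)
        then have "dist x (s *\<^sub>R t) = s * dist (x /\<^sub>R s) t" using s0 by (simp add: dist_norm)
        then show ?thesis using True s0 by (simp add: B_def \<rho>_def pos_le_divide_eq mult.commute)
      qed
      have "(\<integral>\<^sup>+t. ?f (t, s) * indicator B (t, s) \<partial>lborel) = (\<integral>\<^sup>+t. ennreal (r / s) * indicator (cball (x /\<^sub>R s) \<rho>) t \<partial>lborel)"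
        using s0 ball by (intro nn_integral_cong) (auto simp: indicator_def)
      also have "\<dots> = ennreal (r / s) * ennreal (V * \<rho> ^ d)"
        using \<rho>0 by (simp add: nn_integral_cmult_indicator emeasure_cball V_def d_def)
      also have "\<dots> = ennreal (r / s * (V * \<rho> ^ d))"
        using r s0 V \<rho>0 by (intro ennreal_mult[symmetric]) auto
      also have "\<dots> \<le> ennreal (r / s * (V * ((1 + 2 * e * 2 ^ j) / 2) ^ d))"
      proof -
        have "e / s \<le> e * 2 ^ j"
          using s s0 e mult_left_mono[of "1 / s" "2 ^ j" e] by (simp add: field_simps)
        then have "\<rho> \<le> (1 + 2 * e * 2 ^ j) / 2" using s0 by (simp add: \<rho>_def add_divide_distrib)
        then show ?thesis using \<rho>0 r s0 V by (intro ennreal_leI mult_left_mono power_mono) auto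
      qed
      finally show ?thesis using True by simp
    qed
  qed
  also have "\<dots> \<le> ennreal ((r * (V * ((1 + 2 * e * 2 ^ j) / 2) ^ d)) * ln 2)"
    using r V e by (intro level_integral) auto
  also have "r * (V * ((1 + 2 * e * 2 ^ j) / 2) ^ d) = r * measure lborel (ball (0::'a) (1/2)) * (1 + 2 * e * 2 ^ j) ^ d"
    by (simp add: content_ball V_def d_def power_divide)
  finally show "emeasure (ppp_intensity r) B \<le> ennreal (r * measure lborel (ball (0::'a) (1/2)) * (1 + 2 * e * 2 ^ j) ^ DIM('a) * ln 2)"
    by (simp add: d_def)
qed

text \<open>With this mesh the centres \<open>s *\<^sub>R t\<close> given by the points of one cell differ by at most
  \<open>erosion j\<close>, see \<open>cell_close\<close>.\<close>

definition mesh :: "'a::euclidean_space itself \<Rightarrow> nat \<Rightarrow> real" where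
  "mesh _ j = erosion j / (DIM('a) * (2 ^ j + 5))"

definition cell :: "nat \<times> ('a::euclidean_space \<Rightarrow> int) \<times> int \<Rightarrow> ('a \<times> real) set" where
  "cell c = (case c of (j, k, l) \<Rightarrow>
     {t. \<forall>b\<in>Basis. \<lfloor>t \<bullet> b / mesh TYPE('a) j\<rfloor> = k b} \<times> {s\<in>level_interval j. \<lfloor>s / mesh TYPE('a) j\<rfloor> = l})"

text \<open>If \<open>1 / 2 ^ j \<le> s < 1\<close> and the ball given by \<open>(t, s)\<close>
  meets the open unit ball, then \<open>norm t \<le> 2 ^ j + 1\<close>. The additional 1 allows for
  rounding down.\<close>

definition cell_bound :: "'a::euclidean_space itself \<Rightarrow> nat \<Rightarrow> int" where
  "cell_bound _ j = \<lceil>(2 ^ j + 1) / mesh TYPE('a) j\<rceil> + 1"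

text \<open>The value 0 off the basis makes the index of a cell unique and the index set
  finite.\<close>

definition cell_index :: "nat \<Rightarrow> (('a::euclidean_space \<Rightarrow> int) \<times> int) set" where
  "cell_index j = {k. \<forall>b. (b \<in> Basis \<longrightarrow> k b \<in> {- cell_bound TYPE('a) j..cell_bound TYPE('a) j}) \<and> (b \<notin> Basis \<longrightarrow> k b = 0)}
     \<times> {0..cell_bound TYPE('a) j}"

text \<open>All balls that points of the cell could produce. The whole union is removed as soon as
  the cell contains a Poisson point: this is slightly too much, but leaves only one Boolean variable
  for each cell.\<close>

definition cell_ball :: "nat \<times> ('a::euclidean_space \<Rightarrow> int) \<times> int \<Rightarrow> 'a set" where
  "cell_ball c = (\<Union>(t, s)\<in>cell c. ball (s *\<^sub>R t) (s / 2))"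

lemma mesh_pos: "0 < mesh TYPE('a::euclidean_space) j"
  by (simp add: mesh_def erosion_pos add_pos_pos)

lemma mesh_le: "mesh TYPE('a::euclidean_space) j \<le> erosion j" "real DIM('a) * mesh TYPE('a) j * (2 ^ j + 5) = erosion j"
proof -
  have p: "(0::real) < 2 ^ j + 5" by (simp add: add_pos_pos)
  show "real DIM('a) * mesh TYPE('a) j * (2 ^ j + 5) = erosion j" using p by (simp add: mesh_def)
  have d: "1 \<le> real DIM('a)" by (simp add: Suc_leI)
  have "1 \<le> real DIM('a) * (2 ^ j + 5)" using mult_mono[of 1 "real DIM('a)" 1 "2 ^ j + 5 :: real"] d by simp
  then show "mesh TYPE('a) j \<le> erosion j"
    using erosion_pos[of j] mult_left_mono[of 1 "real DIM('a) * (2 ^ j + 5)" "erosion j"] p d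
    by (simp add: mesh_def pos_divide_le_eq)
qed

lemma finite_cell_index: "finite (cell_index j :: (('a::euclidean_space \<Rightarrow> int) \<times> int) set)"
  unfolding cell_index_def
  by (intro finite_cartesian_product finite_set_of_finite_funs) auto

lemma cell_sets: "cell c \<in> sets (ppp_intensity r :: ('a::euclidean_space \<times> real) measure)"
proof -
  obtain j k l where c: "c = (j, k, l)" by (cases c)
  have "{t :: 'a. \<forall>b\<in>Basis. \<lfloor>t \<bullet> b / mesh TYPE('a) j\<rfloor> = k b} =
      {t \<in> space borel. \<forall>b\<in>Basis. real_of_int (k b) \<le> t \<bullet> b / mesh TYPE('a) j \<and> t \<bullet> b / mesh TYPE('a) j < real_of_int (k b) + 1}"
    by (auto simp: floor_eq_iff)
  also have "\<dots> \<in> sets borel" by measurable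
  finally have 1: "{t :: 'a. \<forall>b\<in>Basis. \<lfloor>t \<bullet> b / mesh TYPE('a) j\<rfloor> = k b} \<in> sets borel" .
  have "{s\<in>level_interval j. \<lfloor>s / mesh TYPE('a) j\<rfloor> = l} =
      {s \<in> space borel. (1 / 2 ^ j \<le> s \<and> s < 2 / 2 ^ j) \<and> real_of_int l \<le> s / mesh TYPE('a) j \<and> s / mesh TYPE('a) j < real_of_int l + 1}"
    by (auto simp: floor_eq_iff level_interval_def)
  also have "\<dots> \<in> sets borel" by measurable
  finally have 2: "{s\<in>level_interval j. \<lfloor>s / mesh TYPE('a) j\<rfloor> = l} \<in> sets borel" .
  have "cell c \<in> sets (borel \<Otimes>\<^sub>M borel)" unfolding c cell_def using 1 2 by auto
  then show ?thesis by (simp add: ppp_intensity_def cong: sets_pair_measure_cong)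
qed

lemma cell_disjoint: "disjoint_family_on cell (SIGMA j:{1..}. (cell_index j :: (('a::euclidean_space \<Rightarrow> int) \<times> int) set))"
  unfolding disjoint_family_on_def
proof (intro ballI impI)
  fix c c' assume c: "c \<in> (SIGMA j:{1..}. (cell_index j :: (('a \<Rightarrow> int) \<times> int) set))"
    and c': "c' \<in> (SIGMA j:{1..}. cell_index j)" and ne: "c \<noteq> c'"
  obtain j k l where e: "c = (j, k, l)" by (cases c)
  obtain j' k' l' where e': "c' = (j', k', l')" by (cases c')
  show "cell c \<inter> cell c' = {}"
  proof (rule ccontr)
    assume "cell c \<inter> cell c' \<noteq> {}"
    then obtain t s where ts: "(t, s) \<in> cell c" "(t, s) \<in> cell c'" by auto
    have s: "1 / 2 ^ j \<le> s" "s < 2 / 2 ^ j" "1 / 2 ^ j' \<le> s" "s < 2 / 2 ^ j'"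
      using ts by (auto simp: e e' cell_def level_interval_def)
    have "(2::real) ^ j' < 2 ^ Suc j" "(2::real) ^ j < 2 ^ Suc j'"
      using le_less_trans[OF s(1,4)] le_less_trans[OF s(3,2)] by (simp_all add: field_simps)
    then have "j' < Suc j" "j < Suc j'" by (simp_all only: power_strict_increasing_iff)
    then have jj: "j = j'" by simp
    have kk: "k = k'"
    proof
      fix b show "k b = k' b"
      proof (cases "b \<in> Basis")
        case True
        then show ?thesis using ts jj by (auto simp: e e' cell_def)
      next
        case False
        then show ?thesis using c c' by (auto simp: e e' cell_index_def)
      qed
    qed
    have "l = l'" using ts jj by (auto simp: e e' cell_def)
    then show False using ne jj kk e e' by simp
  qed
qed

text \<open>The centres differ by \<open>s *\<^sub>R (t - t') + (s - s') *\<^sub>R t'\<close>, where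
  \<open>t'\<close> has norm of order \<open>2 ^ j\<close> by the bound on the indices. This
  accounts for the factor \<open>2 ^ j + 5\<close> in the mesh.\<close>

lemma cell_close:
  fixes t t' :: "'a::euclidean_space"
  assumes j: "1 \<le> j" and c: "c \<in> cell_index j" and ts: "(t, s) \<in> cell (j, c)" "(t', s') \<in> cell (j, c)"
  shows "dist (s *\<^sub>R t) (s' *\<^sub>R t') \<le> erosion j" "\<bar>s - s'\<bar> \<le> erosion j" "0 < s" "s < 2 / 2 ^ j"
proof -
  obtain k l where cc: "c = (k, l)" by (cases c)
  define h where "h = mesh TYPE('a) j"
  have h: "0 < h" "h \<le> erosion j" using mesh_pos mesh_le(1) by (auto simp: h_def)
  have close: "\<bar>y - z\<bar> \<le> h" if "\<lfloor>y / h\<rfloor> = \<lfloor>z / h\<rfloor>" for y z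
  proof -
    have "\<bar>y / h - z / h\<bar> \<le> 1" using that by linarith
    then have "\<bar>(y - z) / h\<bar> \<le> 1" by (simp only: diff_divide_distrib)
    then show ?thesis using h by (simp add: abs_divide)
  qed
  show ss: "\<bar>s - s'\<bar> \<le> erosion j"
    using close[of s s'] ts h by (auto simp: cc cell_def h_def[symmetric])
  have ssh: "\<bar>s - s'\<bar> \<le> h" using close[of s s'] ts by (auto simp: cc cell_def h_def[symmetric])
  have s: "1 / 2 ^ j \<le> s" "s < 2 / 2 ^ j" using ts by (auto simp: cc cell_def level_interval_def)
  show s0: "0 < s" using s(1) less_le_trans[of 0 "1 / 2 ^ j" s] by simp
  show "s < 2 / 2 ^ j" by (rule s(2))
  have "(2::real) ^ 1 \<le> 2 ^ j" using j by (intro power_increasing) auto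
  then have s1: "s \<le> 1" using s(2) less_le_trans[of s "2 / 2 ^ j" 1] by simp
  have tt: "norm (t - t') \<le> DIM('a) * h"
  proof (rule norm_le_coords)
    fix b :: 'a assume "b \<in> Basis"
    then have "\<lfloor>t \<bullet> b / h\<rfloor> = \<lfloor>t' \<bullet> b / h\<rfloor>" using ts by (auto simp: cc cell_def h_def)
    then show "\<bar>(t - t') \<bullet> b\<bar> \<le> h" using close by (simp add: inner_diff_left)
  qed
  have t': "norm t' \<le> real DIM('a) * (2 ^ j + 4)"
  proof (rule norm_le_coords)
    fix b :: 'a assume b: "b \<in> Basis"
    have "\<lfloor>t' \<bullet> b / h\<rfloor> \<in> {- cell_bound TYPE('a) j..cell_bound TYPE('a) j}"
      using ts b c by (auto simp: cc cell_def h_def cell_index_def)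
    then have "\<bar>t' \<bullet> b / h\<bar> \<le> real_of_int (cell_bound TYPE('a) j) + 1" unfolding atLeastAtMost_iff by linarith
    also have "real_of_int (cell_bound TYPE('a) j) \<le> (2 ^ j + 1) / h + 2" unfolding cell_bound_def h_def by linarith
    finally have "\<bar>t' \<bullet> b\<bar> / h \<le> (2 ^ j + 1) / h + 3" using h by (simp add: abs_divide)
    then have "\<bar>t' \<bullet> b\<bar> \<le> 2 ^ j + 1 + 3 * h" using h by (simp add: field_simps)
    moreover have "erosion j \<le> 1" unfolding erosion_def by (intro power_le_one) auto
    ultimately show "\<bar>t' \<bullet> b\<bar> \<le> 2 ^ j + 4" using h by linarith
  qed
  have "dist (s *\<^sub>R t) (s' *\<^sub>R t') = norm (s *\<^sub>R (t - t') + (s - s') *\<^sub>R t')"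
    by (simp add: dist_norm algebra_simps)
  also have "\<dots> \<le> s * norm (t - t') + \<bar>s - s'\<bar> * norm t'"
    using norm_triangle_ineq[of "s *\<^sub>R (t - t')" "(s - s') *\<^sub>R t'"] s0 by simp
  also have "\<dots> \<le> 1 * (DIM('a) * h) + h * (DIM('a) * (2 ^ j + 4))"
    using s0 s1 tt ssh t' h by (intro add_mono mult_mono) auto
  also have "\<dots> = DIM('a) * h * (2 ^ j + 5)" by (simp add: algebra_simps)
  also have "\<dots> = erosion j" unfolding h_def by (rule mesh_le(2))
  finally show "dist (s *\<^sub>R t) (s' *\<^sub>R t') \<le> erosion j" .
qed

text \<open>Three errors of at most one erosion each: from \<open>x\<close> to the cell ball,
  between two centres of the cell, and between two radii.\<close>

lemma cell_subset_near:
  fixes x :: "'a::euclidean_space"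
  assumes j: "1 \<le> j" and c: "c \<in> cell_index j" and near: "x \<notin> far (erosion j) (cell_ball (j, c))"
  shows "cell (j, c) \<subseteq> {p. snd p \<in> level_interval j \<and> dist x (snd p *\<^sub>R fst p) \<le> snd p / 2 + 3 * erosion j}"
proof safe
  fix t s assume ts: "(t, s) \<in> cell (j, c)"
  show "snd (t, s) \<in> level_interval j" using ts by (cases c) (auto simp: cell_def)
  obtain y where y: "y \<in> cell_ball (j, c)" "dist x y \<le> erosion j" using near by (auto simp: far_def not_less)
  then obtain t' s' where t': "(t', s') \<in> cell (j, c)" "dist (s' *\<^sub>R t') y < s' / 2" by (auto simp: cell_ball_def)
  have "dist x (s *\<^sub>R t) \<le> dist x y + dist (s' *\<^sub>R t') y + dist (s' *\<^sub>R t') (s *\<^sub>R t)"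
    using dist_triangle[of x "s *\<^sub>R t" y] dist_triangle[of y "s *\<^sub>R t" "s' *\<^sub>R t'"] by (simp add: dist_commute)
  moreover have "dist (s' *\<^sub>R t') (s *\<^sub>R t) \<le> erosion j" "\<bar>s' - s\<bar> \<le> erosion j"
    by (rule cell_close[OF j c t'(1) ts])+
  ultimately have "dist x (s *\<^sub>R t) \<le> s / 2 + 3 * erosion j" using y(2) t'(2) erosion_pos[of j] by linarith
  then show "dist x (snd (t, s) *\<^sub>R fst (t, s)) \<le> snd (t, s) / 2 + 3 * erosion j" by simp
qed

text \<open>The cells that threaten \<open>x\<close> are disjoint and lie in the set of
  \<open>ppp_intensity_near_point\<close> with \<open>e = 3 * erosion n\<close>, so all are empty
  with probability at least \<open>exp (- q n)\<close>. Here \<open>q n\<close> exceeds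
  \<open>\<alpha> * ln 2\<close> by at most a multiple of \<open>1 / 2 ^ n\<close>, which gives
  \<kappa>. In the diameter constant 3, two radii contribute 2 and the distance of the centres
  1.\<close>

lemma ball_cutout_removal_model:
  fixes Y :: "'w \<Rightarrow> ('a::euclidean_space \<times> real) set"
  assumes M: "prob_space M" and r: "0 < r" and \<alpha>: "\<alpha> = r * measure lborel (ball (0::'a) (1/2))"
    and ppp: "poisson_point_process M (ppp_intensity r) Y"
  shows "removal_model M cell_index (\<lambda>c \<omega>. Y \<omega> \<inter> cell c \<noteq> {}) (cell_ball :: _ \<Rightarrow> 'a set) \<alpha> 3 (12 * \<alpha> * DIM('a) * 7 ^ DIM('a))"
proof -
  interpret prob_space M by (rule M)
  let ?\<nu> = "ppp_intensity r :: ('a \<times> real) measure"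
  let ?d = "DIM('a)"
  have \<alpha>pos: "0 < \<alpha>" unfolding \<alpha> using r content_ball_pos[of "1/2" "0::'a"] by simp
  have indep: "indep_vars (\<lambda>_. count_space UNIV) (\<lambda>c \<omega>. Y \<omega> \<inter> cell c \<noteq> {})
      (SIGMA j:{1..}. (cell_index j :: (('a \<Rightarrow> int) \<times> int) set))"
    by (rule indep_vars_nonempty_poisson[OF ppp cell_sets cell_disjoint])
  define q where "q j = \<alpha> * (1 + 6 * erosion j * 2 ^ j) ^ ?d * ln 2" for j
  define Bx where "Bx j x = {p :: 'a \<times> real. snd p \<in> level_interval j \<and> dist x (snd p *\<^sub>R fst p) \<le> snd p / 2 + 3 * erosion j}" for j x
  have Bx: "Bx j x \<in> sets ?\<nu>" "emeasure ?\<nu> (Bx j x) \<le> ennreal (q j)" for j x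
    using ppp_intensity_near_point[OF r, of "3 * erosion j" j x] erosion_pos[of j] unfolding Bx_def q_def \<alpha>
    by (simp_all add: mult.assoc)
  have q0: "0 \<le> q j" for j using \<alpha>pos erosion_pos[of j] by (simp add: q_def add_nonneg_nonneg)
  have cellfin: "emeasure ?\<nu> (cell (j, c)) < \<infinity>" if j: "1 \<le> j" "c \<in> cell_index j" for j and c :: "('a \<Rightarrow> int) \<times> int"
  proof (cases "cell (j, c) = {}")
    case False
    then obtain t s where ts: "(t, s) \<in> cell (j, c)" by auto
    have "0 < s" using cell_close(3)[OF j ts ts] .
    then have "s *\<^sub>R t \<in> cell_ball (j, c)" using ts unfolding cell_ball_def by force
    then have "s *\<^sub>R t \<notin> far (erosion j) (cell_ball (j, c))" using erosion_pos[of j] by (auto simp: far_def not_less intro!: bexI[of _ "s *\<^sub>R t"])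
    from cell_subset_near[OF j this] have "emeasure ?\<nu> (cell (j, c)) \<le> emeasure ?\<nu> (Bx j (s *\<^sub>R t))"
      unfolding Bx_def[symmetric] by (rule emeasure_mono[OF _ Bx(1)])
    also have "\<dots> \<le> ennreal (q j)" by (rule Bx(2))
    also have "\<dots> < \<infinity>" by simp
    finally show ?thesis .
  qed simp
  have void: "prob {\<omega>\<in>space M. Y \<omega> \<inter> cell (j, c) = {}} = exp (- enn2real (emeasure ?\<nu> (cell (j, c))))"
    if "1 \<le> j" "c \<in> cell_index j" for j and c :: "('a \<Rightarrow> int) \<times> int"
    by (rule prob_void_poisson[OF ppp cell_sets cellfin[OF that]])
  show ?thesis
  proof unfold_locales
    show "0 < \<alpha>" "(0::real) \<le> 3" "0 \<le> 12 * \<alpha> * ?d * 7 ^ ?d" using \<alpha>pos by auto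
    show "finite (cell_index n :: (('a \<Rightarrow> int) \<times> int) set)" for n by (rule finite_cell_index)
    show "indep_vars (\<lambda>_. count_space UNIV) (\<lambda>c \<omega>. Y \<omega> \<inter> cell c \<noteq> {})
      (SIGMA n:{1..}. (cell_index n :: (('a \<Rightarrow> int) \<times> int) set))" by (rule indep)
    show "dist x y \<le> 3 / 2 ^ n" if n: "1 \<le> n" "i \<in> cell_index n" and xy: "x \<in> cell_ball (n, i)" "y \<in> cell_ball (n, i)"
      for n and i :: "('a \<Rightarrow> int) \<times> int" and x y
    proof -
      obtain t s where ts: "(t, s) \<in> cell (n, i)" "dist (s *\<^sub>R t) x < s / 2" using xy by (auto simp: cell_ball_def)
      obtain t' s' where ts': "(t', s') \<in> cell (n, i)" "dist (s' *\<^sub>R t') y < s' / 2" using xy by (auto simp: cell_ball_def)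
      have "dist x y \<le> dist (s *\<^sub>R t) x + dist (s *\<^sub>R t) (s' *\<^sub>R t') + dist (s' *\<^sub>R t') y"
        using dist_triangle[of x y "s *\<^sub>R t"] dist_triangle[of "s *\<^sub>R t" y "s' *\<^sub>R t'"] by (simp add: dist_commute)
      moreover have "dist (s *\<^sub>R t) (s' *\<^sub>R t') \<le> erosion n" by (rule cell_close(1)[OF n ts(1) ts'(1)])
      moreover have "s < 2 / 2 ^ n" "s' < 2 / 2 ^ n"
        using cell_close(4)[OF n ts(1) ts(1)] cell_close(4)[OF n ts'(1) ts'(1)] by auto
      moreover have "erosion n \<le> 1 / 2 ^ n" using erosion_le[of n] by (simp add: power_one_over)
      moreover have "2 / 2 ^ n = 2 * (1 / 2 ^ n :: real)" "3 / 2 ^ n = 3 * (1 / 2 ^ n :: real)" by simp_all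
      ultimately show ?thesis using ts(2) ts'(2) by linarith
    qed
    show "0 < prob {\<omega>\<in>space M. \<not> Y \<omega> \<inter> cell (n, i) \<noteq> {}}" if "1 \<le> n" "i \<in> cell_index n" for n and i :: "('a \<Rightarrow> int) \<times> int"
      using void[OF that] by simp
    show "2 powr (- \<alpha>) * (1 - 12 * \<alpha> * ?d * 7 ^ ?d / 2 ^ n) \<le> prob {\<omega>\<in>space M. \<forall>i\<in>cell_index n. Y \<omega> \<inter> cell (n, i) \<noteq> {} \<longrightarrow>
        x \<in> far (erosion n) (cell_ball (n, i))}" if n: "1 \<le> n" for n and x :: 'a
    proof -
      define C where "C = {i\<in>cell_index n. x \<notin> far (erosion n) (cell_ball (n, i))}"
      have finC: "finite C" by (rule finite_subset[OF _ finite_cell_index[of n]]) (auto simp: C_def)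
      have CI: "i \<in> cell_index n" if "i \<in> C" for i using that by (simp add: C_def)
      have set_eq: "{\<omega>\<in>space M. \<forall>i\<in>cell_index n. Y \<omega> \<inter> cell (n, i) \<noteq> {} \<longrightarrow> x \<in> far (erosion n) (cell_ball (n, i))}
        = {\<omega>\<in>space M. \<forall>i\<in>C. Y \<omega> \<inter> cell (n, i) = {}}" by (auto simp: C_def)
      have pe: "prob {\<omega>\<in>space M. \<forall>i\<in>C. Y \<omega> \<inter> cell (n, i) = {}} = exp (- (\<Sum>i\<in>C. enn2real (emeasure ?\<nu> (cell (n, i)))))"
      proof (cases "C = {}")
        case True
        then show ?thesis by (simp add: prob_space)
      next
        case False
        have "prob (\<Inter>p\<in>Pair n ` C. (\<lambda>\<omega>. Y \<omega> \<inter> cell p \<noteq> {}) -` {False} \<inter> space M)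
          = (\<Prod>p\<in>Pair n ` C. prob ((\<lambda>\<omega>. Y \<omega> \<inter> cell p \<noteq> {}) -` {False} \<inter> space M))"
          by (rule indep_varsD[OF indep]) (use False finC n CI in auto)
        moreover have "(\<Inter>p\<in>Pair n ` C. (\<lambda>\<omega>. Y \<omega> \<inter> cell p \<noteq> {}) -` {False} \<inter> space M) = {\<omega>\<in>space M. \<forall>i\<in>C. Y \<omega> \<inter> cell (n, i) = {}}"
          using False by auto
        moreover have "(\<Prod>p\<in>Pair n ` C. prob ((\<lambda>\<omega>. Y \<omega> \<inter> cell p \<noteq> {}) -` {False} \<inter> space M)) = (\<Prod>i\<in>C. exp (- enn2real (emeasure ?\<nu> (cell (n, i)))))"
        proof -
          have "(\<lambda>\<omega>. Y \<omega> \<inter> cell (n, i) \<noteq> {}) -` {False} \<inter> space M = {\<omega>\<in>space M. Y \<omega> \<inter> cell (n, i) = {}}" for i by auto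
          then show ?thesis using void[OF n CI] by (subst prod.reindex) (auto simp: inj_on_def intro!: prod.cong)
        qed
        ultimately show ?thesis using finC by (simp add: exp_sum[symmetric] sum_negf)
      qed
      have sumle: "(\<Sum>i\<in>C. enn2real (emeasure ?\<nu> (cell (n, i)))) \<le> q n"
      proof -
        have disjC: "disjoint_family_on (\<lambda>i. cell (n, i)) C"
          unfolding disjoint_family_on_def
        proof (intro ballI impI)
          fix i k assume ik: "i \<in> C" "k \<in> C" "i \<noteq> k"
          show "cell (n, i) \<inter> cell (n, k) = {}"
            by (rule cell_disjoint[unfolded disjoint_family_on_def, rule_format]) (use ik n CI in auto)
        qed
        have sub: "(\<Union>i\<in>C. cell (n, i)) \<subseteq> Bx n x"
          using cell_subset_near[OF n] unfolding Bx_def C_def by blast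
        have "(\<Sum>i\<in>C. emeasure ?\<nu> (cell (n, i))) = emeasure ?\<nu> (\<Union>i\<in>C. cell (n, i))"
          by (rule sum_emeasure[OF _ disjC finC]) (use cell_sets in auto)
        also have "\<dots> \<le> emeasure ?\<nu> (Bx n x)" by (rule emeasure_mono[OF sub Bx(1)])
        also have "\<dots> \<le> ennreal (q n)" by (rule Bx(2))
        finally have "(\<Sum>i\<in>C. emeasure ?\<nu> (cell (n, i))) \<le> ennreal (q n)" .
        moreover have "emeasure ?\<nu> (cell (n, i)) = ennreal (enn2real (emeasure ?\<nu> (cell (n, i))))" if "i \<in> C" for i
          using cellfin[OF n CI[OF that]] by simp
        ultimately have "ennreal (\<Sum>i\<in>C. enn2real (emeasure ?\<nu> (cell (n, i)))) \<le> ennreal (q n)"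
          by (subst sum_ennreal[symmetric]) (auto cong: sum.cong)
        then show ?thesis using q0 by (simp add: ennreal_le_iff)
      qed
      \<comment> \<open>The relative enlargement of the balls. It is at most
        \<open>12 / 2 ^ n\<close>, because \<open>2 * n \<le> n\<^sup>2 + 1\<close>.\<close>
      define u where "u = 6 * erosion n * 2 ^ n"
      have u: "0 \<le> u" "u \<le> 12 / 2 ^ n" "u \<le> 6"
      proof -
        show "0 \<le> u" using erosion_pos[of n] by (simp add: u_def)
        have "n + n \<le> n ^ 2 + 1"
        proof -
          have "2 * int n \<le> (int n)\<^sup>2 + 1" using zero_le_power2[of "int n - 1"] by (simp add: power2_eq_square algebra_simps)
          then have "int (n + n) \<le> int (n ^ 2 + 1)" by simp
          then show ?thesis by (simp only: of_nat_le_iff)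
        qed
        then have "(2::real) ^ (n + n) \<le> 2 ^ (n ^ 2 + 1)" by (intro power_increasing) auto
        then have "(2::real) ^ n * 2 ^ n \<le> 2 * 2 ^ (n ^ 2)" by (simp add: power_add)
        then show "u \<le> 12 / 2 ^ n" unfolding u_def erosion_def by (simp add: power_one_over field_simps)
        have "(2::real) ^ 1 \<le> 2 ^ n" using n by (intro power_increasing) auto
        then have "12 / 2 ^ n \<le> (12 / 2 :: real)" by (intro divide_left_mono) auto
        then show "u \<le> 6" using \<open>u \<le> 12 / 2 ^ n\<close> by linarith
      qed
      have "(1 + u) ^ ?d \<le> 1 + real ?d * 7 ^ ?d * u" by (rule one_plus_power_le[OF u(1,3)])
      also have "\<dots> \<le> 1 + real ?d * 7 ^ ?d * (12 / 2 ^ n)" using u by (intro add_left_mono mult_left_mono) auto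
      finally have "q n \<le> \<alpha> * (1 + real ?d * 7 ^ ?d * (12 / 2 ^ n)) * ln 2"
        unfolding q_def u_def using \<alpha>pos by (intro mult_right_mono mult_left_mono) auto
      then have qle: "q n \<le> \<alpha> * ln 2 + (12 * \<alpha> * ?d * 7 ^ ?d / 2 ^ n) * ln 2" by (simp add: algebra_simps)
      define z where "z = 12 * \<alpha> * ?d * 7 ^ ?d / 2 ^ n"
      have z: "0 \<le> z" using \<alpha>pos by (simp add: z_def)
      \<comment> \<open>\<open>z * ln 2\<close> bounds the surplus in the exponent, and
        \<open>1 - y \<le> exp (- y)\<close> converts it into the factor
        \<open>1 - z\<close>.\<close>
      have "1 - z \<le> 1 - z * ln 2" using z ln2_le_25_over_36 mult_left_mono[of "ln 2" 1 z] by simp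
      also have "\<dots> \<le> exp (- (z * ln 2))" using exp_ge_add_one_self[of "- (z * ln 2)"] by simp
      finally have "2 powr (- \<alpha>) * (1 - z) \<le> 2 powr (- \<alpha>) * exp (- (z * ln 2))" by (intro mult_left_mono) auto
      also have "\<dots> = exp (- (\<alpha> * ln 2 + z * ln 2))" by (simp add: powr_def exp_add[symmetric])
      also have "\<dots> \<le> exp (- (\<Sum>i\<in>C. enn2real (emeasure ?\<nu> (cell (n, i)))))"
        using sumle qle by (simp add: z_def)
      finally show ?thesis unfolding set_eq pe z_def .
    qed
  qed
qed

text \<open>A ball of the process that covers \<open>x\<close> comes from a point
  \<open>(t, s)\<close> whose level is the least \<open>j\<close> with
  \<open>1 / 2 ^ j \<le> s\<close>. Level 0 is excluded by \<open>s < 1\<close>, and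
  \<open>norm x < 1\<close> keeps the cell of \<open>(t, s)\<close> within the index bounds.\<close>

lemma ball_Diff_removed_subset_cutout:
  fixes x :: "'a::euclidean_space"
  assumes x: "norm x < 1"
    and keep: "\<And>j c. j \<in> {1..n} \<Longrightarrow> c \<in> cell_index j \<Longrightarrow> x \<in> cell_ball (j, c) \<Longrightarrow> Y \<omega> \<inter> cell (j, c) = {}"
  shows "x \<in> cutout_set Y \<omega> n"
proof (rule ccontr)
  assume "x \<notin> cutout_set Y \<omega> n"
  then obtain t s where ts: "(t, s) \<in> Y \<omega>" "2 powr (- real n) \<le> s" "s < 1" "x \<in> ball (s *\<^sub>R t) (s / 2)"
    using x by (auto simp: cutout_set_def)
  have sn: "1 / 2 ^ n \<le> s" using ts(2) by (simp add: powr_minus powr_realpow inverse_eq_divide)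
  have s0: "0 < s" using sn less_le_trans[of 0 "1 / 2 ^ n" s] by simp
  define j where "j = (LEAST j. 1 / 2 ^ j \<le> s)"
  have js: "1 / 2 ^ j \<le> s" unfolding j_def by (rule LeastI[of "\<lambda>j. 1 / 2 ^ j \<le> s" n, OF sn])
  have jn: "j \<le> n" unfolding j_def by (rule Least_le[of "\<lambda>j. 1 / 2 ^ j \<le> s", OF sn])
  have "j \<noteq> 0"
  proof
    assume "j = 0"
    then show False using js ts(3) by simp
  qed
  then obtain i where i: "j = Suc i" by (cases j) auto
  have "\<not> 1 / 2 ^ i \<le> s" using not_less_Least[of i "\<lambda>j. 1 / 2 ^ j \<le> s"] i by (simp add: j_def[symmetric])
  then have slev: "s \<in> level_interval j" using js i by (simp add: level_interval_def)
  define h where "h = mesh TYPE('a) j"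
  have h: "0 < h" by (simp add: h_def mesh_pos)
  define k :: "'a \<Rightarrow> int" where "k b = (if b \<in> Basis then \<lfloor>t \<bullet> b / h\<rfloor> else 0)" for b
  define l where "l = \<lfloor>s / h\<rfloor>"
  have tsc: "(t, s) \<in> cell (j, k, l)" using slev by (auto simp: cell_def k_def l_def h_def)
  have nt: "norm t \<le> 2 ^ j + 1"
  proof -
    have "norm (s *\<^sub>R t) \<le> norm x + dist (s *\<^sub>R t) x" by (metis dist_norm norm_triangle_sub)
    then have "s * norm t < 1 + s / 2" using x ts(4) s0 by simp
    then have "norm t < 1 / s + 1 / 2" using s0 by (simp add: field_simps)
    moreover have "1 / s \<le> 2 ^ j" using js s0 by (simp add: field_simps)
    ultimately show ?thesis by linarith
  qed
  have cb: "(2 ^ j + 1) / h + 1 \<le> real_of_int (cell_bound TYPE('a) j)" unfolding cell_bound_def h_def by linarith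
  have "k b \<in> {- cell_bound TYPE('a) j..cell_bound TYPE('a) j}" if b: "b \<in> Basis" for b
  proof -
    have "\<bar>t \<bullet> b\<bar> \<le> 2 ^ j + 1" using Basis_le_norm[OF b, of t] nt by linarith
    then have "\<bar>t \<bullet> b / h\<bar> \<le> (2 ^ j + 1) / h" using h by (simp add: abs_divide divide_right_mono)
    then show ?thesis using cb b unfolding k_def atLeastAtMost_iff by (simp; linarith)
  qed
  moreover have "l \<in> {0..cell_bound TYPE('a) j}"
  proof -
    have "s / h \<le> (2 ^ j + 1) / h" using ts(3) h by (intro divide_right_mono) (auto intro: order_trans[of s 1])
    moreover have "0 \<le> s / h" using s0 h by simp
    ultimately show ?thesis using cb unfolding l_def atLeastAtMost_iff by linarith
  qed
  ultimately have "(k, l) \<in> cell_index j" by (auto simp: cell_index_def k_def)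
  moreover have "x \<in> cell_ball (j, k, l)" using tsc ts(4) by (auto simp: cell_ball_def intro!: bexI[of _ "(t, s)"])
  moreover have "j \<in> {1..n}" using jn \<open>j \<noteq> 0\<close> by simp
  ultimately have "Y \<omega> \<inter> cell (j, k, l) = {}" using keep by blast
  then show False using ts(1) tsc by blast
qed

theorem ball_cutout_support_meets_all_attractors:
  fixes M :: "'w measure" and \<mu> :: "nat \<Rightarrow> 'w \<Rightarrow> 'a::euclidean_space \<Rightarrow> real"
  assumes M: "prob_space M" and model: "ball_cutout_model M \<alpha> \<mu>"
    and lim: "AE \<omega> in M. sets (\<mu>inf \<omega>) = sets borel \<and> finite_measure (\<mu>inf \<omega>) \<and>
       weak_conv_measures (\<lambda>n. density lborel (\<lambda>x. ennreal (\<mu> n \<omega> x))) (\<mu>inf \<omega>)"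
    and \<Gamma>: "\<Gamma> \<subseteq> sim_tuples m" "ifs_compact \<Gamma>"
    and F: "\<forall>F\<in>\<Gamma>. \<not> in_hyperplane (attractor F)"
      "\<forall>F\<in>\<Gamma>. \<forall>\<omega>\<in>space M. attractor F \<inter> interior (msupp (density lborel (\<lambda>x. ennreal (\<mu> 0 \<omega> x)))) \<noteq> {}"
      "\<forall>F\<in>\<Gamma>. hausdorff_dim (attractor F) > \<alpha>"
  shows "\<exists>B\<in>sets M. 0 < measure M B \<and> (\<forall>\<omega>\<in>B. \<forall>F\<in>\<Gamma>. msupp (\<mu>inf \<omega>) \<inter> attractor F \<noteq> {})"
proof -
  from model[unfolded ball_cutout_model_def] obtain r and Y :: "'w \<Rightarrow> ('a \<times> real) set" where
    H: "0 < r \<and> \<alpha> = r * measure lborel (ball (0::'a) (1/2)) \<and> poisson_point_process M (ppp_intensity r) Y \<and>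
      (\<forall>n \<omega> x. \<mu> n \<omega> x = 2 powr (\<alpha> * real n) * indicator (cutout_set Y \<omega> n) x)"
    by (elim exE) (rule that)
  note rY = H[THEN conjunct1] H[THEN conjunct2, THEN conjunct1] H[THEN conjunct2, THEN conjunct2, THEN conjunct1]
    H[THEN conjunct2, THEN conjunct2, THEN conjunct2]
  interpret removal_model M cell_index "\<lambda>c \<omega>. Y \<omega> \<inter> cell c \<noteq> {}" "cell_ball :: _ \<Rightarrow> 'a set" \<alpha> 3 "12 * \<alpha> * DIM('a) * 7 ^ DIM('a)"
    by (rule ball_cutout_removal_model[OF M rY(1,2,3)])
  show ?thesis
  proof (rule support_meets_all_attractors[where C = "cball 0 1" and A = "cutout_set Y", OF _ _ _ _ _ _ lim \<Gamma> F])
    show "interior (cball 0 1) - removed \<omega> n \<subseteq> cutout_set Y \<omega> n" if "\<omega> \<in> space M" for \<omega> n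
    proof
      fix x assume x: "x \<in> interior (cball 0 1) - removed \<omega> n"
      show "x \<in> cutout_set Y \<omega> n"
      proof (rule ball_Diff_removed_subset_cutout)
        show "norm x < 1" using x by simp
        fix j and c :: "('a \<Rightarrow> int) \<times> int" assume jc: "j \<in> {1..n}" "c \<in> cell_index j" "x \<in> cell_ball (j, c)"
        show "Y \<omega> \<inter> cell (j, c) = {}"
        proof (rule ccontr)
          assume "Y \<omega> \<inter> cell (j, c) \<noteq> {}"
          then have "(j, c) \<in> config (J n) \<omega>" using jc by (simp add: config_def J_def)
          then have "x \<in> removed \<omega> n" unfolding removed_def using jc(3) by (rule UN_I)
          then show False using x by blast
        qed
      qed
    qed
    \<comment> \<open>Measurability follows from openness, which holds for unions of arbitrarily
      many balls.\<close>
    have "open (\<Union>{ball (s *\<^sub>R t) (s / 2) | t s. (t, s) \<in> Y \<omega> \<and> 2 powr (- real n) \<le> s \<and> s < 1})" for \<omega> n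
      by (intro open_Union) auto
    then show "cutout_set Y \<omega> n \<in> sets borel" for \<omega> n unfolding cutout_set_def by auto
    show "bounded (cutout_set Y \<omega> n)" for \<omega> n
      unfolding cutout_set_def by (rule bounded_subset[OF bounded_ball[of 0 1]]) auto
    show "cutout_set Y \<omega> 0 \<subseteq> cball 0 1" for \<omega> unfolding cutout_set_def by auto
    show "\<mu> n \<omega> x = 2 powr (\<alpha> * real n) * indicator (cutout_set Y \<omega> n) x" for n \<omega> x using rY(4) by simp
  qed (rule closed_cball)
qed

theorem theorem9p5:
  fixes M :: "'w measure" and \<alpha> :: real and m :: nat
    and \<mu> :: "nat \<Rightarrow> 'w \<Rightarrow> 'a::euclidean_space \<Rightarrow> real"
    and \<mu>inf :: "'w \<Rightarrow> 'a measure"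
    and \<Gamma> :: "('a \<Rightarrow> 'a) list set"
  assumes "prob_space M" and "0 < \<alpha>"
    and "ball_cutout_model M \<alpha> \<mu> \<or> fractal_percolation_model M \<alpha> \<mu>"
    and "AE \<omega> in M. sets (\<mu>inf \<omega>) = sets borel \<and> finite_measure (\<mu>inf \<omega>) \<and>
           weak_conv_measures (\<lambda>n. density lborel (\<lambda>x. ennreal (\<mu> n \<omega> x))) (\<mu>inf \<omega>)"
    and "\<Gamma> \<subseteq> sim_tuples m" and "ifs_compact \<Gamma>"
    and "\<forall>F\<in>\<Gamma>. \<not> in_hyperplane (attractor F)"
    and "\<forall>F\<in>\<Gamma>. \<forall>\<omega>\<in>space M.
           attractor F \<inter> interior (msupp (density lborel (\<lambda>x. ennreal (\<mu> 0 \<omega> x)))) \<noteq> {}"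
    and "\<forall>F\<in>\<Gamma>. hausdorff_dim (attractor F) > \<alpha>"
  shows "\<exists>A\<in>sets M. measure M A > 0 \<and> (\<forall>\<omega>\<in>A. \<forall>F\<in>\<Gamma>. msupp (\<mu>inf \<omega>) \<inter> attractor F \<noteq> {})"
  using assms(3)
proof
  assume "ball_cutout_model M \<alpha> \<mu>"
  then show ?thesis by (rule ball_cutout_support_meets_all_attractors[OF assms(1) _ assms(4-9)])
next
  assume "fractal_percolation_model M \<alpha> \<mu>"
  then show ?thesis by (rule percolation_support_meets_all_attractors[OF assms(1,2) _ assms(4-9)])
qed

end
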